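(* Let $G$ be a finite simple graph, let $\pi=\{W_1,\ldots,W_r\}$ be a clique partition of $G$, let $n_1,\ldots,n_r$ be positive integers, and let $S=\Bbbk[V(G^\pi[n_1,\ldots,n_r])]$, where $G^\pi[n_1,\ldots,n_r]$ is the multi-clique-whiskered graph of $G$ with respect to $\pi$. Then $$\mathrm{reg}\,S/I(G^\pi[n_1,\ldots,n_r])=\mathrm{im}(G^\pi[n_1,\ldots,n_r]).$$
   Context: $\Bbbk$ is an arbitrary field. A clique partition $\pi=\{W_1,\ldots,W_r\}$ of $G$ is a family of cliques (vertex sets inducing complete subgraphs) whose disjoint union is $V(G)$. The multi-clique-whiskered graph $G^\pi[n_1,\ldots,n_r]$ has vertex set $V(G)\cup\{w_{i,k}:1\le i\le r,\ 1\le k\le n_i\}$ (new vertices $w_{i,k}$) and edge set $E(G)\cup\bigcup_{i=1}^r\{\{x,w_{i,k}\}: x\in W_i,\ 1\le k\le n_i\}$. The edge ideal $I(\Gamma)\subseteq\Bbbk[V(\Gamma)]$ of a graph $\Gamma$ is generated by $uv$, $\{u,v\}\in E(\Gamma)$. $\mathrm{reg}$ is Castelnuovo--Mumford regularity. A matching $M$ is a set of pairwise disjoint edges; it is induced if no edge of $E(\Gamma)\setminus M$ is contained in the union of the edges of $M$; $\mathrm{im}(\Gamma)$ is the maximal size of an induced matching. *)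

theory Defs
  imports
    "HOL-Library.Ramsey"
    "HOL-Library.Disjoint_Sets"
    "HOL-Library.Poly_Mapping"
    "HOL-Library.Extended_Real"
    "Jordan_Normal_Form.Matrix"
begin

section \<open>Graphs\<close>

definition simple_graph :: "'a set \<Rightarrow> 'a set set \<Rightarrow> bool" where
  "simple_graph V E \<longleftrightarrow> finite V \<and> (\<forall>e\<in>E. e \<subseteq> V \<and> card e = 2)"

definition matching :: "'a set set \<Rightarrow> 'a set set \<Rightarrow> bool" where
  "matching E M \<longleftrightarrow> M \<subseteq> E \<and> disjoint M"

definition induced_matching :: "'a set set \<Rightarrow> 'a set set \<Rightarrow> bool" where
  "induced_matching E M \<longleftrightarrow> matching E M \<and> (\<forall>e\<in>E - M. \<not> e \<subseteq> \<Union>M)"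

definition induced_matching_number :: "'a set set \<Rightarrow> nat" where
  "induced_matching_number E = Max {card M | M. induced_matching E M}"

text \<open>The parts are indexed, and a part may be empty (the empty set is a clique).\<close>

definition clique_partition :: "'a set \<Rightarrow> 'a set set \<Rightarrow> nat \<Rightarrow> (nat \<Rightarrow> 'a set) \<Rightarrow> bool" where
  "clique_partition V E r W \<longleftrightarrow>
     (\<forall>i\<in>{1..r}. clique (W i) E) \<and> disjoint_family_on W {1..r} \<and> (\<Union>i\<in>{1..r}. W i) = V"

datatype 'a whisker_vertex = Orig 'a | Whisk nat nat

definition whiskered_verts :: "'a set \<Rightarrow> nat \<Rightarrow> (nat \<Rightarrow> nat) \<Rightarrow> 'a whisker_vertex set" where
  "whiskered_verts V r n = Orig ` V \<union> {Whisk i k | i k. i \<in> {1..r} \<and> k \<in> {1..n i}}"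

definition whiskered_edges ::
  "'a set set \<Rightarrow> nat \<Rightarrow> (nat \<Rightarrow> 'a set) \<Rightarrow> (nat \<Rightarrow> nat) \<Rightarrow> 'a whisker_vertex set set" where
  "whiskered_edges E r W n =
     (\<lambda>e. Orig ` e) ` E \<union>
     {{Orig x, Whisk i k} | x i k. i \<in> {1..r} \<and> x \<in> W i \<and> k \<in> {1..n i}}"

section \<open>Polynomial rings and edge ideals\<close>

type_synonym ('v, 'k) mpoly = "('v \<Rightarrow>\<^sub>0 nat) \<Rightarrow>\<^sub>0 'k"

text \<open>The ring \<open>k[V]\<close> is the subring of those polynomials that only involve variables in \<open>V\<close>.\<close>

definition polys :: "'v set \<Rightarrow> ('v, 'k::field) mpoly set" where
  "polys V = {p. \<forall>m\<in>Poly_Mapping.keys p. Poly_Mapping.keys m \<subseteq> V}"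

definition Var :: "'v \<Rightarrow> ('v, 'k::field) mpoly" where
  "Var x = Poly_Mapping.single (Poly_Mapping.single x 1) 1"

definition mon_degree :: "('v \<Rightarrow>\<^sub>0 nat) \<Rightarrow> nat" where
  "mon_degree m = (\<Sum>x\<in>Poly_Mapping.keys m. Poly_Mapping.lookup m x)"

text \<open>Degrees are integers since they arise as differences of shifts; the only homogeneous
  element of negative degree is \<open>0\<close>, which is homogeneous of every degree.\<close>

definition homogeneous :: "int \<Rightarrow> ('v, 'k::field) mpoly \<Rightarrow> bool" where
  "homogeneous e p \<longleftrightarrow> (\<forall>m\<in>Poly_Mapping.keys p. int (mon_degree m) = e)"

definition generated_ideal :: "'v set \<Rightarrow> ('v, 'k::field) mpoly set \<Rightarrow> ('v, 'k) mpoly set" where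
  "generated_ideal V A =
     {(\<Sum>a\<in>A'. c a * a) | A' c. finite A' \<and> A' \<subseteq> A \<and> c ` A' \<subseteq> polys V}"

definition edge_ideal :: "'v set \<Rightarrow> 'v set set \<Rightarrow> ('v, 'k::field) mpoly set" where
  "edge_ideal V E = generated_ideal V {Var u * Var v | u v. {u, v} \<in> E}"

section \<open>Minimal graded free resolutions and regularity\<close>

definition free_module :: "'v set \<Rightarrow> nat \<Rightarrow> ('v, 'k::field) mpoly vec set" where
  "free_module V n = {v \<in> carrier_vec n. \<forall>b<n. v $ b \<in> polys V}"

text \<open>
  With \<open>S = k[V]\<close>, the following describes a graded free resolution of the \<open>S\<close>-module \<open>S/I\<close>,
  \<open>\<dots> \<rightarrow> F 2 \<rightarrow> F 1 \<rightarrow> F 0 \<rightarrow> S/I \<rightarrow> 0\<close>, by free modules of finite rank.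
  Here \<open>F i\<close> is free of rank \<open>\<rho> i\<close> and its \<open>b\<close>-th basis element has degree \<open>d i b\<close>, i.e.
  \<open>F i\<close> is the direct sum of the \<open>S(- d i b)\<close> for \<open>b < \<rho> i\<close>. The matrix \<open>\<phi> i\<close> is that of
  \<open>F (i + 1) \<rightarrow> F i\<close>. The augmentation \<open>F 0 \<rightarrow> S/I\<close> is given by homogeneous representatives
  \<open>\<epsilon> $ b\<close> in \<open>S\<close> of the images of the basis elements of \<open>F 0\<close>.
  The last three conjuncts are surjectivity of the augmentation, exactness at \<open>F 0\<close>
  and exactness at \<open>F (i + 1)\<close>.
\<close>

definition graded_free_resolution ::
  "'v set \<Rightarrow> ('v, 'k::field) mpoly set \<Rightarrow> (nat \<Rightarrow> nat) \<Rightarrow> (nat \<Rightarrow> nat \<Rightarrow> int) \<Rightarrow>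
   ('v, 'k) mpoly vec \<Rightarrow> (nat \<Rightarrow> ('v, 'k) mpoly mat) \<Rightarrow> bool" where
  "graded_free_resolution V I \<rho> d \<epsilon> \<phi> \<longleftrightarrow>
     \<epsilon> \<in> free_module V (\<rho> 0) \<and>
     (\<forall>b<\<rho> 0. homogeneous (d 0 b) (\<epsilon> $ b)) \<and>
     (\<forall>i. \<phi> i \<in> carrier_mat (\<rho> i) (\<rho> (Suc i)) \<and>
        (\<forall>a<\<rho> i. \<forall>b<\<rho> (Suc i).
           \<phi> i $$ (a, b) \<in> polys V \<and> homogeneous (d (Suc i) b - d i a) (\<phi> i $$ (a, b)))) \<and>
     (\<forall>p\<in>polys V. \<exists>v\<in>free_module V (\<rho> 0). p - \<epsilon> \<bullet> v \<in> I) \<and>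
     {v \<in> free_module V (\<rho> 0). \<epsilon> \<bullet> v \<in> I} = (\<lambda>w. \<phi> 0 *\<^sub>v w) ` free_module V (\<rho> 1) \<and>
     (\<forall>i. {v \<in> free_module V (\<rho> (Suc i)). \<phi> i *\<^sub>v v = 0\<^sub>v (\<rho> i)} =
          (\<lambda>w. \<phi> (Suc i) *\<^sub>v w) ` free_module V (\<rho> (Suc (Suc i))))"

text \<open>Minimality: the image of \<open>F (i + 1) \<rightarrow> F i\<close> lies in \<open>\<mm> F i\<close>, where \<open>\<mm>\<close> is the ideal
  generated by the variables, i.e. all matrix entries have constant term \<open>0\<close>.\<close>

definition minimal_graded_free_resolution ::
  "'v set \<Rightarrow> ('v, 'k::field) mpoly set \<Rightarrow> (nat \<Rightarrow> nat) \<Rightarrow> (nat \<Rightarrow> nat \<Rightarrow> int) \<Rightarrow>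
   ('v, 'k) mpoly vec \<Rightarrow> (nat \<Rightarrow> ('v, 'k) mpoly mat) \<Rightarrow> bool" where
  "minimal_graded_free_resolution V I \<rho> d \<epsilon> \<phi> \<longleftrightarrow>
     graded_free_resolution V I \<rho> d \<epsilon> \<phi> \<and>
     (\<forall>i. \<forall>a<\<rho> i. \<forall>b<\<rho> (Suc i). Poly_Mapping.lookup (\<phi> i $$ (a, b)) 0 = 0)"

text \<open>The graded Betti number \<open>\<beta>\<^sub>i\<^sub>,\<^sub>j(S/I)\<close>: the number of summands \<open>S(-j)\<close> of \<open>F i\<close> in a minimal
  graded free resolution of \<open>S/I\<close>. For finite \<open>V\<close> and homogeneous \<open>I\<close>
  such a resolution exists, and this number does not depend on the choice of it.\<close>

definition graded_betti :: "'v set \<Rightarrow> ('v, 'k::field) mpoly set \<Rightarrow> nat \<Rightarrow> int \<Rightarrow> nat" where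
  "graded_betti V I i j =
     (THE \<beta>. \<exists>\<rho> d \<epsilon> \<phi>. minimal_graded_free_resolution V I \<rho> d \<epsilon> \<phi> \<and>
        \<beta> = card {b. b < \<rho> i \<and> d i b = j})"

text \<open>The Castelnuovo--Mumford regularity of \<open>S/I\<close>, with value \<open>-\<infinity>\<close> for the zero module.\<close>

definition reg_quotient :: "'v set \<Rightarrow> ('v, 'k::field) mpoly set \<Rightarrow> ereal" where
  "reg_quotient V I =
     Sup {ereal (real_of_int (j - int i)) | i j. graded_betti V I i j \<noteq> 0}"

end

theory Submission
  imports Defs "Jordan_Normal_Form.Determinant"
begin

text \<open>
  \<^bold>\<open>Upper bound.\<close> For a variable \<open>x\<close> and a homogeneous ideal \<open>I\<close>, resolutions of the outer terms of
  \<open>0 \<rightarrow> S/(I : x)(-1) \<rightarrow> S/I \<rightarrow> S/(I + (x)) \<rightarrow> 0\<close> combine to one of \<open>S/I\<close> (lemma \<open>horseshoe\<close>), so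
  that \<open>reg S/I \<le> max (reg S/(I : x) + 1) (reg S/(I + (x)))\<close>. Let \<open>I\<close> be the edge ideal of the
  whiskered graph, and let \<open>x\<close> be a vertex of \<open>G\<close>. Up to variables, \<open>I + (x)\<close> and \<open>I : x\<close> are the edge
  ideals of the graphs that result from the deletion of \<open>x\<close> and of the closed neighbourhood of \<open>x\<close>,
  and both of these are whiskered graphs again. An induced matching that avoids the closed
  neighbourhood of \<open>x\<close> stays induced when \<open>{x, w}\<close> is added, where \<open>w\<close> is a whisker vertex at the
  clique of \<open>x\<close>: all neighbours of \<open>w\<close> are \<open>x\<close> or neighbours of \<open>x\<close>. By induction on the number of
  vertices of \<open>G\<close>, there is a finite resolution whose \<open>i\<close>-th module is generated in degrees at most
  \<open>i + im\<close> (lemma \<open>bounded_res_dominated_whiskers\<close>). In the base case there are no edges, and the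
  Koszul complex on variables is built by iterated mapping cones (lemma \<open>mapping_cone\<close>).

  \<^bold>\<open>Lower bound.\<close> For an induced matching \<open>M\<close> with vertex set \<open>U\<close>, the ring \<open>k[U]/I(M)\<close> is an algebra
  retract of \<open>S/I\<close>: the variables outside \<open>U\<close> are mapped to 0. Lifting the inclusion and the retraction
  to resolutions shows that Betti numbers of \<open>k[U]/I(M)\<close> are at most those of \<open>S/I\<close>
  (lemma \<open>betti_retract_le\<close>). Since \<open>I(M)\<close> is generated by a regular sequence of \<open>m = card M\<close> quadrics,
  the Betti number of \<open>k[U]/I(M)\<close> in homological degree \<open>m\<close> and degree \<open>2m\<close> is not 0
  (lemma \<open>disjoint_edges_resolution\<close>).

  \<^bold>\<open>Betti numbers.\<close> They are well defined because a finite resolution becomes minimal by cancelling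
  pairs of basis elements (lemma \<open>exists_minimal_gres\<close>), which keeps the bounds on the degrees, and
  because \<open>betti_retract_le\<close> with \<open>U = V\<close> yields that two minimal resolutions have the same Betti numbers.
\<close>

section \<open>Polynomials and homogeneous ideals\<close>

lemma polys_zero [simp, intro]: "0 \<in> polys V"
  and polys_one [simp, intro]: "1 \<in> polys V"
  by (auto simp: polys_def)

lemma polys_add [intro]: "p \<in> polys V \<Longrightarrow> q \<in> polys V \<Longrightarrow> p + q \<in> polys V"
  using keys_add[of p q] by (fastforce simp: polys_def)

lemma keys_uminus_poly [simp]: "Poly_Mapping.keys (- p) = Poly_Mapping.keys (p :: 'b \<Rightarrow>\<^sub>0 'c::ab_group_add)"
  by (auto simp: in_keys_iff)

lemma polys_uminus [intro]: "p \<in> polys V \<Longrightarrow> - p \<in> polys V"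
  by (simp add: polys_def)

lemma polys_diff [intro]: "p \<in> polys V \<Longrightarrow> q \<in> polys V \<Longrightarrow> p - q \<in> polys V"
  using polys_add[of p V "- q"] polys_uminus[of q V] by simp

lemma keys_add_nat:
  "Poly_Mapping.keys (m + m') = Poly_Mapping.keys m \<union> Poly_Mapping.keys (m' :: 'v \<Rightarrow>\<^sub>0 nat)"
  by (auto simp: in_keys_iff lookup_add)

lemma polys_mult [intro]:
  assumes "p \<in> polys V" "q \<in> polys V"
  shows "p * q \<in> polys V"
  using keys_mult[of p q] assms unfolding polys_def by (fastforce simp: keys_add_nat)

lemma polys_sum [intro]: "(\<And>a. a \<in> A \<Longrightarrow> f a \<in> polys V) \<Longrightarrow> (\<Sum>a\<in>A. f a) \<in> polys V"
  by (induction A rule: infinite_finite_induct) auto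

lemma polys_mono: "U \<subseteq> V \<Longrightarrow> p \<in> polys U \<Longrightarrow> p \<in> polys V"
  by (auto simp: polys_def)

lemma polys_const [intro]: "Poly_Mapping.single 0 c \<in> polys V"
  by (auto simp: polys_def)

lemma homogeneous_zero [simp, intro]: "homogeneous e 0"
  by (simp add: homogeneous_def)

lemma homogeneous_add [intro]: "homogeneous e p \<Longrightarrow> homogeneous e q \<Longrightarrow> homogeneous e (p + q)"
  using keys_add[of p q] by (fastforce simp: homogeneous_def)

lemma homogeneous_uminus [intro]: "homogeneous e p \<Longrightarrow> homogeneous e (- p)"
  by (simp add: homogeneous_def)

lemma homogeneous_diff [intro]: "homogeneous e p \<Longrightarrow> homogeneous e q \<Longrightarrow> homogeneous e (p - q)"
  using homogeneous_add[of e p "- q"] homogeneous_uminus[of e q] by simp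

lemma homogeneous_sum [intro]:
  "(\<And>a. a \<in> A \<Longrightarrow> homogeneous e (f a)) \<Longrightarrow> homogeneous e (\<Sum>a\<in>A. f a)"
  by (induction A rule: infinite_finite_induct) auto

lemma mon_degree_superset:
  assumes "finite A" "Poly_Mapping.keys m \<subseteq> A"
  shows "mon_degree m = (\<Sum>x\<in>A. Poly_Mapping.lookup m x)"
  unfolding mon_degree_def
  by (rule sum.mono_neutral_left) (use assms in \<open>auto simp: in_keys_iff\<close>)

lemma mon_degree_add: "mon_degree (m + m') = mon_degree m + mon_degree m'"
proof -
  let ?A = "Poly_Mapping.keys m \<union> Poly_Mapping.keys m'"
  have "mon_degree (m + m') = (\<Sum>x\<in>?A. Poly_Mapping.lookup (m + m') x)"
    by (rule mon_degree_superset) (auto simp: keys_add_nat)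
  also have "\<dots> = mon_degree m + mon_degree m'"
    by (simp add: lookup_add sum.distrib mon_degree_superset[of ?A m] mon_degree_superset[of ?A m'])
  finally show ?thesis .
qed

lemma mon_degree_eq_0_iff [simp]: "mon_degree m = 0 \<longleftrightarrow> m = 0"
proof
  assume "mon_degree m = 0"
  then have "\<forall>x\<in>Poly_Mapping.keys m. Poly_Mapping.lookup m x = 0"
    by (simp add: mon_degree_def)
  then show "m = 0"
    by (intro poly_mapping_eqI) (metis in_keys_iff lookup_zero)
qed (simp add: mon_degree_def)

lemma homogeneous_mult:
  assumes "homogeneous e p" "homogeneous e' q"
  shows "homogeneous (e + e') (p * q)"
  unfolding homogeneous_def
proof
  fix m assume "m \<in> Poly_Mapping.keys (p * q)"
  then obtain a b where "m = a + b" "a \<in> Poly_Mapping.keys p" "b \<in> Poly_Mapping.keys q"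
    using keys_mult[of p q] by blast
  then show "int (mon_degree m) = e + e'"
    using assms by (simp add: homogeneous_def mon_degree_add)
qed

lemma homogeneous_mult_eq:
  "homogeneous e p \<Longrightarrow> homogeneous e' q \<Longrightarrow> d = e + e' \<Longrightarrow> homogeneous d (p * q)"
  using homogeneous_mult by blast

lemma homogeneous_one [simp, intro]: "homogeneous 0 1"
  by (simp add: homogeneous_def)

lemma homogeneous_const [intro]: "homogeneous 0 (Poly_Mapping.single 0 c)"
  by (auto simp: homogeneous_def)

text \<open>Keeping only the terms whose monomial satisfies a predicate. This gives both the
  homogeneous components of a polynomial and the substitution of 0 for some of the variables.\<close>

definition pfilter :: "('b \<Rightarrow> bool) \<Rightarrow> ('b \<Rightarrow>\<^sub>0 'c::zero) \<Rightarrow> 'b \<Rightarrow>\<^sub>0 'c" where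
  "pfilter P p = Poly_Mapping.mapp (\<lambda>m c. c when P m) p"

lemma lookup_pfilter:
  "Poly_Mapping.lookup (pfilter P p) m = (if P m then Poly_Mapping.lookup p m else 0)"
  by (auto simp: pfilter_def lookup_mapp when_def in_keys_iff)

lemma keys_pfilter: "Poly_Mapping.keys (pfilter P p) = {m \<in> Poly_Mapping.keys p. P m}"
  by (auto simp: in_keys_iff lookup_pfilter split: if_splits)

lemma pfilter_zero [simp]: "pfilter P 0 = 0"
  by (rule poly_mapping_eqI) (simp add: lookup_pfilter)

lemma pfilter_add: "pfilter P (p + q) = pfilter P p + pfilter P q"
  by (rule poly_mapping_eqI) (simp add: lookup_pfilter lookup_add)

lemma pfilter_diff: "pfilter P (p - q) = pfilter P p - pfilter P (q :: 'b \<Rightarrow>\<^sub>0 'c::ab_group_add)"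
  by (rule poly_mapping_eqI) (simp add: lookup_pfilter lookup_minus)

lemma pfilter_sum: "pfilter P (\<Sum>a\<in>A. f a) = (\<Sum>a\<in>A. pfilter P (f a))"
  by (induction A rule: infinite_finite_induct) (auto simp: pfilter_add)

lemma pfilter_id: "(\<And>m. m \<in> Poly_Mapping.keys p \<Longrightarrow> P m) \<Longrightarrow> pfilter P p = p"
  by (rule poly_mapping_eqI) (metis in_keys_iff lookup_pfilter)

lemma pfilter_eq_0: "(\<And>m. m \<in> Poly_Mapping.keys p \<Longrightarrow> \<not> P m) \<Longrightarrow> pfilter P p = 0"
  by (rule poly_mapping_eqI) (metis in_keys_iff lookup_pfilter lookup_zero)

lemma pfilter_mult:
  fixes p q :: "('b::monoid_add) \<Rightarrow>\<^sub>0 'c::ring"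
  assumes "\<And>m m'. m \<in> Poly_Mapping.keys p \<Longrightarrow> m' \<in> Poly_Mapping.keys q \<Longrightarrow> P (m + m') \<longleftrightarrow> Q m'"
  shows "pfilter P (p * q) = p * pfilter Q q"
proof -
  let ?q' = "pfilter (\<lambda>m. \<not> Q m) q"
  have q: "q = pfilter Q q + ?q'"
    by (rule poly_mapping_eqI) (simp add: lookup_pfilter lookup_add)
  have "pfilter P (p * pfilter Q q) = p * pfilter Q q"
    by (rule pfilter_id) (use keys_mult[of p "pfilter Q q"] assms in \<open>fastforce simp: keys_pfilter\<close>)
  moreover have "pfilter P (p * ?q') = 0"
    by (rule pfilter_eq_0) (use keys_mult[of p ?q'] assms in \<open>fastforce simp: keys_pfilter\<close>)
  moreover have "p * q = p * pfilter Q q + p * ?q'"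
    by (subst q) (simp add: distrib_left)
  ultimately show ?thesis
    by (simp add: pfilter_add)
qed

text \<open>The homogeneous component of degree \<open>e\<close>.\<close>

definition hom_comp :: "int \<Rightarrow> ('v, 'k::field) mpoly \<Rightarrow> ('v, 'k) mpoly" where
  "hom_comp e = pfilter (\<lambda>m. int (mon_degree m) = e)"

lemma homogeneous_hom_comp [intro]: "homogeneous e (hom_comp e p)"
  by (simp add: homogeneous_def hom_comp_def keys_pfilter)

lemma polys_hom_comp [intro]: "p \<in> polys V \<Longrightarrow> hom_comp e p \<in> polys V"
  by (simp add: polys_def hom_comp_def keys_pfilter)

lemma hom_comp_id: "homogeneous e p \<Longrightarrow> hom_comp e p = p"
  unfolding hom_comp_def by (rule pfilter_id) (simp add: homogeneous_def)

lemma hom_comp_sum: "hom_comp e (\<Sum>a\<in>A. f a) = (\<Sum>a\<in>A. hom_comp e (f a))"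
  by (simp add: hom_comp_def pfilter_sum)

lemma hom_comp_diff: "hom_comp e (p - q) = hom_comp e p - hom_comp e q"
  by (simp add: hom_comp_def pfilter_diff)

lemma hom_comp_mult:
  assumes "homogeneous e' p"
  shows "hom_comp e (p * q) = p * hom_comp (e - e') q"
  unfolding hom_comp_def
  by (rule pfilter_mult) (use assms in \<open>auto simp: homogeneous_def mon_degree_add\<close>)

text \<open>The retraction of \<open>k[V]\<close> onto \<open>k[U]\<close> that maps the variables outside \<open>U\<close> to 0.\<close>

definition restr :: "'v set \<Rightarrow> ('v, 'k::field) mpoly \<Rightarrow> ('v, 'k) mpoly" where
  "restr U = pfilter (\<lambda>m. Poly_Mapping.keys m \<subseteq> U)"

lemma polys_restr [intro]: "restr U p \<in> polys U"
  by (auto simp: polys_def restr_def keys_pfilter)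

lemma homogeneous_restr [intro]: "homogeneous e p \<Longrightarrow> homogeneous e (restr U p)"
  by (simp add: homogeneous_def restr_def keys_pfilter)

lemma restr_id: "p \<in> polys U \<Longrightarrow> restr U p = p"
  unfolding restr_def by (rule pfilter_id) (simp add: polys_def)

lemma restr_diff: "restr U (p - q) = restr U p - restr U q"
  by (simp add: restr_def pfilter_diff)

lemma restr_sum: "restr U (\<Sum>a\<in>A. f a) = (\<Sum>a\<in>A. restr U (f a))"
  by (simp add: restr_def pfilter_sum)

lemma restr_mult: "restr U (p * q) = restr U p * restr U q"
proof -
  let ?p' = "pfilter (\<lambda>m. \<not> Poly_Mapping.keys m \<subseteq> U) p"
  have p: "p = restr U p + ?p'"
    by (rule poly_mapping_eqI) (simp add: restr_def lookup_pfilter lookup_add)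
  have "restr U (restr U p * q) = restr U p * restr U q"
    unfolding restr_def by (rule pfilter_mult) (auto simp: keys_pfilter keys_add_nat)
  moreover have "restr U (?p' * q) = ?p' * pfilter (\<lambda>_. False) q"
    unfolding restr_def by (rule pfilter_mult) (auto simp: keys_pfilter keys_add_nat)
  moreover have "pfilter (\<lambda>_. False) q = 0"
    by (rule pfilter_eq_0) simp
  moreover have "p * q = restr U p * q + ?p' * q"
    by (subst p) (simp add: distrib_right)
  ultimately show ?thesis
    by (simp add: restr_def pfilter_add)
qed

text \<open>The constant term corresponds to the retraction for \<open>U = {}\<close>, hence it is multiplicative.\<close>

definition const_term :: "('v, 'k::field) mpoly \<Rightarrow> 'k" where
  "const_term p = Poly_Mapping.lookup p 0"

lemma const_term_zero [simp]: "const_term 0 = 0"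
  and const_term_one [simp]: "const_term 1 = 1"
  and const_term_diff: "const_term (p - q) = const_term p - const_term q"
  and const_term_uminus [simp]: "const_term (- p) = - const_term p"
  and const_term_sum: "const_term (\<Sum>a\<in>A. f a) = (\<Sum>a\<in>A. const_term (f a))"
  by (simp_all add: const_term_def lookup_add lookup_minus lookup_sum)

lemma restr_empty: "restr {} p = Poly_Mapping.single 0 (const_term p)"
  by (rule poly_mapping_eqI)
    (auto simp: restr_def lookup_pfilter const_term_def lookup_single when_def)

lemma const_term_mult: "const_term (p * q) = const_term p * const_term q"
  using restr_mult[of "{}" p q] unfolding restr_empty mult_single
  by (metis add_0 lookup_single_eq)

lemma const_term_restr [simp]: "const_term (restr U p) = const_term p"
  by (simp add: const_term_def restr_def lookup_pfilter)

lemma homogeneous_const_term: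
  assumes "homogeneous e p" "const_term p \<noteq> 0"
  shows "e = 0" "p = Poly_Mapping.single 0 (const_term p)"
proof -
  have "0 \<in> Poly_Mapping.keys p"
    using assms(2) by (simp add: in_keys_iff const_term_def)
  then show e: "e = 0"
    using assms(1) by (force simp: homogeneous_def)
  show "p = Poly_Mapping.single 0 (const_term p)"
  proof (rule poly_mapping_eqI)
    fix m
    show "Poly_Mapping.lookup p m = Poly_Mapping.lookup (Poly_Mapping.single 0 (const_term p)) m"
    proof (cases "m = 0")
      case False
      then have "m \<notin> Poly_Mapping.keys p"
        using assms(1) e by (auto simp: homogeneous_def)
      with False show ?thesis
        by (simp add: in_keys_iff lookup_single)
    qed (simp add: const_term_def)
  qed
qed

lemma const_term_homogeneous_eq_0: "homogeneous e p \<Longrightarrow> e \<noteq> 0 \<Longrightarrow> const_term p = 0"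
  using homogeneous_const_term(1) by blast

text \<open>Homogeneous ideals of \<open>k[V]\<close>, i.e. ideals that are closed under taking homogeneous components.\<close>

definition hom_ideal :: "'v set \<Rightarrow> ('v, 'k::field) mpoly set \<Rightarrow> bool" where
  "hom_ideal V I \<longleftrightarrow> I \<subseteq> polys V \<and> 0 \<in> I \<and> (\<forall>p\<in>I. \<forall>q\<in>I. p + q \<in> I) \<and>
     (\<forall>p\<in>polys V. \<forall>q\<in>I. p * q \<in> I) \<and> (\<forall>e. \<forall>p\<in>I. hom_comp e p \<in> I)"

context
  fixes V :: "'v set" and I :: "('v, 'k::field) mpoly set"
  assumes I: "hom_ideal V I"
begin

lemma ideal_polys: "p \<in> I \<Longrightarrow> p \<in> polys V"
  and ideal_zero: "0 \<in> I"
  and ideal_add: "p \<in> I \<Longrightarrow> q \<in> I \<Longrightarrow> p + q \<in> I"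
  and ideal_mult: "p' \<in> polys V \<Longrightarrow> q \<in> I \<Longrightarrow> p' * q \<in> I"
  and ideal_hom_comp: "p \<in> I \<Longrightarrow> hom_comp e p \<in> I"
  using I by (auto simp: hom_ideal_def)

lemma ideal_mult_right: "q \<in> I \<Longrightarrow> p \<in> polys V \<Longrightarrow> q * p \<in> I"
  using ideal_mult[of p q] by (simp add: mult.commute)

lemma ideal_uminus: "p \<in> I \<Longrightarrow> - p \<in> I"
  using ideal_mult[of "- 1" p] by auto

lemma ideal_uminus_iff: "- p \<in> I \<longleftrightarrow> p \<in> I"
  using ideal_uminus[of p] ideal_uminus[of "- p"] by auto

lemma ideal_diff: "p \<in> I \<Longrightarrow> q \<in> I \<Longrightarrow> p - q \<in> I"
  using ideal_add[of p "- q"] ideal_uminus[of q] by simp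

lemma ideal_sum: "(\<And>a. a \<in> A \<Longrightarrow> f a \<in> I) \<Longrightarrow> (\<Sum>a\<in>A. f a) \<in> I"
  by (induction A rule: infinite_finite_induct) (auto intro: ideal_zero ideal_add)

lemma ideal_cong: "p - q \<in> I \<Longrightarrow> p \<in> I \<longleftrightarrow> q \<in> I"
  using ideal_diff[of p "p - q"] ideal_add[of "p - q" q] by auto

end

section \<open>Resolutions with indexed bases\<close>

text \<open>The product of a matrix, given as a function, with the vector \<open>v\<close> indexed by \<open>C\<close>.\<close>

definition mv :: "'c set \<Rightarrow> ('b \<Rightarrow> 'c \<Rightarrow> 'r) \<Rightarrow> ('c \<Rightarrow> 'r) \<Rightarrow> 'b \<Rightarrow> 'r::comm_ring_1" where
  "mv C A v a = (\<Sum>c\<in>C. A a c * v c)"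

lemma mv_cong:
  "a = a' \<Longrightarrow> (\<And>c. c \<in> C \<Longrightarrow> A a' c = A' a' c) \<Longrightarrow> (\<And>c. c \<in> C \<Longrightarrow> v c = v' c) \<Longrightarrow>
     mv C A v a = mv C A' v' a'"
  by (simp add: mv_def)

lemma mv_add: "mv C A (\<lambda>c. v c + w c) a = mv C A v a + mv C A w a"
  by (simp add: mv_def distrib_left sum.distrib)

lemma mv_diff: "mv C A (\<lambda>c. v c - w c) a = mv C A v a - mv C A w a"
  by (simp add: mv_def right_diff_distrib sum_subtractf)

lemma mv_uminus: "mv C A (\<lambda>c. - v c) a = - mv C A v a"
  by (simp add: mv_def sum_negf)

lemma mv_uminus_left: "mv C (\<lambda>a c. - A a c) v a = - mv C A v a"
  by (simp add: mv_def sum_negf)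

lemma mv_add_left: "mv C (\<lambda>a c. A a c + A' a c) v a = mv C A v a + mv C A' v a"
  by (simp add: mv_def distrib_right sum.distrib)

lemma mv_diff_left: "mv C (\<lambda>a c. A a c - A' a c) v a = mv C A v a - mv C A' v a"
  by (simp add: mv_def left_diff_distrib sum_subtractf)

lemma mv_scale: "mv C A (\<lambda>c. p * v c) a = p * mv C A v a"
  by (simp add: mv_def sum_distrib_left mult_ac)

lemma mv_scale_left: "mv C (\<lambda>a c. p * A a c) v a = p * mv C A v a"
  by (simp add: mv_def sum_distrib_left mult_ac)

lemma mv_zero [simp]: "mv C A (\<lambda>c. 0) a = 0"
  by (simp add: mv_def)

lemma mv_zero_left: "(\<And>c. c \<in> C \<Longrightarrow> A a c = 0) \<Longrightarrow> mv C A v a = 0"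
  by (simp add: mv_def)

lemma mv_delta: "finite C \<Longrightarrow> b \<in> C \<Longrightarrow> mv C A (\<lambda>c. if c = b then 1 else 0) a = A a b"
  by (simp add: mv_def if_distrib[of "\<lambda>x. _ * x"] cong: if_cong)

lemma mv_delta_left: "finite C \<Longrightarrow> a \<in> C \<Longrightarrow> mv C (\<lambda>a c. if a = c then p else 0) v a = p * v a"
  by (simp add: mv_def if_distrib[of "\<lambda>x. x * _"] cong: if_cong)

lemma mv_mv: "mv B A (mv C N v) a = mv C (\<lambda>a c. mv B A (\<lambda>b. N b c) a) v a"
  unfolding mv_def
  by (subst sum_distrib_left, subst sum.swap) (simp add: sum_distrib_left sum_distrib_right mult_ac)

lemma mv_polys [intro]:
  "(\<And>c. c \<in> C \<Longrightarrow> A a c \<in> polys V) \<Longrightarrow> (\<And>c. c \<in> C \<Longrightarrow> v c \<in> polys V) \<Longrightarrow> mv C A v a \<in> polys V"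
  unfolding mv_def by auto

lemma mv_homogeneous:
  assumes "\<And>c. c \<in> C \<Longrightarrow> homogeneous (f c) (A a c)" "\<And>c. c \<in> C \<Longrightarrow> homogeneous (e - f c) (v c)"
  shows "homogeneous e (mv C A v a)"
  unfolding mv_def
  by (rule homogeneous_sum) (use assms in \<open>force intro: homogeneous_mult_eq\<close>)

lemma hom_comp_mv:
  assumes "\<And>c. c \<in> C \<Longrightarrow> homogeneous (f c) (A a c)"
  shows "hom_comp e (mv C A v a) = mv C A (\<lambda>c. hom_comp (e - f c) (v c)) a"
  unfolding mv_def hom_comp_sum by (rule sum.cong) (use assms in \<open>auto simp: hom_comp_mult\<close>)

lemma restr_mv: "restr U (mv C A v a) = mv C (\<lambda>a c. restr U (A a c)) (\<lambda>c. restr U (v c)) a"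
  by (simp add: mv_def restr_sum restr_mult)

text \<open>A graded free resolution of \<open>S/I\<close> over \<open>S = k[V]\<close>, where the basis of the \<open>i\<close>-th module is
  indexed by a finite set \<open>B i\<close>, and matrices and vectors are functions, whose values outside of the
  index sets do not matter. The augmentation is \<open>\<epsilon>\<close>, written as a matrix with the single row \<open>()\<close>.
  The predicates \<open>cyc\<close> and \<open>bnd\<close> are membership in the kernel of the map out of the \<open>i\<close>-th module
  (onto \<open>S/I\<close> for \<open>i = 0\<close>) and in the image of the map into it.\<close>

definition cyc :: "('v, 'k::field) mpoly set \<Rightarrow> (nat \<Rightarrow> 'b set) \<Rightarrow> ('b \<Rightarrow> ('v, 'k) mpoly) \<Rightarrow>
    (nat \<Rightarrow> 'b \<Rightarrow> 'b \<Rightarrow> ('v, 'k) mpoly) \<Rightarrow> nat \<Rightarrow> ('b \<Rightarrow> ('v, 'k) mpoly) \<Rightarrow> bool" where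
  "cyc I B \<epsilon> \<phi> i y \<longleftrightarrow> (case i of 0 \<Rightarrow> mv (B 0) (\<lambda>_. \<epsilon>) y () \<in> I
     | Suc k \<Rightarrow> \<forall>a\<in>B k. mv (B (Suc k)) (\<phi> k) y a = 0)"

definition bnd :: "'v set \<Rightarrow> (nat \<Rightarrow> 'b set) \<Rightarrow> (nat \<Rightarrow> 'b \<Rightarrow> 'b \<Rightarrow> ('v, 'k::field) mpoly) \<Rightarrow>
    nat \<Rightarrow> ('b \<Rightarrow> ('v, 'k) mpoly) \<Rightarrow> bool" where
  "bnd V B \<phi> i y \<longleftrightarrow>
     (\<exists>w\<in>B (Suc i) \<rightarrow> polys V. \<forall>a\<in>B i. y a = mv (B (Suc i)) (\<phi> i) w a)"

definition gres :: "'v set \<Rightarrow> ('v, 'k::field) mpoly set \<Rightarrow> (nat \<Rightarrow> 'b set) \<Rightarrow> (nat \<Rightarrow> 'b \<Rightarrow> int) \<Rightarrow>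
    ('b \<Rightarrow> ('v, 'k) mpoly) \<Rightarrow> (nat \<Rightarrow> 'b \<Rightarrow> 'b \<Rightarrow> ('v, 'k) mpoly) \<Rightarrow> bool" where
  "gres V I B d \<epsilon> \<phi> \<longleftrightarrow>
     (\<forall>i. finite (B i)) \<and>
     (\<forall>b\<in>B 0. \<epsilon> b \<in> polys V \<and> homogeneous (d 0 b) (\<epsilon> b)) \<and>
     (\<forall>i. \<forall>a\<in>B i. \<forall>b\<in>B (Suc i). \<phi> i a b \<in> polys V \<and>
        homogeneous (d (Suc i) b - d i a) (\<phi> i a b)) \<and>
     (\<forall>p\<in>polys V. \<exists>v\<in>B 0 \<rightarrow> polys V. p - mv (B 0) (\<lambda>_. \<epsilon>) v () \<in> I) \<and>
     (\<forall>i. \<forall>y\<in>B i \<rightarrow> polys V. cyc I B \<epsilon> \<phi> i y \<longleftrightarrow> bnd V B \<phi> i y)"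

text \<open>Minimality: all entries of the differentials have constant term 0.\<close>

definition minimal :: "(nat \<Rightarrow> 'b set) \<Rightarrow> (nat \<Rightarrow> 'b \<Rightarrow> 'b \<Rightarrow> ('v, 'k::field) mpoly) \<Rightarrow> bool" where
  "minimal B \<phi> \<longleftrightarrow> (\<forall>i. \<forall>a\<in>B i. \<forall>b\<in>B (Suc i). const_term (\<phi> i a b) = 0)"

lemma cyc_0: "cyc I B \<epsilon> \<phi> 0 y \<longleftrightarrow> mv (B 0) (\<lambda>_. \<epsilon>) y () \<in> I"
  and cyc_Suc: "cyc I B \<epsilon> \<phi> (Suc k) y \<longleftrightarrow> (\<forall>a\<in>B k. mv (B (Suc k)) (\<phi> k) y a = 0)"
  by (simp_all add: cyc_def)

lemma cyc_cong:
  assumes "\<And>a. a \<in> B i \<Longrightarrow> y a = y' a"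
  shows "cyc I B \<epsilon> \<phi> i y \<longleftrightarrow> cyc I B \<epsilon> \<phi> i y'"
proof (cases i)
  case 0
  then show ?thesis
    using mv_cong[of "()" "()" "B 0" "\<lambda>_. \<epsilon>" "\<lambda>_. \<epsilon>" y y'] assms by (simp add: cyc_0)
next
  case (Suc k)
  then show ?thesis
    using mv_cong[of _ _ "B i" "\<phi> k" "\<phi> k" y y'] assms by (simp add: cyc_Suc)
qed

lemma bnd_cong:
  assumes "\<And>a. a \<in> B i \<Longrightarrow> y a = y' a"
  shows "bnd V B \<phi> i y \<longleftrightarrow> bnd V B \<phi> i y'"
  using assms by (simp add: bnd_def)

lemma bndI:
  "(\<And>b. b \<in> B (Suc i) \<Longrightarrow> w b \<in> polys V) \<Longrightarrow>
   (\<And>a. a \<in> B i \<Longrightarrow> y a = mv (B (Suc i)) (\<phi> i) w a) \<Longrightarrow> bnd V B \<phi> i y"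
  unfolding bnd_def by auto

lemma bndE:
  assumes "bnd V B \<phi> i y"
  obtains w where "\<And>b. b \<in> B (Suc i) \<Longrightarrow> w b \<in> polys V"
    "\<And>a. a \<in> B i \<Longrightarrow> y a = mv (B (Suc i)) (\<phi> i) w a"
  using assms unfolding bnd_def by auto

context
  fixes V :: "'v set" and I :: "('v, 'k::field) mpoly set" and B :: "nat \<Rightarrow> 'b set"
    and \<epsilon> :: "'b \<Rightarrow> ('v, 'k) mpoly" and \<phi> :: "nat \<Rightarrow> 'b \<Rightarrow> 'b \<Rightarrow> ('v, 'k) mpoly"
  assumes I: "hom_ideal V I"
begin

lemma cyc_add:
  assumes "cyc I B \<epsilon> \<phi> i y" "cyc I B \<epsilon> \<phi> i y'"
  shows "cyc I B \<epsilon> \<phi> i (\<lambda>a. y a + y' a)"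
  using assms by (cases i) (auto simp: cyc_0 cyc_Suc mv_add intro: ideal_add[OF I])

lemma cyc_diff:
  assumes "cyc I B \<epsilon> \<phi> i y" "cyc I B \<epsilon> \<phi> i y'"
  shows "cyc I B \<epsilon> \<phi> i (\<lambda>a. y a - y' a)"
  using assms by (cases i) (auto simp: cyc_0 cyc_Suc mv_diff intro: ideal_diff[OF I])

end

lemma gresI:
  fixes I :: "('v, 'k::field) mpoly set" and B :: "nat \<Rightarrow> 'b set"
  assumes "\<And>i. finite (B i)"
    and "\<And>b. b \<in> B 0 \<Longrightarrow> \<epsilon> b \<in> polys V"
    and "\<And>b. b \<in> B 0 \<Longrightarrow> homogeneous (d 0 b) (\<epsilon> b)"
    and "\<And>i a b. a \<in> B i \<Longrightarrow> b \<in> B (Suc i) \<Longrightarrow> \<phi> i a b \<in> polys V"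
    and "\<And>i a b. a \<in> B i \<Longrightarrow> b \<in> B (Suc i) \<Longrightarrow> homogeneous (d (Suc i) b - d i a) (\<phi> i a b)"
    and "\<And>p. p \<in> polys V \<Longrightarrow> \<exists>v. (\<forall>b\<in>B 0. v b \<in> polys V) \<and> p - mv (B 0) (\<lambda>_. \<epsilon>) v () \<in> I"
    and "\<And>i y. (\<And>a. a \<in> B i \<Longrightarrow> y a \<in> polys V) \<Longrightarrow> cyc I B \<epsilon> \<phi> i y \<Longrightarrow> bnd V B \<phi> i y"
    and "\<And>i y. (\<And>a. a \<in> B i \<Longrightarrow> y a \<in> polys V) \<Longrightarrow> bnd V B \<phi> i y \<Longrightarrow> cyc I B \<epsilon> \<phi> i y"
  shows "gres V I B d \<epsilon> \<phi>"
  unfolding gres_def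
proof (intro conjI allI ballI)
  fix p :: "('v, 'k) mpoly" assume "p \<in> polys V"
  then obtain v where "\<forall>b\<in>B 0. v b \<in> polys V" "p - mv (B 0) (\<lambda>_. \<epsilon>) v () \<in> I"
    using assms(6) by blast
  then show "\<exists>v\<in>B 0 \<rightarrow> polys V. p - mv (B 0) (\<lambda>_. \<epsilon>) v () \<in> I"
    by (intro bexI[of _ v]) auto
next
  fix i and y :: "'b \<Rightarrow> ('v, 'k) mpoly" assume "y \<in> B i \<rightarrow> polys V"
  then show "cyc I B \<epsilon> \<phi> i y \<longleftrightarrow> bnd V B \<phi> i y"
    using assms(7,8)[of i y] by (meson PiE)
qed (use assms in auto)

locale resolution =
  fixes V :: "'v set" and I :: "('v, 'k::field) mpoly set" and B :: "nat \<Rightarrow> 'b set"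
    and d :: "nat \<Rightarrow> 'b \<Rightarrow> int" and \<epsilon> :: "'b \<Rightarrow> ('v, 'k) mpoly"
    and \<phi> :: "nat \<Rightarrow> 'b \<Rightarrow> 'b \<Rightarrow> ('v, 'k) mpoly"
  assumes hom_ideal: "hom_ideal V I" and gres: "gres V I B d \<epsilon> \<phi>"
begin

lemma fin: "finite (B i)"
  and eps_polys: "b \<in> B 0 \<Longrightarrow> \<epsilon> b \<in> polys V"
  and eps_hom: "b \<in> B 0 \<Longrightarrow> homogeneous (d 0 b) (\<epsilon> b)"
  and phi_polys: "a \<in> B i \<Longrightarrow> c \<in> B (Suc i) \<Longrightarrow> \<phi> i a c \<in> polys V"
  and phi_hom: "a \<in> B i \<Longrightarrow> c \<in> B (Suc i) \<Longrightarrow> homogeneous (d (Suc i) c - d i a) (\<phi> i a c)"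
  using gres by (auto simp: gres_def)

lemma surj:
  assumes "p \<in> polys V"
  obtains v where "\<And>b. b \<in> B 0 \<Longrightarrow> v b \<in> polys V" "p - mv (B 0) (\<lambda>_. \<epsilon>) v () \<in> I"
  using gres assms unfolding gres_def by (metis PiE)

abbreviation "cyc' \<equiv> cyc I B \<epsilon> \<phi>"
abbreviation "bnd' \<equiv> bnd V B \<phi>"

lemma cyc_iff_bnd: "(\<And>a. a \<in> B i \<Longrightarrow> y a \<in> polys V) \<Longrightarrow> cyc' i y \<longleftrightarrow> bnd' i y"
  using gres unfolding gres_def by blast

lemma phi_column_cyc:
  assumes "c \<in> B (Suc i)"
  shows "cyc' i (\<lambda>a. \<phi> i a c)"
proof -
  have "bnd' i (\<lambda>a. \<phi> i a c)"
    by (rule bndI[of _ _ "\<lambda>x. if x = c then 1 else 0"]) (use assms fin in \<open>auto simp: mv_delta\<close>)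
  then show ?thesis
    using cyc_iff_bnd[of i "\<lambda>a. \<phi> i a c"] assms phi_polys by auto
qed

lemma phi_phi:
  assumes "a \<in> B i" "c \<in> B (Suc (Suc i))"
  shows "mv (B (Suc i)) (\<phi> i) (\<lambda>b. \<phi> (Suc i) b c) a = 0"
  using phi_column_cyc[OF assms(2)] assms(1) by (simp add: cyc_Suc)

lemma phi_phi_mv:
  assumes "a \<in> B i"
  shows "mv (B (Suc i)) (\<phi> i) (mv (B (Suc (Suc i))) (\<phi> (Suc i)) w) a = 0"
  unfolding mv_mv by (rule mv_zero_left) (use assms phi_phi in blast)

lemma eps_phi: "c \<in> B 1 \<Longrightarrow> mv (B 0) (\<lambda>_. \<epsilon>) (\<lambda>b. \<phi> 0 b c) () \<in> I"
  using phi_column_cyc[of c 0] by (simp add: cyc_0)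

lemma surj_homogeneous:
  assumes "p \<in> polys V" "homogeneous e p"
  obtains v where "\<And>b. b \<in> B 0 \<Longrightarrow> v b \<in> polys V" "\<And>b. b \<in> B 0 \<Longrightarrow> homogeneous (e - d 0 b) (v b)"
    "p - mv (B 0) (\<lambda>_. \<epsilon>) v () \<in> I"
proof -
  obtain v where v: "\<And>b. b \<in> B 0 \<Longrightarrow> v b \<in> polys V" "p - mv (B 0) (\<lambda>_. \<epsilon>) v () \<in> I"
    using surj[OF assms(1)] by blast
  let ?v = "\<lambda>b. hom_comp (e - d 0 b) (v b)"
  have "hom_comp e (p - mv (B 0) (\<lambda>_. \<epsilon>) v ()) = p - mv (B 0) (\<lambda>_. \<epsilon>) ?v ()"
    using assms(2) by (subst hom_comp_diff, subst hom_comp_mv[of _ "d 0"]) (auto simp: hom_comp_id eps_hom)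
  then show ?thesis
    using that[of ?v] v ideal_hom_comp[OF hom_ideal v(2), of e] by auto
qed

lemma exact_homogeneous:
  assumes "\<And>a. a \<in> B i \<Longrightarrow> y a \<in> polys V" "\<And>a. a \<in> B i \<Longrightarrow> homogeneous (e - d i a) (y a)" "cyc' i y"
  obtains w where "\<And>b. b \<in> B (Suc i) \<Longrightarrow> w b \<in> polys V"
    "\<And>b. b \<in> B (Suc i) \<Longrightarrow> homogeneous (e - d (Suc i) b) (w b)"
    "\<And>a. a \<in> B i \<Longrightarrow> y a = mv (B (Suc i)) (\<phi> i) w a"
proof -
  obtain w where w: "\<And>b. b \<in> B (Suc i) \<Longrightarrow> w b \<in> polys V"
    "\<And>a. a \<in> B i \<Longrightarrow> y a = mv (B (Suc i)) (\<phi> i) w a"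
    using cyc_iff_bnd[of i y] assms(1,3) by (auto elim!: bndE)
  let ?w = "\<lambda>b. hom_comp (e - d (Suc i) b) (w b)"
  have "y a = mv (B (Suc i)) (\<phi> i) ?w a" if a: "a \<in> B i" for a
  proof -
    have "y a = hom_comp (e - d i a) (mv (B (Suc i)) (\<phi> i) w a)"
      using assms(2)[OF a] w(2)[OF a] by (simp add: hom_comp_id)
    also have "\<dots> = mv (B (Suc i)) (\<phi> i) (\<lambda>b. hom_comp (e - d i a - (d (Suc i) b - d i a)) (w b)) a"
      by (rule hom_comp_mv) (use a phi_hom in auto)
    finally show ?thesis by simp
  qed
  then show ?thesis
    using that[of ?w] w by auto
qed

text \<open>Let \<open>C\<close> be (the bases of) a complex of graded free modules with differentials \<open>\<chi>\<close>. A map \<open>s\<close> from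
  its zeroth module to \<open>S\<close> that induces a map from the cokernel of \<open>\<chi> 0\<close> to \<open>S/I\<close> lifts to a graded
  chain map \<open>f\<close> from \<open>C\<close> into the resolution. Exactness of \<open>C\<close> is not required.\<close>

lemma lifting:
  fixes C :: "nat \<Rightarrow> 'c set" and \<chi> :: "nat \<Rightarrow> 'c \<Rightarrow> 'c \<Rightarrow> ('v, 'k) mpoly"
  assumes \<chi>: "\<And>j b c. b \<in> C j \<Longrightarrow> c \<in> C (Suc j) \<Longrightarrow> \<chi> j b c \<in> polys V"
      "\<And>j b c. b \<in> C j \<Longrightarrow> c \<in> C (Suc j) \<Longrightarrow> homogeneous (dC (Suc j) c - dC j b) (\<chi> j b c)"
    and \<chi>\<chi>: "\<And>j a c. a \<in> C j \<Longrightarrow> c \<in> C (Suc (Suc j)) \<Longrightarrow>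
        mv (C (Suc j)) (\<chi> j) (\<lambda>b. \<chi> (Suc j) b c) a = 0"
    and s: "\<And>c. c \<in> C 0 \<Longrightarrow> s c \<in> polys V" "\<And>c. c \<in> C 0 \<Longrightarrow> homogeneous (dC 0 c) (s c)"
      "\<And>c. c \<in> C (Suc 0) \<Longrightarrow> mv (C 0) (\<lambda>_. s) (\<lambda>b. \<chi> 0 b c) () \<in> I"
  obtains f where
    "\<And>j a c. a \<in> B j \<Longrightarrow> c \<in> C j \<Longrightarrow> f j a c \<in> polys V"
    "\<And>j a c. a \<in> B j \<Longrightarrow> c \<in> C j \<Longrightarrow> homogeneous (dC j c - d j a) (f j a c)"
    "\<And>c. c \<in> C 0 \<Longrightarrow> s c - mv (B 0) (\<lambda>_. \<epsilon>) (\<lambda>a. f 0 a c) () \<in> I"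
    "\<And>j a c. a \<in> B j \<Longrightarrow> c \<in> C (Suc j) \<Longrightarrow>
       mv (B (Suc j)) (\<phi> j) (\<lambda>b. f (Suc j) b c) a = mv (C j) (f j) (\<lambda>b. \<chi> j b c) a"
proof -
  define P where "P = (\<lambda>j F.
     (\<forall>a\<in>B j. \<forall>c\<in>C j. F a c \<in> polys V \<and> homogeneous (dC j c - d j a) (F a c)) \<and>
     (\<forall>c\<in>C (Suc j). cyc' j (mv (C j) F (\<lambda>b. \<chi> j b c))) \<and>
     (j = 0 \<longrightarrow> (\<forall>c\<in>C 0. s c - mv (B 0) (\<lambda>_. \<epsilon>) (\<lambda>a. F a c) () \<in> I)))"
  define Q where "Q = (\<lambda>j F F'. \<forall>a\<in>B j. \<forall>c\<in>C (Suc j).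
     mv (B (Suc j)) (\<phi> j) (\<lambda>b. F' b c) a = mv (C j) F (\<lambda>b. \<chi> j b c) a)"
  \<comment> \<open>The invariant \<open>P\<close> contains what is required for the next step, namely that the composition of the
    current component with the differential of \<open>C\<close> maps to cycles.\<close>
  have base: "\<exists>F. P 0 F"
  proof -
    have "\<exists>v. \<forall>c\<in>C 0. (\<forall>b\<in>B 0. v c b \<in> polys V \<and> homogeneous (dC 0 c - d 0 b) (v c b)) \<and>
        s c - mv (B 0) (\<lambda>_. \<epsilon>) (v c) () \<in> I"
      by (rule bchoice) (metis s(1,2) surj_homogeneous)
    then obtain v where v: "\<forall>c\<in>C 0. (\<forall>b\<in>B 0. v c b \<in> polys V \<and> homogeneous (dC 0 c - d 0 b) (v c b)) \<and>
        s c - mv (B 0) (\<lambda>_. \<epsilon>) (v c) () \<in> I" by blast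
    let ?F = "\<lambda>a c. v c a"
    have "cyc' 0 (mv (C 0) ?F (\<lambda>b. \<chi> 0 b c))" if c: "c \<in> C (Suc 0)" for c
    proof -
      have "mv (C 0) (\<lambda>_ c. s c - mv (B 0) (\<lambda>_. \<epsilon>) (v c) ()) (\<lambda>b. \<chi> 0 b c) () \<in> I"
        unfolding mv_def[of "C 0"]
        by (rule ideal_sum[OF hom_ideal]) (use c v \<chi>(1) in \<open>blast intro: ideal_mult_right[OF hom_ideal]\<close>)
      then have "mv (C 0) (\<lambda>_. s) (\<lambda>b. \<chi> 0 b c) () - mv (B 0) (\<lambda>_. \<epsilon>) (mv (C 0) ?F (\<lambda>b. \<chi> 0 b c)) () \<in> I"
        unfolding mv_diff_left mv_mv by simp
      then show ?thesis
        using ideal_cong[OF hom_ideal] s(3)[OF c] by (simp add: cyc_0)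
    qed
    then have "P 0 ?F"
      using v by (simp add: P_def)
    then show ?thesis by blast
  qed
  have step: "\<exists>F'. P (Suc j) F' \<and> Q j F F'" if F: "P j F" for j F
  proof -
    let ?y = "\<lambda>c. mv (C j) F (\<lambda>b. \<chi> j b c)"
    have "\<exists>w. \<forall>c\<in>C (Suc j).
        (\<forall>b\<in>B (Suc j). w c b \<in> polys V \<and> homogeneous (dC (Suc j) c - d (Suc j) b) (w c b)) \<and>
        (\<forall>a\<in>B j. ?y c a = mv (B (Suc j)) (\<phi> j) (w c) a)"
    proof (rule bchoice, rule ballI)
      fix c assume c: "c \<in> C (Suc j)"
      have 1: "?y c a \<in> polys V" if "a \<in> B j" for a
        using F that \<chi>(1) c by (auto simp: P_def)
      have 2: "homogeneous (dC (Suc j) c - d j a) (?y c a)" if "a \<in> B j" for a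
        by (rule mv_homogeneous[of _ "\<lambda>b. dC j b - d j a"])
          (use F that \<chi>(2)[OF _ c] in \<open>auto simp: P_def\<close>)
      have 3: "cyc' j (?y c)"
        using F c by (simp add: P_def)
      show "\<exists>w. (\<forall>b\<in>B (Suc j). w b \<in> polys V \<and> homogeneous (dC (Suc j) c - d (Suc j) b) (w b)) \<and>
        (\<forall>a\<in>B j. ?y c a = mv (B (Suc j)) (\<phi> j) w a)"
        using exact_homogeneous[of j "?y c" "dC (Suc j) c", OF 1 2 3] by metis
    qed
    then obtain w where w: "\<forall>c\<in>C (Suc j).
        (\<forall>b\<in>B (Suc j). w c b \<in> polys V \<and> homogeneous (dC (Suc j) c - d (Suc j) b) (w c b)) \<and>
        (\<forall>a\<in>B j. ?y c a = mv (B (Suc j)) (\<phi> j) (w c) a)" by blast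
    let ?F = "\<lambda>b c. w c b"
    have "cyc' (Suc j) (mv (C (Suc j)) ?F (\<lambda>b. \<chi> (Suc j) b c))" if c: "c \<in> C (Suc (Suc j))" for c
      unfolding cyc_Suc
    proof
      fix a assume a: "a \<in> B j"
      have "mv (B (Suc j)) (\<phi> j) (mv (C (Suc j)) ?F (\<lambda>b. \<chi> (Suc j) b c)) a
          = mv (C (Suc j)) (\<lambda>a c. ?y c a) (\<lambda>b. \<chi> (Suc j) b c) a"
        unfolding mv_mv using w a by (intro mv_cong) auto
      also have "\<dots> = mv (C j) F (mv (C (Suc j)) (\<chi> j) (\<lambda>b. \<chi> (Suc j) b c)) a"
        unfolding mv_mv ..
      also have "\<dots> = mv (C j) F (\<lambda>_. 0) a"
        using \<chi>\<chi>[OF _ c] by (intro mv_cong) auto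
      finally show "mv (B (Suc j)) (\<phi> j) (mv (C (Suc j)) ?F (\<lambda>b. \<chi> (Suc j) b c)) a = 0"
        by simp
    qed
    then have "P (Suc j) ?F" "Q j F ?F"
      using w by (auto simp: P_def Q_def)
    then show ?thesis by blast
  qed
  obtain f where f: "\<forall>j. P j (f j) \<and> Q j (f j) (f (Suc j))"
    using dependent_nat_choice[of P Q, OF base step] by blast
  show ?thesis
  proof (rule that[of f])
    fix c assume "c \<in> C 0"
    then show "s c - mv (B 0) (\<lambda>_. \<epsilon>) (\<lambda>a. f 0 a c) () \<in> I"
      using f[rule_format, of 0] by (simp add: P_def)
  qed (use f in \<open>auto simp: P_def Q_def\<close>)
qed

end

section \<open>Comparison of Betti numbers\<close>

text \<open>A matrix with a left inverse has at least as many rows as columns.\<close>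

lemma card_le_if_left_inverse:
  fixes f :: "'b \<Rightarrow> 'a \<Rightarrow> 'k::field" and g :: "'a \<Rightarrow> 'b \<Rightarrow> 'k"
  assumes "finite X" "finite Y"
    and gf: "\<And>a c. a \<in> X \<Longrightarrow> c \<in> X \<Longrightarrow> (\<Sum>b\<in>Y. g a b * f b c) = (if a = c then 1 else 0)"
  shows "card X \<le> card Y"
proof (rule ccontr)
  define n m where "n = card X" and "m = card Y"
  assume "\<not> card X \<le> card Y"
  then have mn: "m < n" by (simp add: n_def m_def)
  obtain p where p: "bij_betw p {0..<n} X"
    using ex_bij_betw_nat_finite[OF assms(1)] n_def by blast
  obtain q where q: "bij_betw q {0..<m} Y"
    using ex_bij_betw_nat_finite[OF assms(2)] m_def by blast
  \<comment> \<open>Both matrices are padded by 0 to squares; then a left inverse is a right inverse.\<close>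
  define M where "M = mat n n (\<lambda>(i, j). if j < m then g (p i) (q j) else 0)"
  define N where "N = mat n n (\<lambda>(i, j). if i < m then f (q i) (p j) else 0)"
  have "M * N = 1\<^sub>m n"
  proof (rule eq_matI)
    fix i j assume "i < dim_row (1\<^sub>m n :: 'k mat)" "j < dim_col (1\<^sub>m n :: 'k mat)"
    then have i: "i < n" and j: "j < n" by auto
    then have pX: "p i \<in> X" "p j \<in> X" and pij: "p i = p j \<longleftrightarrow> i = j"
      using p by (auto simp: bij_betw_def inj_on_eq_iff)
    have "(M * N) $$ (i, j) = (\<Sum>l\<in>{0..<n}. if l < m then g (p i) (q l) * f (q l) (p j) else 0)"
      using i j by (auto simp: M_def N_def scalar_prod_def intro!: sum.cong)
    also have "\<dots> = (\<Sum>l\<in>{0..<m}. g (p i) (q l) * f (q l) (p j))"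
      by (rule sum.mono_neutral_cong_right) (use mn in auto)
    also have "\<dots> = (\<Sum>b\<in>Y. g (p i) b * f b (p j))"
      using sum.reindex_bij_betw[OF q, of "\<lambda>b. g (p i) b * f b (p j)"] by simp
    finally show "(M * N) $$ (i, j) = (1\<^sub>m n :: 'k mat) $$ (i, j)"
      using gf[OF pX] pij i j by simp
  qed (auto simp: M_def N_def)
  then have NM: "N * M = 1\<^sub>m n"
    by (rule mat_mult_left_right_inverse[rotated 2]) (auto simp: M_def N_def)
  have "(N * M) $$ (n - 1, n - 1) = 0"
    using mn by (auto simp: M_def N_def scalar_prod_def intro!: sum.neutral)
  then show False
    using NM mn by simp
qed

text \<open>Betti numbers do not increase along an algebra retract. The inclusion \<open>k[U] \<rightarrow> k[V]\<close> and the
  retraction \<open>k[V] \<rightarrow> k[U]\<close> induce maps \<open>k[U]/J \<rightarrow> k[V]/I \<rightarrow> k[U]/J\<close> with composition the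
  identity, and the lifts to resolutions compose to a map that is homotopic to the identity.
  Over a minimal resolution of \<open>k[U]/J\<close>, it is the identity on constant terms. For \<open>U = V\<close>, this is
  the uniqueness of Betti numbers.\<close>

lemma betti_retract_le:
  fixes U V :: "'v set" and I J :: "('v, 'k::field) mpoly set"
    and \<phi>F :: "nat \<Rightarrow> 'b \<Rightarrow> 'b \<Rightarrow> ('v, 'k) mpoly" and \<phi>G :: "nat \<Rightarrow> 'c \<Rightarrow> 'c \<Rightarrow> ('v, 'k) mpoly"
  assumes J: "hom_ideal U J" and I: "hom_ideal V I"
    and F: "gres U J BF dF \<epsilon>F \<phi>F" and min: "minimal BF \<phi>F"
    and G: "gres V I BG dG \<epsilon>G \<phi>G"
    and UV: "U \<subseteq> V" and JI: "J \<subseteq> I" and IJ: "restr U ` I \<subseteq> J"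
  shows "card {b \<in> BF i. dF i b = e} \<le> card {b \<in> BG i. dG i b = e}"
proof -
  interpret F: resolution U J BF dF \<epsilon>F \<phi>F
    by unfold_locales (fact J, fact F)
  interpret G: resolution V I BG dG \<epsilon>G \<phi>G
    by unfold_locales (fact I, fact G)
  have UV': "p \<in> polys V" if "p \<in> polys U" for p :: "('v, 'k) mpoly"
    using polys_mono[OF UV that] .
  obtain f where f:
    "\<And>j a c. a \<in> BG j \<Longrightarrow> c \<in> BF j \<Longrightarrow> f j a c \<in> polys V"
    "\<And>j a c. a \<in> BG j \<Longrightarrow> c \<in> BF j \<Longrightarrow> homogeneous (dF j c - dG j a) (f j a c)"
    "\<And>c. c \<in> BF 0 \<Longrightarrow> \<epsilon>F c - mv (BG 0) (\<lambda>_. \<epsilon>G) (\<lambda>a. f 0 a c) () \<in> I"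
    "\<And>j a c. a \<in> BG j \<Longrightarrow> c \<in> BF (Suc j) \<Longrightarrow>
       mv (BG (Suc j)) (\<phi>G j) (\<lambda>b. f (Suc j) b c) a = mv (BF j) (f j) (\<lambda>b. \<phi>F j b c) a"
  proof (rule G.lifting[of BF \<phi>F dF \<epsilon>F])
    show "mv (BF 0) (\<lambda>_. \<epsilon>F) (\<lambda>b. \<phi>F 0 b c) () \<in> I" if "c \<in> BF (Suc 0)" for c
      using F.eps_phi[of c] that JI by auto
  qed (use F.phi_polys F.phi_hom F.phi_phi F.eps_polys F.eps_hom UV' in auto)
  let ?\<phi> = "\<lambda>j a b. restr U (\<phi>G j a b)" and ?f = "\<lambda>j a b. restr U (f j a b)"
  obtain g where g:
    "\<And>j a c. a \<in> BF j \<Longrightarrow> c \<in> BG j \<Longrightarrow> g j a c \<in> polys U"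
    "\<And>j a c. a \<in> BF j \<Longrightarrow> c \<in> BG j \<Longrightarrow> homogeneous (dG j c - dF j a) (g j a c)"
    "\<And>c. c \<in> BG 0 \<Longrightarrow> restr U (\<epsilon>G c) - mv (BF 0) (\<lambda>_. \<epsilon>F) (\<lambda>a. g 0 a c) () \<in> J"
    "\<And>j a c. a \<in> BF j \<Longrightarrow> c \<in> BG (Suc j) \<Longrightarrow>
       mv (BF (Suc j)) (\<phi>F j) (\<lambda>b. g (Suc j) b c) a = mv (BG j) (g j) (\<lambda>b. ?\<phi> j b c) a"
  proof (rule F.lifting[of BG ?\<phi> dG "\<lambda>c. restr U (\<epsilon>G c)"])
    show "mv (BG (Suc j)) (?\<phi> j) (\<lambda>b. ?\<phi> (Suc j) b c) a = 0"
      if "a \<in> BG j" "c \<in> BG (Suc (Suc j))" for j a c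
      using G.phi_phi[OF that, THEN arg_cong, of "restr U"] by (simp add: restr_mv) (simp add: restr_def)
    show "mv (BG 0) (\<lambda>_ c. restr U (\<epsilon>G c)) (\<lambda>b. ?\<phi> 0 b c) () \<in> J" if "c \<in> BG (Suc 0)" for c
    proof -
      have "restr U (mv (BG 0) (\<lambda>_. \<epsilon>G) (\<lambda>b. \<phi>G 0 b c) ()) \<in> J"
        using G.eps_phi[of c] that IJ by auto
      then show ?thesis by (simp add: restr_mv)
    qed
  qed (use G.phi_hom G.eps_hom in \<open>auto intro: homogeneous_restr\<close>)
  \<comment> \<open>The composition of the two chain maps, an endomorphism over \<open>k[U]\<close> of the minimal resolution.\<close>
  define h where "h = (\<lambda>j a c. mv (BG j) (g j) (\<lambda>b. ?f j b c) a)"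
  have h_polys: "h j a c \<in> polys U" if "a \<in> BF j" "c \<in> BF j" for j a c
    unfolding h_def using that g(1) by auto
  have h_phi: "mv (BF (Suc j)) (\<phi>F j) (\<lambda>b. h (Suc j) b c) a = mv (BF j) (h j) (\<lambda>b. \<phi>F j b c) a"
    if a: "a \<in> BF j" and c: "c \<in> BF (Suc j)" for j a c
  proof -
    have "mv (BF (Suc j)) (\<phi>F j) (\<lambda>b. h (Suc j) b c) a
        = mv (BG (Suc j)) (\<lambda>a c. mv (BF (Suc j)) (\<phi>F j) (\<lambda>b. g (Suc j) b c) a) (\<lambda>b. ?f (Suc j) b c) a"
      unfolding h_def by (rule mv_mv)
    also have "\<dots> = mv (BG (Suc j)) (\<lambda>a c. mv (BG j) (g j) (\<lambda>b. ?\<phi> j b c) a) (\<lambda>b. ?f (Suc j) b c) a"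
      using g(4)[OF a] by (intro mv_cong) auto
    also have "\<dots> = mv (BG j) (g j) (mv (BG (Suc j)) (?\<phi> j) (\<lambda>b. ?f (Suc j) b c)) a"
      by (rule mv_mv[symmetric])
    also have "\<dots> = mv (BG j) (g j) (\<lambda>b. restr U (mv (BG (Suc j)) (\<phi>G j) (\<lambda>b. f (Suc j) b c) b)) a"
      by (simp add: mv_def restr_sum restr_mult)
    also have "\<dots> = mv (BG j) (g j) (\<lambda>b. restr U (mv (BF j) (f j) (\<lambda>b. \<phi>F j b c) b)) a"
      using f(4)[OF _ c] by (intro mv_cong) auto
    also have "\<dots> = mv (BG j) (g j) (mv (BF j) (?f j) (\<lambda>b. \<phi>F j b c)) a"
      using F.phi_polys[OF _ c] unfolding restr_mv by (intro mv_cong) (auto simp: restr_id)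
    also have "\<dots> = mv (BF j) (h j) (\<lambda>b. \<phi>F j b c) a"
      unfolding mv_mv h_def ..
    finally show ?thesis .
  qed
  have h_eps: "mv (BF 0) (\<lambda>_. \<epsilon>F) (\<lambda>a. h 0 a c) () - \<epsilon>F c \<in> J" if c: "c \<in> BF 0" for c
  proof -
    have "restr U (\<epsilon>F c - mv (BG 0) (\<lambda>_. \<epsilon>G) (\<lambda>a. f 0 a c) ()) \<in> J"
      using f(3)[OF c] IJ by auto
    then have 1: "\<epsilon>F c - mv (BG 0) (\<lambda>_ b. restr U (\<epsilon>G b)) (\<lambda>a. ?f 0 a c) () \<in> J"
      using F.eps_polys[OF c] by (simp add: restr_diff restr_mv restr_id)
    have "mv (BG 0) (\<lambda>_ b. restr U (\<epsilon>G b) - mv (BF 0) (\<lambda>_. \<epsilon>F) (\<lambda>a. g 0 a b) ()) (\<lambda>a. ?f 0 a c) () \<in> J"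
      unfolding mv_def[of "BG 0"]
      by (rule ideal_sum[OF J], rule ideal_mult_right[OF J]) (use g(3) in auto)
    then have 2: "mv (BG 0) (\<lambda>_ b. restr U (\<epsilon>G b)) (\<lambda>a. ?f 0 a c) () -
        mv (BF 0) (\<lambda>_. \<epsilon>F) (\<lambda>a. h 0 a c) () \<in> J"
      unfolding mv_diff_left h_def mv_mv by simp
    show ?thesis
      using ideal_uminus[OF J ideal_add[OF J 1 2]] by simp
  qed
  let ?id = "\<lambda>a c. if a = c then 1 else 0 :: ('v, 'k) mpoly"
  \<comment> \<open>Write \<open>h - id\<close> as \<open>k + t\<close>, where \<open>t\<close> is the part of the homotopy that factors through the
    differential out of the \<open>j\<close>-th module. Then \<open>k\<close> maps to cycles, \<open>t\<close> has constant terms 0 by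
    minimality, and \<open>t\<close> vanishes on the image of the next differential.\<close>
  have "\<exists>k. (\<forall>c\<in>BF j. (\<forall>a\<in>BF j. k a c \<in> polys U \<and> const_term (k a c) = const_term (h j a c - ?id a c)) \<and>
      F.cyc' j (\<lambda>a. k a c)) \<and>
    (\<forall>a\<in>BF j. \<forall>c\<in>BF (Suc j). mv (BF j) (\<lambda>a b. h j a b - ?id a b - k a b) (\<lambda>b. \<phi>F j b c) a = 0)" for j
  proof (induction j)
    case 0
    have "F.cyc' 0 (\<lambda>a. h 0 a c - ?id a c)" if "c \<in> BF 0" for c
      using h_eps[OF that] that F.fin unfolding cyc_0 mv_diff by (simp add: mv_delta)
    then show ?case
      using h_polys by (intro exI[of _ "\<lambda>a c. h 0 a c - ?id a c"]) (auto simp: mv_zero_left)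
  next
    case (Suc j)
    then obtain k where k:
      "\<And>a c. a \<in> BF j \<Longrightarrow> c \<in> BF j \<Longrightarrow> k a c \<in> polys U"
      "\<And>c. c \<in> BF j \<Longrightarrow> F.cyc' j (\<lambda>a. k a c)"
      "\<And>a c. a \<in> BF j \<Longrightarrow> c \<in> BF (Suc j) \<Longrightarrow>
         mv (BF j) (\<lambda>a b. h j a b - ?id a b - k a b) (\<lambda>b. \<phi>F j b c) a = 0"
      by blast
    have "\<exists>s. \<forall>c\<in>BF j. (\<forall>b\<in>BF (Suc j). s c b \<in> polys U) \<and>
        (\<forall>a\<in>BF j. k a c = mv (BF (Suc j)) (\<phi>F j) (s c) a)"
    proof (rule bchoice, rule ballI)
      fix c assume c: "c \<in> BF j"
      have "F.bnd' j (\<lambda>a. k a c)"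
        using F.cyc_iff_bnd[of j "\<lambda>a. k a c"] k(1)[OF _ c] k(2)[OF c] by blast
      then show "\<exists>s. (\<forall>b\<in>BF (Suc j). s b \<in> polys U) \<and> (\<forall>a\<in>BF j. k a c = mv (BF (Suc j)) (\<phi>F j) s a)"
        by (auto elim!: bndE)
    qed
    then obtain s where s: "\<And>b c. c \<in> BF j \<Longrightarrow> b \<in> BF (Suc j) \<Longrightarrow> s c b \<in> polys U"
        "\<And>a c. c \<in> BF j \<Longrightarrow> a \<in> BF j \<Longrightarrow> k a c = mv (BF (Suc j)) (\<phi>F j) (s c) a"
      by blast
    define t where "t = (\<lambda>a c. mv (BF j) (\<lambda>b a. s a b) (\<lambda>b. \<phi>F j b c) a)"
    define k' where "k' = (\<lambda>a c. h (Suc j) a c - ?id a c - t a c)"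
    have t_polys: "t a c \<in> polys U" if "a \<in> BF (Suc j)" "c \<in> BF (Suc j)" for a c
      unfolding t_def using that s(1) F.phi_polys by auto
    have k'_polys: "k' a c \<in> polys U" if "a \<in> BF (Suc j)" "c \<in> BF (Suc j)" for a c
      unfolding k'_def using h_polys[OF that] t_polys[OF that] by (intro polys_diff) auto
    have t_const: "const_term (t a c) = 0" if "c \<in> BF (Suc j)" for a c
      using min that by (simp add: t_def mv_def const_term_sum const_term_mult minimal_def)
    have "F.cyc' (Suc j) (\<lambda>a. k' a c)" if c: "c \<in> BF (Suc j)" for c
      unfolding cyc_Suc
    proof
      fix a assume a: "a \<in> BF j"
      have "mv (BF (Suc j)) (\<phi>F j) (\<lambda>b. t b c) a = mv (BF j) k (\<lambda>b. \<phi>F j b c) a"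
        unfolding t_def mv_mv using s(2)[OF _ a] by (intro mv_cong) auto
      moreover have "mv (BF j) ?id (\<lambda>b. \<phi>F j b c) a = \<phi>F j a c"
        using F.fin a by (simp add: mv_delta_left)
      moreover have "mv (BF (Suc j)) (\<phi>F j) (\<lambda>b. ?id b c) a = \<phi>F j a c"
        using F.fin c by (simp add: mv_delta)
      ultimately show "mv (BF (Suc j)) (\<phi>F j) (\<lambda>a. k' a c) a = 0"
        using k(3)[OF a c] h_phi[OF a c] unfolding k'_def mv_diff mv_diff_left by simp
    qed
    moreover have "mv (BF (Suc j)) (\<lambda>a b. h (Suc j) a b - ?id a b - k' a b) (\<lambda>b. \<phi>F (Suc j) b c) a = 0"
      if a: "a \<in> BF (Suc j)" and c: "c \<in> BF (Suc (Suc j))" for a c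
    proof -
      have "mv (BF (Suc j)) (\<lambda>a b. h (Suc j) a b - ?id a b - k' a b) (\<lambda>b. \<phi>F (Suc j) b c) a
          = mv (BF (Suc j)) t (\<lambda>b. \<phi>F (Suc j) b c) a"
        by (intro mv_cong) (auto simp: k'_def)
      also have "\<dots> = mv (BF j) (\<lambda>b a. s a b) (mv (BF (Suc j)) (\<phi>F j) (\<lambda>b. \<phi>F (Suc j) b c)) a"
        unfolding t_def mv_mv ..
      also have "\<dots> = mv (BF j) (\<lambda>b a. s a b) (\<lambda>_. 0) a"
        using F.phi_phi[OF _ c] by (intro mv_cong) auto
      finally show ?thesis by simp
    qed
    ultimately show ?case
      using k'_polys t_const
      by (intro exI[of _ k']) (auto simp: k'_def const_term_diff)
  qed
  note homotopy = this
  have h_const: "const_term (h i a c) = (if a = c then 1 else 0)" if a: "a \<in> BF i" and c: "c \<in> BF i" for a c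
  proof -
    obtain k where k: "\<And>a. a \<in> BF i \<Longrightarrow> k a c \<in> polys U" "F.cyc' i (\<lambda>a. k a c)"
      "const_term (k a c) = const_term (h i a c - ?id a c)"
      using homotopy[of i] a c by blast
    then have "F.bnd' i (\<lambda>a. k a c)"
      using F.cyc_iff_bnd[of i "\<lambda>a. k a c"] by blast
    then obtain w where "k a c = mv (BF (Suc i)) (\<phi>F i) w a"
      using a by (auto elim!: bndE)
    then have "const_term (k a c) = 0"
      using min a by (simp add: mv_def const_term_sum const_term_mult minimal_def)
    with k(3) show ?thesis
      by (simp add: const_term_diff split: if_splits)
  qed
  show ?thesis
  proof (rule card_le_if_left_inverse)
    fix a c assume a: "a \<in> {b \<in> BF i. dF i b = e}" and c: "c \<in> {b \<in> BF i. dF i b = e}"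
    \<comment> \<open>The entries of graded maps between basis elements of different degrees have constant term 0.\<close>
    have "const_term (g i a b) = 0" if "b \<in> BG i" "dG i b \<noteq> e" for b
      using g(2)[of a i b] a that by (intro const_term_homogeneous_eq_0) auto
    then have "(\<Sum>b\<in>{b \<in> BG i. dG i b = e}. const_term (g i a b) * const_term (f i b c))
        = (\<Sum>b\<in>BG i. const_term (g i a b) * const_term (f i b c))"
      by (intro sum.mono_neutral_left) (use G.fin in auto)
    also have "\<dots> = const_term (h i a c)"
      by (simp add: h_def mv_def const_term_sum const_term_mult)
    finally show "(\<Sum>b\<in>{b \<in> BG i. dG i b = e}. const_term (g i a b) * const_term (f i b c))
        = (if a = c then 1 else 0)"
      using h_const a c by simp
  qed (use F.fin G.fin in auto)
qed

section \<open>Minimal resolutions\<close>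

lemma mv_remove: "finite C \<Longrightarrow> c \<in> C \<Longrightarrow> mv C A v a = A a c * v c + mv (C - {c}) A v a"
  by (simp add: mv_def sum.remove)

lemma mv_upd_0:
  assumes "finite C"
  shows "mv C A (v(c := 0)) a = mv (C - {c}) A v a"
  unfolding mv_def by (rule sum.mono_neutral_cong_right) (use assms in auto)

lemma bndD:
  "bnd V B \<phi> i y \<Longrightarrow>
     \<exists>w. (\<forall>b\<in>B (Suc i). w b \<in> polys V) \<and> (\<forall>a\<in>B i. y a = mv (B (Suc i)) (\<phi> i) w a)"
  unfolding bnd_def by blast

context resolution
begin

context
  fixes i :: nat and a0 b0 :: 'b
  assumes a0: "a0 \<in> B i" and b0: "b0 \<in> B (Suc i)" and unit: "const_term (\<phi> i a0 b0) \<noteq> 0"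
begin

text \<open>If the entry of a differential at \<open>(a0, b0)\<close> has a nonzero constant term, then it is a constant by
  homogeneity, and the basis elements \<open>a0\<close> and \<open>b0\<close> can be removed. The other entries of the
  differential change by a step of Gaussian elimination.\<close>

definition inv_entry :: "('v, 'k) mpoly" where
  "inv_entry = Poly_Mapping.single 0 (inverse (const_term (\<phi> i a0 b0)))"

definition cancel_basis :: "nat \<Rightarrow> 'b set" where
  "cancel_basis = B(i := B i - {a0}, Suc i := B (Suc i) - {b0})"

definition cancel_diff :: "nat \<Rightarrow> 'b \<Rightarrow> 'b \<Rightarrow> ('v, 'k) mpoly" where
  "cancel_diff = \<phi>(i := \<lambda>a b. \<phi> i a b - \<phi> i a b0 * inv_entry * \<phi> i a0 b)"

text \<open>A vector in the kernel of the row \<open>a0\<close> is determined by its entries other than that at \<open>b0\<close>.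
  The map \<open>ext_row\<close> changes the entry at \<open>b0\<close> to the one for which the vector lies in this kernel.\<close>

definition ext_row :: "('b \<Rightarrow> ('v, 'k) mpoly) \<Rightarrow> 'b \<Rightarrow> ('v, 'k) mpoly" where
  "ext_row y = y(b0 := - inv_entry * mv (B (Suc i) - {b0}) (\<phi> i) y a0)"

lemma degrees_eq: "d (Suc i) b0 = d i a0"
  using homogeneous_const_term(1)[OF phi_hom[OF a0 b0] unit] by simp

lemma inv_entry: "\<phi> i a0 b0 * inv_entry = 1"
proof -
  have "\<phi> i a0 b0 * inv_entry = Poly_Mapping.single 0 (const_term (\<phi> i a0 b0)) * inv_entry"
    using homogeneous_const_term(2)[OF phi_hom[OF a0 b0] unit] by simp
  also have "\<dots> = 1"
    using unit by (simp add: inv_entry_def mult_single)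
  finally show ?thesis .
qed

lemma inv_entry_polys: "inv_entry \<in> polys V"
  by (auto simp: inv_entry_def)

lemma cancel_basis_simps:
  "cancel_basis i = B i - {a0}" "cancel_basis (Suc i) = B (Suc i) - {b0}"
  "j \<noteq> i \<Longrightarrow> j \<noteq> Suc i \<Longrightarrow> cancel_basis j = B j"
  "cancel_diff i = (\<lambda>a b. \<phi> i a b - \<phi> i a b0 * inv_entry * \<phi> i a0 b)"
  "j \<noteq> i \<Longrightarrow> cancel_diff j = \<phi> j"
  by (auto simp: cancel_basis_def cancel_diff_def)

lemma cancel_basis_subset: "cancel_basis j \<subseteq> B j"
  by (auto simp: cancel_basis_def)

lemma cancel_diff_mv:
  "mv (B (Suc i) - {b0}) (cancel_diff i) y a = mv (B (Suc i)) (\<phi> i) (ext_row y) a"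
proof -
  have "mv (B (Suc i)) (\<phi> i) (ext_row y) a =
      \<phi> i a b0 * ext_row y b0 + mv (B (Suc i) - {b0}) (\<phi> i) (ext_row y) a"
    using fin b0 by (rule mv_remove)
  also have "mv (B (Suc i) - {b0}) (\<phi> i) (ext_row y) a = mv (B (Suc i) - {b0}) (\<phi> i) y a"
    by (rule mv_cong) (auto simp: ext_row_def)
  also have "\<phi> i a b0 * ext_row y b0 = - (\<phi> i a b0 * inv_entry) * mv (B (Suc i) - {b0}) (\<phi> i) y a0"
    by (simp add: ext_row_def algebra_simps)
  finally show ?thesis
    by (simp add: cancel_basis_simps mv_diff_left)
      (simp add: mv_def sum_distrib_left mult_ac)
qed

lemma ext_row_row: "mv (B (Suc i)) (\<phi> i) (ext_row y) a0 = 0"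
proof -
  have "cancel_diff i a0 b = 0" for b
    by (simp add: cancel_basis_simps inv_entry)
  then show ?thesis
    unfolding cancel_diff_mv[symmetric] by (intro mv_zero_left) simp
qed

lemma ext_row_id:
  assumes "mv (B (Suc i)) (\<phi> i) v a0 = 0"
  shows "ext_row v = v"
proof -
  have "\<phi> i a0 b0 * v b0 + mv (B (Suc i) - {b0}) (\<phi> i) v a0 = 0"
    using assms mv_remove[OF fin b0] by metis
  then have "inv_entry * (\<phi> i a0 b0 * v b0) = - inv_entry * mv (B (Suc i) - {b0}) (\<phi> i) v a0"
    by (metis add.inverse_unique minus_mult_commute add.commute)
  moreover have "inv_entry * (\<phi> i a0 b0 * v b0) = v b0"
    using inv_entry by (simp add: mult.assoc[symmetric] mult.commute[of inv_entry])
  ultimately show ?thesis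
    by (auto simp: ext_row_def)
qed

lemma ext_row_polys:
  assumes "\<And>b. b \<in> B (Suc i) - {b0} \<Longrightarrow> y b \<in> polys V" "b \<in> B (Suc i)"
  shows "ext_row y b \<in> polys V"
  using assms inv_entry_polys phi_polys[OF a0]
  by (auto simp: ext_row_def intro!: polys_uminus polys_mult mv_polys)

lemma ext_row_cong:
  assumes "\<And>b. b \<in> B (Suc i) - {b0} \<Longrightarrow> y b = y' b" "b \<in> B (Suc i)"
  shows "ext_row y b = ext_row y' b"
  using assms mv_cong[of a0 a0 "B (Suc i) - {b0}" "\<phi> i" "\<phi> i" y y'] by (auto simp: ext_row_def)

text \<open>Modulo the column \<open>b0\<close> of the differential, every vector is congruent to one with entry 0 at \<open>a0\<close>.\<close>

lemma clear_entry:
  assumes "\<And>a. a \<in> B i \<Longrightarrow> w a \<in> polys V"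
  obtains w' where "\<And>a. a \<in> B i \<Longrightarrow> w' a \<in> polys V" "w' a0 = 0"
    "\<And>a. w' a = w a - inv_entry * w a0 * \<phi> i a b0"
proof -
  let ?w = "\<lambda>a. w a - inv_entry * w a0 * \<phi> i a b0"
  have "?w a0 = 0"
    using inv_entry by (simp add: mult_ac)
  moreover have "?w a \<in> polys V" if "a \<in> B i" for a
    using that assms a0 inv_entry_polys phi_polys[OF _ b0] by (intro polys_diff polys_mult) auto
  ultimately show ?thesis
    by (intro that[of ?w]) auto
qed

abbreviation (input) "ccyc \<equiv> cyc I cancel_basis \<epsilon> cancel_diff"
abbreviation (input) "cbnd \<equiv> bnd V cancel_basis cancel_diff"

lemma cancel_cyc_i: "ccyc i y \<longleftrightarrow> cyc' i (y(a0 := 0))"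
proof (cases i)
  case 0
  then show ?thesis
    using cancel_basis_simps(1) mv_upd_0[OF fin[of 0], of "\<lambda>_. \<epsilon>" y a0 "()"] by (simp add: cyc_0)
next
  case (Suc k)
  then show ?thesis
    using cancel_basis_simps(1) cancel_basis_simps(3,5)[of k] mv_upd_0[OF fin[of i], of "\<phi> k"]
    by (simp add: cyc_Suc)
qed

lemma cancel_bnd_i: "cbnd i y \<longleftrightarrow> bnd' i (y(a0 := 0))"
proof
  assume "cbnd i y"
  then obtain w where "(\<forall>b\<in>cancel_basis (Suc i). w b \<in> polys V) \<and>
      (\<forall>a\<in>cancel_basis (i). y a = mv (cancel_basis (Suc i)) (cancel_diff (i)) w a)"
    by (rule bndD[THEN exE])
  note w = this[THEN conjunct1, rule_format] this[THEN conjunct2, rule_format]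
  note w = w[unfolded cancel_basis_simps(1,2)]
  show "bnd' i (y(a0 := 0))"
    by (rule bndI[of _ _ "ext_row w"])
      (use w ext_row_polys[of w] ext_row_row cancel_diff_mv in auto)
next
  assume "bnd' i (y(a0 := 0))"
  then obtain w where "(\<forall>b\<in>B (Suc i). w b \<in> polys V) \<and>
      (\<forall>a\<in>B i. (y(a0 := 0)) a = mv (B (Suc i)) (\<phi> i) w a)"
    by (rule bndD[THEN exE])
  note w = this[THEN conjunct1, rule_format] this[THEN conjunct2, rule_format]
  have "ext_row w = w"
    by (rule ext_row_id) (use w(2)[OF a0] in simp)
  moreover have "y a = mv (B (Suc i)) (\<phi> i) w a" if "a \<in> B i - {a0}" for a
    using w(2)[of a] that by simp
  ultimately show "cbnd i y"
    using w(1) by (intro bndI[of _ _ w]) (auto simp: cancel_basis_simps(1,2) cancel_diff_mv)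
qed

lemma cancel_cyc_Suc: "ccyc (Suc i) y \<longleftrightarrow> cyc' (Suc i) (ext_row y)"
  using ext_row_row[of y] by (auto simp: cyc_Suc cancel_basis_simps(1,2) cancel_diff_mv)

lemma cancel_bnd_Suc: "cbnd (Suc i) y \<longleftrightarrow> bnd' (Suc i) (ext_row y)"
proof
  assume "cbnd (Suc i) y"
  then obtain w where "(\<forall>b\<in>cancel_basis (Suc (Suc i)). w b \<in> polys V) \<and>
      (\<forall>a\<in>cancel_basis (Suc i). y a = mv (cancel_basis (Suc (Suc i))) (cancel_diff (Suc i)) w a)"
    by (rule bndD[THEN exE])
  note w = this[THEN conjunct1, rule_format] this[THEN conjunct2, rule_format]
  from w have w: "\<And>b. b \<in> B (Suc (Suc i)) \<Longrightarrow> w b \<in> polys V"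
    "\<And>a. a \<in> B (Suc i) - {b0} \<Longrightarrow> y a = mv (B (Suc (Suc i))) (\<phi> (Suc i)) w a"
    by (simp_all add: cancel_basis_simps)
  let ?v = "mv (B (Suc (Suc i))) (\<phi> (Suc i)) w"
  have "ext_row ?v = ?v"
    by (rule ext_row_id) (rule phi_phi_mv[OF a0])
  then show "bnd' (Suc i) (ext_row y)"
    using w ext_row_cong[of y ?v] by (intro bndI[of _ _ w]) auto
next
  assume "bnd' (Suc i) (ext_row y)"
  then show "cbnd (Suc i) y"
    by (auto simp: bnd_def cancel_basis_simps ext_row_def split: if_splits)
qed

lemma cancel_cyc_Suc_Suc: "ccyc (Suc (Suc i)) y \<longleftrightarrow> cyc' (Suc (Suc i)) y"
proof -
  let ?v = "mv (B (Suc (Suc i))) (\<phi> (Suc i)) y"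
  have "?v b0 = 0" if "\<And>b. b \<in> B (Suc i) - {b0} \<Longrightarrow> ?v b = 0"
  proof -
    have "ext_row ?v = ?v"
      by (rule ext_row_id) (rule phi_phi_mv[OF a0])
    then have "?v b0 = ext_row ?v b0" by simp
    also have "\<dots> = ext_row (\<lambda>_. 0) b0"
      by (rule ext_row_cong) (use that b0 in auto)
    finally show ?thesis by (simp add: ext_row_def)
  qed
  then show ?thesis
    by (auto simp: cyc_Suc cancel_basis_simps)
qed

lemma cancel_bnd_before:
  assumes j: "Suc j = i"
  shows "cbnd j y \<longleftrightarrow> bnd' j y"
proof -
  have bases: "cancel_basis j = B j" "cancel_basis (Suc j) = B i - {a0}" "cancel_diff j = \<phi> j"
    using cancel_basis_simps(3,5)[of j] cancel_basis_simps(1) j by simp_all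
  show ?thesis
  proof
    assume "cbnd j y"
    then obtain w where "(\<forall>b\<in>cancel_basis (Suc j). w b \<in> polys V) \<and>
        (\<forall>a\<in>cancel_basis (j). y a = mv (cancel_basis (Suc j)) (cancel_diff (j)) w a)"
      by (rule bndD[THEN exE])
    note w = this[THEN conjunct1, rule_format] this[THEN conjunct2, rule_format]
    note w = w[unfolded bases]
    then show "bnd' j y"
      using j mv_upd_0[OF fin[of i], of "\<phi> j" w a0] by (intro bndI[of _ _ "w(a0 := 0)"]) auto
  next
    assume "bnd' j y"
    then obtain w where w: "\<And>b. b \<in> B i \<Longrightarrow> w b \<in> polys V"
      "\<And>a. a \<in> B j \<Longrightarrow> y a = mv (B i) (\<phi> j) w a"
      using j by (auto elim!: bndE)
    obtain w' where w': "\<And>a. a \<in> B i \<Longrightarrow> w' a \<in> polys V" "w' a0 = 0"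
        "\<And>a. w' a = w a - inv_entry * w a0 * \<phi> i a b0"
      using clear_entry[of w] w(1) by metis
    have "y a = mv (B i - {a0}) (\<phi> j) w' a" if a: "a \<in> B j" for a
    proof -
      have "mv (B i - {a0}) (\<phi> j) w' a = mv (B i) (\<phi> j) w' a"
        using mv_remove[OF fin a0, of "\<phi> j" w' a] w'(2) by simp
      also have "\<dots> = mv (B i) (\<phi> j) w a - inv_entry * w a0 * mv (B i) (\<phi> j) (\<lambda>b. \<phi> i b b0) a"
        unfolding w'(3)[abs_def] mv_diff mv_scale ..
      also have "mv (B i) (\<phi> j) (\<lambda>b. \<phi> i b b0) a = 0"
        using phi_phi[OF a, of b0] b0 j by auto
      finally show ?thesis
        using w(2)[OF a] by simp
    qed
    then show "cbnd j y"
      using w'(1) bases by (intro bndI[of _ _ w']) auto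
  qed
qed

lemma cancel_surj:
  assumes "p \<in> polys V"
  shows "\<exists>v. (\<forall>b\<in>cancel_basis 0. v b \<in> polys V) \<and> p - mv (cancel_basis 0) (\<lambda>_. \<epsilon>) v () \<in> I"
proof -
  obtain v where v: "\<And>b. b \<in> B 0 \<Longrightarrow> v b \<in> polys V" "p - mv (B 0) (\<lambda>_. \<epsilon>) v () \<in> I"
    using surj[OF assms] by blast
  show ?thesis
  proof (cases "i = 0")
    case True
    obtain v' where v': "\<And>a. a \<in> B i \<Longrightarrow> v' a \<in> polys V" "v' a0 = 0"
        "\<And>a. v' a = v a - inv_entry * v a0 * \<phi> i a b0"
      using clear_entry[of v] v(1) unfolding True by metis
    have "mv (B i - {a0}) (\<lambda>_. \<epsilon>) v' () = mv (B i) (\<lambda>_. \<epsilon>) v' ()"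
      using mv_remove[OF fin a0, of "\<lambda>_. \<epsilon>" v' "()"] v'(2) by simp
    also have "\<dots> = mv (B i) (\<lambda>_. \<epsilon>) v () - inv_entry * v a0 * mv (B i) (\<lambda>_. \<epsilon>) (\<lambda>b. \<phi> i b b0) ()"
      unfolding v'(3)[abs_def] mv_diff mv_scale ..
    finally have eq: "p - mv (B i - {a0}) (\<lambda>_. \<epsilon>) v' () =
        (p - mv (B 0) (\<lambda>_. \<epsilon>) v ()) + inv_entry * v a0 * mv (B 0) (\<lambda>_. \<epsilon>) (\<lambda>b. \<phi> 0 b b0) ()"
      using True by simp
    have "inv_entry * v a0 * mv (B 0) (\<lambda>_. \<epsilon>) (\<lambda>b. \<phi> 0 b b0) () \<in> I"
      by (rule ideal_mult[OF hom_ideal], rule polys_mult)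
        (use eps_phi[of b0] b0 a0 v(1) inv_entry_polys True in simp_all)
    from ideal_add[OF hom_ideal v(2) this] have "p - mv (B i - {a0}) (\<lambda>_. \<epsilon>) v' () \<in> I"
      unfolding eq .
    moreover have "cancel_basis 0 = B i - {a0}"
      using cancel_basis_simps(1) True by simp
    ultimately show ?thesis
      using v'(1) by (intro exI[of _ v']) auto
  next
    case False
    then show ?thesis
      using v cancel_basis_simps(3)[of 0] by auto
  qed
qed

lemma cancel_gres: "gres V I cancel_basis d \<epsilon> cancel_diff"
proof -
  have "ccyc j y \<longleftrightarrow> cbnd j y" if y: "\<And>a. a \<in> cancel_basis j \<Longrightarrow> y a \<in> polys V" for j y
  proof -
    consider "j = i" | "j = Suc i" | "j = Suc (Suc i)" | "Suc j = i" |
      "j \<noteq> i" "j \<noteq> Suc i" "j \<noteq> Suc (Suc i)" "Suc j \<noteq> i" by blast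
    then show ?thesis
    proof cases
      case 1
      have "cyc' i (y(a0 := 0)) \<longleftrightarrow> bnd' i (y(a0 := 0))"
        by (rule cyc_iff_bnd) (use y 1 in \<open>auto simp: cancel_basis_simps\<close>)
      then show ?thesis
        using 1 cancel_cyc_i cancel_bnd_i by simp
    next
      case 2
      have "cyc' (Suc i) (ext_row y) \<longleftrightarrow> bnd' (Suc i) (ext_row y)"
        by (rule cyc_iff_bnd) (use y 2 in \<open>auto simp: cancel_basis_simps intro!: ext_row_polys\<close>)
      then show ?thesis
        using 2 cancel_cyc_Suc cancel_bnd_Suc by simp
    next
      case 3
      have "cbnd j y \<longleftrightarrow> bnd' j y"
        using 3 by (simp add: bnd_def cancel_basis_simps)
      moreover have "ccyc j y \<longleftrightarrow> cyc' j y"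
        using 3 cancel_cyc_Suc_Suc by simp
      moreover have "cyc' j y \<longleftrightarrow> bnd' j y"
        by (rule cyc_iff_bnd) (use y 3 in \<open>auto simp: cancel_basis_simps\<close>)
      ultimately show ?thesis by simp
    next
      case 4
      have "ccyc j y \<longleftrightarrow> cyc' j y"
        using 4 by (cases j) (auto simp: cyc_0 cyc_Suc cancel_basis_simps)
      moreover have "cyc' j y \<longleftrightarrow> bnd' j y"
        by (rule cyc_iff_bnd) (use y 4 in \<open>auto simp: cancel_basis_simps\<close>)
      ultimately show ?thesis
        using cancel_bnd_before[OF 4] by simp
    next
      case 5
      have "ccyc j y \<longleftrightarrow> cyc' j y"
        using 5 by (cases j) (auto simp: cyc_0 cyc_Suc cancel_basis_simps)
      moreover have "cbnd j y \<longleftrightarrow> bnd' j y"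
        using 5 by (simp add: bnd_def cancel_basis_simps)
      moreover have "cyc' j y \<longleftrightarrow> bnd' j y"
        by (rule cyc_iff_bnd) (use y 5 in \<open>auto simp: cancel_basis_simps\<close>)
      ultimately show ?thesis by simp
    qed
  qed
  note exact = this
  show ?thesis
  proof (rule gresI)
    fix j a b assume a': "a \<in> cancel_basis j" and b': "b \<in> cancel_basis (Suc j)"
    then have a: "a \<in> B j" and b: "b \<in> B (Suc j)"
      using cancel_basis_subset by blast+
    show "cancel_diff j a b \<in> polys V"
    proof (cases "j = i")
      case True
      show ?thesis
        unfolding True cancel_basis_simps
        by (intro polys_diff polys_mult phi_polys inv_entry_polys a0 b0) (use a b True in auto)
    qed (use a b phi_polys in \<open>simp add: cancel_basis_simps\<close>)
    show "homogeneous (d (Suc j) b - d j a) (cancel_diff j a b)"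
    proof (cases "j = i")
      case True
      have "homogeneous (d (Suc i) b0 - d i a) (\<phi> i a b0 * inv_entry)"
        by (rule homogeneous_mult_eq[OF phi_hom[OF _ b0]])
          (use a True in \<open>auto simp: inv_entry_def\<close>)
      then have "homogeneous (d (Suc i) b - d i a) (\<phi> i a b0 * inv_entry * \<phi> i a0 b)"
        by (rule homogeneous_mult_eq[OF _ phi_hom[OF a0]]) (use b True degrees_eq in auto)
      then show ?thesis
        using phi_hom[OF a b] True by (auto simp: cancel_basis_simps)
    qed (use a b phi_hom in \<open>simp add: cancel_basis_simps\<close>)
  next
    fix j show "finite (cancel_basis j)"
      using cancel_basis_subset fin by (metis finite_subset)
  next
    fix b assume "b \<in> cancel_basis 0"
    then show "\<epsilon> b \<in> polys V" "homogeneous (d 0 b) (\<epsilon> b)"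
      using cancel_basis_subset eps_polys eps_hom by blast+
  qed (use exact cancel_surj in blast)+
qed

end

end

text \<open>Cancelling decreases the total rank, and it keeps the degrees of the remaining basis elements.\<close>

lemma exists_minimal_gres:
  fixes B :: "nat \<Rightarrow> 'b set" and I :: "('v, 'k::field) mpoly set"
  assumes I: "hom_ideal V I" and "gres V I B d \<epsilon> \<phi>" and "\<And>i. i \<ge> N \<Longrightarrow> B i = {}"
  shows "\<exists>B' \<phi>'. gres V I B' d \<epsilon> \<phi>' \<and> minimal B' \<phi>' \<and> (\<forall>i. B' i \<subseteq> B i)"
  using assms(2,3)
proof (induction "\<Sum>i<N. card (B i)" arbitrary: B \<phi> rule: less_induct)
  case less
  interpret resolution V I B d \<epsilon> \<phi>
    using I less.prems(1) by unfold_locales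
  show ?case
  proof (cases "minimal B \<phi>")
    case True
    then show ?thesis using less.prems(1) by blast
  next
    case False
    then obtain i a0 b0 where i: "a0 \<in> B i" "b0 \<in> B (Suc i)" "const_term (\<phi> i a0 b0) \<noteq> 0"
      by (auto simp: minimal_def)
    let ?B = "cancel_basis i a0 b0"
    have sub: "?B j \<subseteq> B j" for j
      using cancel_basis_subset[OF i] .
    have "i < N"
      using less.prems(2)[of i] i(1) by (cases "i < N") auto
    moreover have "card (?B i) < card (B i)"
      using cancel_basis_simps(1)[OF i] card_Diff1_less[OF fin i(1)] by simp
    ultimately have "(\<Sum>i<N. card (?B i)) < (\<Sum>i<N. card (B i))"
      using sub fin by (intro sum_strict_mono_ex1) (auto intro: card_mono)
    then obtain B' \<phi>' where "gres V I B' d \<epsilon> \<phi>'" "minimal B' \<phi>'" "\<And>j. B' j \<subseteq> ?B j"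
      using less.hyps[OF _ cancel_gres[OF i]] sub less.prems(2) by blast
    then show ?thesis
      using sub by blast
  qed
qed

section \<open>The horseshoe lemma and mapping cones\<close>

lemma mv_reindex:
  assumes "bij_betw h C' C" "\<And>c. c \<in> C' \<Longrightarrow> v' c = v (h c)" "\<And>c. c \<in> C' \<Longrightarrow> A' a' c = A a (h c)"
  shows "mv C' A' v' a' = mv C A v a"
  unfolding mv_def sum.reindex_bij_betw[OF assms(1), symmetric] using assms(2,3) by simp

lemma gres_reindex:
  fixes I :: "('v, 'k::field) mpoly set" and B' :: "nat \<Rightarrow> 'c set" and B :: "nat \<Rightarrow> 'b set"
  assumes g: "gres V I B d \<epsilon> \<phi>" and h: "\<And>i. bij_betw (h i) (B' i) (B i)"
  shows "gres V I B' (\<lambda>i b. d i (h i b)) (\<lambda>b. \<epsilon> (h 0 b)) (\<lambda>i a b. \<phi> i (h i a) (h (Suc i) b))"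
    (is "gres V I B' ?d ?\<epsilon> ?\<phi>")
proof -
  let ?k = "\<lambda>i. the_inv_into (B' i) (h i)"
  have hB: "h i a \<in> B i" if "a \<in> B' i" for i a
    using h[of i] that by (auto simp: bij_betw_def)
  have kB: "?k i b \<in> B' i" "h i (?k i b) = b" if "b \<in> B i" for i b
    using h[of i] that by (auto simp: bij_betw_def the_inv_into_into f_the_inv_into_f)
  have kh: "?k i (h i a) = a" if "a \<in> B' i" for i a
    using h[of i] that by (auto simp: bij_betw_def the_inv_into_f_f)
  have cyc: "cyc I B' ?\<epsilon> ?\<phi> i y \<longleftrightarrow> cyc I B \<epsilon> \<phi> i (\<lambda>b. y (?k i b))" for i y
  proof (cases i)
    case 0
    have "mv (B' 0) (\<lambda>_. ?\<epsilon>) y () = mv (B 0) (\<lambda>_. \<epsilon>) (\<lambda>b. y (?k 0 b)) ()"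
      by (rule mv_reindex[OF h]) (use kh in auto)
    then show ?thesis by (simp add: 0 cyc_0)
  next
    case (Suc j)
    have "mv (B' (Suc j)) (?\<phi> j) y a = mv (B (Suc j)) (\<phi> j) (\<lambda>b. y (?k (Suc j) b)) (h j a)" for a
      by (rule mv_reindex[OF h]) (use kh in auto)
    then show ?thesis
      unfolding Suc cyc_Suc using hB[of _ j] kB[of _ j] by metis
  qed
  have bnd: "bnd V B' ?\<phi> i y \<longleftrightarrow> bnd V B \<phi> i (\<lambda>b. y (?k i b))" for i y
  proof
    assume "bnd V B' ?\<phi> i y"
    then obtain w where "(\<forall>b\<in>B' (Suc i). w b \<in> polys V) \<and>
        (\<forall>a\<in>B' i. y a = mv (B' (Suc i)) (?\<phi> i) w a)"
      by (rule bndD[THEN exE])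
    note w = this[THEN conjunct1, rule_format] this[THEN conjunct2, rule_format]
    have mv: "mv (B' (Suc i)) (?\<phi> i) w a = mv (B (Suc i)) (\<phi> i) (\<lambda>b. w (?k (Suc i) b)) (h i a)" for a
      by (rule mv_reindex[OF h]) (use kh in auto)
    show "bnd V B \<phi> i (\<lambda>b. y (?k i b))"
      by (rule bndI[of _ _ "\<lambda>b. w (?k (Suc i) b)"]) (use w kB in \<open>auto simp: mv\<close>)
  next
    assume "bnd V B \<phi> i (\<lambda>b. y (?k i b))"
    then obtain w where "(\<forall>b\<in>B (Suc i). w b \<in> polys V) \<and>
        (\<forall>a\<in>B i. y (?k i a) = mv (B (Suc i)) (\<phi> i) w a)"
      by (rule bndD[THEN exE])
    note w = this[THEN conjunct1, rule_format] this[THEN conjunct2, rule_format]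
    have mv: "mv (B' (Suc i)) (?\<phi> i) (\<lambda>c. w (h (Suc i) c)) a = mv (B (Suc i)) (\<phi> i) w (h i a)" for a
      by (rule mv_reindex[OF h]) auto
    show "bnd V B' ?\<phi> i y"
      by (rule bndI[of _ _ "\<lambda>b. w (h (Suc i) b)"]) (use w(1) w(2)[OF hB] hB kh in \<open>auto simp: mv\<close>)
  qed
  have g': "\<And>i. finite (B i)"
    "\<And>b. b \<in> B 0 \<Longrightarrow> \<epsilon> b \<in> polys V \<and> homogeneous (d 0 b) (\<epsilon> b)"
    "\<And>i a b. a \<in> B i \<Longrightarrow> b \<in> B (Suc i) \<Longrightarrow> \<phi> i a b \<in> polys V \<and>
        homogeneous (d (Suc i) b - d i a) (\<phi> i a b)"
    "\<And>p. p \<in> polys V \<Longrightarrow> \<exists>v\<in>B 0 \<rightarrow> polys V. p - mv (B 0) (\<lambda>_. \<epsilon>) v () \<in> I"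
    "\<And>i y. y \<in> B i \<rightarrow> polys V \<Longrightarrow> cyc I B \<epsilon> \<phi> i y \<longleftrightarrow> bnd V B \<phi> i y"
    using g by (auto simp: gres_def)
  show ?thesis
  proof (rule gresI)
    fix i show "finite (B' i)"
      using g'(1) h bij_betw_finite by blast
  next
    fix p :: "('v, 'k) mpoly" assume "p \<in> polys V"
    then obtain v where v: "v \<in> B 0 \<rightarrow> polys V" "p - mv (B 0) (\<lambda>_. \<epsilon>) v () \<in> I"
      using g'(4) by blast
    have "mv (B' 0) (\<lambda>_. ?\<epsilon>) (\<lambda>b. v (h 0 b)) () = mv (B 0) (\<lambda>_. \<epsilon>) v ()"
      by (rule mv_reindex[OF h]) auto
    then show "\<exists>v. (\<forall>b\<in>B' 0. v b \<in> polys V) \<and> p - mv (B' 0) (\<lambda>_. ?\<epsilon>) v () \<in> I"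
      using v hB by (intro exI[of _ "\<lambda>b. v (h 0 b)"]) auto
  next
    fix i and y :: "'c \<Rightarrow> ('v, 'k) mpoly" assume y: "\<And>a. a \<in> B' i \<Longrightarrow> y a \<in> polys V"
    have "(\<lambda>b. y (?k i b)) \<in> B i \<rightarrow> polys V"
      using y kB by auto
    from g'(5)[OF this] have "cyc I B' ?\<epsilon> ?\<phi> i y \<longleftrightarrow> bnd V B' ?\<phi> i y"
      by (simp only: cyc bnd)
    then show "cyc I B' ?\<epsilon> ?\<phi> i y \<Longrightarrow> bnd V B' ?\<phi> i y" "bnd V B' ?\<phi> i y \<Longrightarrow> cyc I B' ?\<epsilon> ?\<phi> i y"
      by simp_all
  qed (use g' hB in auto)
qed

lemma mv_Plus:
  assumes "finite P" "finite Q"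
  shows "mv (P <+> Q) A v a = mv P (\<lambda>a c. A a (Inl c)) (\<lambda>c. v (Inl c)) a + mv Q (\<lambda>a c. A a (Inr c)) (\<lambda>c. v (Inr c)) a"
  using assms by (simp add: mv_def sum.Plus)

lemma ball_Plus: "(\<forall>x\<in>A <+> B. P x) \<longleftrightarrow> (\<forall>a\<in>A. P (Inl a)) \<and> (\<forall>b\<in>B. P (Inr b))"
  by auto

text \<open>The ideals \<open>I : f\<close> and \<open>I + (f)\<close>.\<close>

definition colon :: "'v set \<Rightarrow> ('v, 'k::field) mpoly set \<Rightarrow> ('v, 'k) mpoly \<Rightarrow> ('v, 'k) mpoly set" where
  "colon V I f = {p \<in> polys V. f * p \<in> I}"

definition adjoin :: "'v set \<Rightarrow> ('v, 'k::field) mpoly set \<Rightarrow> ('v, 'k) mpoly \<Rightarrow> ('v, 'k) mpoly set" where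
  "adjoin V I f = {p \<in> polys V. \<exists>q\<in>polys V. p - f * q \<in> I}"

lemma hom_ideal_colon:
  fixes I :: "('v, 'k::field) mpoly set"
  assumes I: "hom_ideal V I" and f: "f \<in> polys V" "homogeneous e f"
  shows "hom_ideal V (colon V I f)"
  unfolding hom_ideal_def
proof (intro conjI ballI allI)
  fix p q :: "('v, 'k) mpoly" assume "p \<in> polys V" "q \<in> colon V I f"
  then show "p * q \<in> colon V I f"
    using ideal_mult[OF I, of p "f * q"] by (auto simp: colon_def mult_ac)
next
  fix e' and p :: "('v, 'k) mpoly" assume p: "p \<in> colon V I f"
  then have "hom_comp (e' + e) (f * p) \<in> I"
    using ideal_hom_comp[OF I] by (auto simp: colon_def)
  then have "f * hom_comp e' p \<in> I"
    using hom_comp_mult[OF f(2), of "e' + e" p] by simp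
  then show "hom_comp e' p \<in> colon V I f"
    using p by (auto simp: colon_def)
qed (auto simp: colon_def distrib_left intro: ideal_zero[OF I] ideal_add[OF I])

lemma hom_ideal_adjoin:
  fixes I :: "('v, 'k::field) mpoly set"
  assumes I: "hom_ideal V I" and f: "f \<in> polys V" "homogeneous e f"
  shows "hom_ideal V (adjoin V I f)"
  unfolding hom_ideal_def
proof (intro conjI ballI allI)
  show "0 \<in> adjoin V I f"
    using ideal_zero[OF I] by (auto simp: adjoin_def intro!: bexI[of _ 0])
next
  fix p q :: "('v, 'k) mpoly" assume "p \<in> adjoin V I f" "q \<in> adjoin V I f"
  then obtain p' q' where pq: "p + q \<in> polys V" "p' + q' \<in> polys V"
      and "p - f * p' \<in> I" "q - f * q' \<in> I"
    by (auto simp: adjoin_def)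
  moreover have "p + q - f * (p' + q') = (p - f * p') + (q - f * q')"
    by (simp add: algebra_simps)
  ultimately have "p + q - f * (p' + q') \<in> I"
    using ideal_add[OF I] by metis
  then show "p + q \<in> adjoin V I f"
    using pq unfolding adjoin_def by blast
next
  fix p q :: "('v, 'k) mpoly" assume "p \<in> polys V" "q \<in> adjoin V I f"
  then obtain q' where pq: "p * q \<in> polys V" "p * q' \<in> polys V"
      and "p \<in> polys V" "q - f * q' \<in> I"
    by (auto simp: adjoin_def)
  moreover have "p * q - f * (p * q') = p * (q - f * q')"
    by (simp add: algebra_simps)
  ultimately have "p * q - f * (p * q') \<in> I"
    using ideal_mult[OF I] by metis
  then show "p * q \<in> adjoin V I f"
    using pq unfolding adjoin_def by blast
next
  fix e' and p :: "('v, 'k) mpoly" assume "p \<in> adjoin V I f"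
  then obtain q where q: "p \<in> polys V" "q \<in> polys V" "p - f * q \<in> I"
    by (auto simp: adjoin_def)
  then have "hom_comp e' p - f * hom_comp (e' - e) q \<in> I"
    using ideal_hom_comp[OF I q(3), of e'] hom_comp_mult[OF f(2)] by (simp add: hom_comp_diff)
  then show "hom_comp e' p \<in> adjoin V I f"
    using q by (auto simp: adjoin_def intro!: bexI[of _ "hom_comp (e' - e) q"])
qed (auto simp: adjoin_def)

text \<open>Resolutions \<open>P\<close> and \<open>Q\<close> of the outer terms of
  \<open>0 \<rightarrow> S/(I : f)(-e) \<rightarrow> S/I \<rightarrow> S/(I + (f)) \<rightarrow> 0\<close> combine to a resolution of the middle term by the
  direct sums of their modules.\<close>

lemma horseshoe:
  fixes I :: "('v, 'k::field) mpoly set" and BP :: "nat \<Rightarrow> 'b set" and BQ :: "nat \<Rightarrow> 'c set"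
  assumes I: "hom_ideal V I" and f: "f \<in> polys V" "homogeneous e f"
    and P: "gres V (colon V I f) BP dP \<epsilon>P \<phi>P"
    and Q: "gres V (adjoin V I f) BQ dQ \<epsilon>Q \<phi>Q"
  shows "\<exists>\<epsilon> \<phi>. gres V I (\<lambda>i. BP i <+> BQ i) (\<lambda>i. case_sum (\<lambda>a. dP i a + e) (dQ i)) \<epsilon> \<phi>"
proof -
  interpret P: resolution V "colon V I f" BP dP \<epsilon>P \<phi>P
    by unfold_locales (fact hom_ideal_colon[OF I f], fact P)
  interpret Q: resolution V "adjoin V I f" BQ dQ \<epsilon>Q \<phi>Q
    by unfold_locales (fact hom_ideal_adjoin[OF I f], fact Q)
  \<comment> \<open>The augmentation of \<open>Q\<close> composed with its first differential lies in \<open>I + (f)\<close>; the multiple of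
    \<open>f\<close> gives a map \<open>s\<close> whose negative lifts to the off-diagonal blocks \<open>\<tau>\<close> of the differentials.\<close>
  let ?aug = "\<lambda>c. mv (BQ 0) (\<lambda>_. \<epsilon>Q) (\<lambda>b. \<phi>Q 0 b c) ()"
  have "\<exists>s. \<forall>c\<in>BQ 1. s c \<in> polys V \<and> homogeneous (dQ 1 c - e) (s c) \<and> ?aug c - f * s c \<in> I"
  proof (rule bchoice, rule ballI)
    fix c assume c: "c \<in> BQ 1"
    obtain q where q: "q \<in> polys V" "?aug c - f * q \<in> I"
      using Q.eps_phi[OF c] by (auto simp: adjoin_def)
    have "homogeneous (dQ 1 c) (?aug c)"
      by (rule mv_homogeneous[of _ "dQ 0"]) (use Q.eps_hom Q.phi_hom[of _ 0 c] c in auto)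
    then have "?aug c - f * hom_comp (dQ 1 c - e) q \<in> I"
      using ideal_hom_comp[OF I q(2), of "dQ 1 c"] hom_comp_mult[OF f(2)]
      by (simp add: hom_comp_diff hom_comp_id)
    then show "\<exists>s. s \<in> polys V \<and> homogeneous (dQ 1 c - e) s \<and> ?aug c - f * s \<in> I"
      using q(1) by blast
  qed
  then obtain s where s: "\<And>c. c \<in> BQ 1 \<Longrightarrow> s c \<in> polys V"
    "\<And>c. c \<in> BQ 1 \<Longrightarrow> homogeneous (dQ 1 c - e) (s c)" "\<And>c. c \<in> BQ 1 \<Longrightarrow> ?aug c - f * s c \<in> I"
    by blast
  obtain \<tau> where
    \<tau>: "\<And>j a c. a \<in> BP j \<Longrightarrow> c \<in> BQ (Suc j) \<Longrightarrow> \<tau> j a c \<in> polys V"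
    "\<And>j a c. a \<in> BP j \<Longrightarrow> c \<in> BQ (Suc j) \<Longrightarrow> homogeneous (dQ (Suc j) c - e - dP j a) (\<tau> j a c)"
    "\<And>c. c \<in> BQ (Suc 0) \<Longrightarrow> - s c - mv (BP 0) (\<lambda>_. \<epsilon>P) (\<lambda>a. \<tau> 0 a c) () \<in> colon V I f"
    "\<And>j a c. a \<in> BP j \<Longrightarrow> c \<in> BQ (Suc (Suc j)) \<Longrightarrow> mv (BP (Suc j)) (\<phi>P j) (\<lambda>b. \<tau> (Suc j) b c) a =
       mv (BQ (Suc j)) (\<tau> j) (\<lambda>b. - \<phi>Q (Suc j) b c) a"
  proof (rule P.lifting[of "\<lambda>j. BQ (Suc j)" "\<lambda>j b c. - \<phi>Q (Suc j) b c" "\<lambda>j c. dQ (Suc j) c - e" "\<lambda>c. - s c"])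
    show "mv (BQ (Suc (Suc j))) (\<lambda>b c. - \<phi>Q (Suc j) b c) (\<lambda>b. - \<phi>Q (Suc (Suc j)) b c) a = 0"
      if "a \<in> BQ (Suc j)" "c \<in> BQ (Suc (Suc (Suc j)))" for j a c
      using Q.phi_phi[OF that] by (simp add: mv_uminus mv_uminus_left)
    show "mv (BQ (Suc 0)) (\<lambda>_ c. - s c) (\<lambda>b. - \<phi>Q (Suc 0) b c) () \<in> colon V I f"
      if c: "c \<in> BQ (Suc (Suc 0))" for c
    proof -
      let ?y = "\<lambda>b. \<phi>Q (Suc 0) b c"
      have "mv (BQ 1) (\<lambda>_ c. ?aug c - f * s c) ?y () \<in> I"
        unfolding mv_def[of "BQ 1"]
        by (rule ideal_sum[OF I], rule ideal_mult_right[OF I]) (use s(3) Q.phi_polys[OF _ c] in auto)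
      moreover have "mv (BQ 1) (\<lambda>_ c. ?aug c) ?y () = mv (BQ 0) (\<lambda>_. \<epsilon>Q) (mv (BQ 1) (\<phi>Q 0) ?y) ()"
        by (simp add: mv_mv)
      moreover have "\<dots> = mv (BQ 0) (\<lambda>_. \<epsilon>Q) (\<lambda>_. 0) ()"
        by (rule mv_cong) (use Q.phi_phi[OF _ c] in auto)
      ultimately have "f * mv (BQ 1) (\<lambda>_. s) ?y () \<in> I"
        using ideal_uminus_iff[OF I] by (simp add: mv_diff_left mv_scale_left)
      moreover have "mv (BQ 1) (\<lambda>_. s) ?y () \<in> polys V"
        using s(1) Q.phi_polys[OF _ c] by auto
      ultimately show ?thesis
        by (simp add: colon_def mv_uminus mv_uminus_left)
    qed
  qed (use s(1,2) Q.phi_polys Q.phi_hom in \<open>auto intro: homogeneous_uminus\<close>)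
  let ?B = "\<lambda>i. BP i <+> BQ i" and ?d = "\<lambda>i. case_sum (\<lambda>a. dP i a + e) (dQ i)"
  define \<epsilon> where "\<epsilon> = case_sum (\<lambda>a. f * \<epsilon>P a) \<epsilon>Q"
  define \<phi> where "\<phi> = (\<lambda>i x y. case x of
      Inl a \<Rightarrow> (case y of Inl b \<Rightarrow> \<phi>P i a b | Inr c \<Rightarrow> \<tau> i a c)
    | Inr a \<Rightarrow> (case y of Inl b \<Rightarrow> 0 | Inr c \<Rightarrow> \<phi>Q i a c))"
  have mv_eps: "mv (?B 0) (\<lambda>_. \<epsilon>) y () =
      f * mv (BP 0) (\<lambda>_. \<epsilon>P) (\<lambda>a. y (Inl a)) () + mv (BQ 0) (\<lambda>_. \<epsilon>Q) (\<lambda>a. y (Inr a)) ()" for y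
    by (simp add: mv_Plus P.fin Q.fin \<epsilon>_def mv_scale_left)
  have mv_Inl: "mv (?B (Suc i)) (\<phi> i) y (Inl a) = mv (BP (Suc i)) (\<phi>P i) (\<lambda>a. y (Inl a)) a +
      mv (BQ (Suc i)) (\<tau> i) (\<lambda>a. y (Inr a)) a" for i y a
    by (simp add: mv_Plus P.fin Q.fin \<phi>_def) (simp add: mv_def)
  have mv_Inr: "mv (?B (Suc i)) (\<phi> i) y (Inr a) = mv (BQ (Suc i)) (\<phi>Q i) (\<lambda>a. y (Inr a)) a" for i y a
    by (simp add: mv_Plus P.fin Q.fin \<phi>_def) (simp add: mv_def)
  let ?cyc = "cyc I ?B \<epsilon> \<phi>"
  have cyc_right: "Q.cyc' i (\<lambda>a. y (Inr a))"
    if "?cyc i y" and y: "\<And>x. x \<in> ?B i \<Longrightarrow> y x \<in> polys V" for i y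
  proof (cases i)
    case 0
    let ?p = "mv (BP 0) (\<lambda>_. \<epsilon>P) (\<lambda>a. y (Inl a)) ()" and ?q = "mv (BQ 0) (\<lambda>_. \<epsilon>Q) (\<lambda>a. y (Inr a)) ()"
    have p: "?p \<in> polys V" and q: "?q \<in> polys V"
      using y 0 P.eps_polys Q.eps_polys by auto
    have "f * ?p + ?q \<in> I"
      using that(1) by (simp add: 0 cyc_0 mv_eps)
    then have "?q - f * (- ?p) \<in> I"
      by (simp add: add.commute)
    then show ?thesis
      using p q unfolding 0 cyc_0 adjoin_def by blast
  next
    case (Suc k)
    then show ?thesis
      using that(1) InrI[of _ "BQ k" "BP k"] by (simp add: cyc_Suc mv_Inr[symmetric])
  qed
  have cyc_left: "?cyc i (case_sum u (\<lambda>_. 0)) \<longleftrightarrow> P.cyc' i u"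
    if u: "\<And>a. a \<in> BP i \<Longrightarrow> u a \<in> polys V" for i u
  proof (cases i)
    case 0
    have "mv (BP 0) (\<lambda>_. \<epsilon>P) u () \<in> polys V"
      using u 0 P.eps_polys by auto
    then show ?thesis
      by (simp add: 0 cyc_0 mv_eps colon_def)
  next
    case (Suc k)
    then show ?thesis
      by (simp add: cyc_Suc ball_Plus mv_Inl mv_Inr)
  qed
  have cyc_right_lift: "?cyc i (case_sum (mv (BQ (Suc i)) (\<tau> i) w) (mv (BQ (Suc i)) (\<phi>Q i) w))"
    if w: "\<And>c. c \<in> BQ (Suc i) \<Longrightarrow> w c \<in> polys V" for i w
  proof (cases i)
    case 0
    let ?t = "\<lambda>c. mv (BP 0) (\<lambda>_. \<epsilon>P) (\<lambda>a. \<tau> 0 a c) ()"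
    have "(f * ?t c + ?aug c) * w c \<in> I" if c: "c \<in> BQ 1" for c
    proof -
      have "f * (- s c - ?t c) \<in> I"
        using \<tau>(3) c by (auto simp: colon_def)
      then have "(?aug c - f * s c) - f * (- s c - ?t c) \<in> I"
        using ideal_diff[OF I s(3)[OF c]] by simp
      then have "f * ?t c + ?aug c \<in> I"
        by (simp add: algebra_simps)
      then show ?thesis
        using ideal_mult_right[OF I] w c 0 by simp
    qed
    then have "mv (BQ 1) (\<lambda>_ c. f * ?t c + ?aug c) w () \<in> I"
      unfolding mv_def[of "BQ 1"] by (rule ideal_sum[OF I])
    moreover have "mv (BQ 1) (\<lambda>_ c. f * ?t c + ?aug c) w () =
        f * mv (BP 0) (\<lambda>_. \<epsilon>P) (mv (BQ 1) (\<tau> 0) w) () + mv (BQ 0) (\<lambda>_. \<epsilon>Q) (mv (BQ 1) (\<phi>Q 0) w) ()"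
      unfolding mv_mv mv_scale_left[symmetric] by (simp add: mv_add_left)
    ultimately show ?thesis
      by (simp add: 0 cyc_0 mv_eps)
  next
    case (Suc k)
    have "mv (BP (Suc k)) (\<phi>P k) (mv (BQ (Suc (Suc k))) (\<tau> (Suc k)) w) a +
        mv (BQ (Suc k)) (\<tau> k) (mv (BQ (Suc (Suc k))) (\<phi>Q (Suc k)) w) a = 0" if a: "a \<in> BP k" for a
      unfolding mv_mv using \<tau>(4)[OF a] by (simp add: mv_def[of "BQ (Suc (Suc k))"] mv_uminus sum_negf)
    then show ?thesis
      using Q.phi_phi_mv mv_Inl mv_Inr by (auto simp: Suc cyc_Suc)
  qed
  have "gres V I ?B ?d \<epsilon> \<phi>"
  proof (rule gresI)
    fix i show "finite (?B i)"
      using P.fin Q.fin by simp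
  next
    fix p :: "('v, 'k) mpoly" assume p: "p \<in> polys V"
    obtain v where v: "\<And>b. b \<in> BQ 0 \<Longrightarrow> v b \<in> polys V"
        "p - mv (BQ 0) (\<lambda>_. \<epsilon>Q) v () \<in> adjoin V I f"
      using Q.surj[OF p] by blast
    then obtain q where q: "q \<in> polys V" "p - mv (BQ 0) (\<lambda>_. \<epsilon>Q) v () - f * q \<in> I"
      by (auto simp: adjoin_def)
    obtain u where u: "\<And>b. b \<in> BP 0 \<Longrightarrow> u b \<in> polys V"
        "q - mv (BP 0) (\<lambda>_. \<epsilon>P) u () \<in> colon V I f"
      using P.surj[OF q(1)] by blast
    have "(p - mv (BQ 0) (\<lambda>_. \<epsilon>Q) v () - f * q) + f * (q - mv (BP 0) (\<lambda>_. \<epsilon>P) u ()) \<in> I"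
      using ideal_add[OF I q(2)] u(2) by (simp add: colon_def)
    then have "p - mv (?B 0) (\<lambda>_. \<epsilon>) (case_sum u v) () \<in> I"
      by (simp add: mv_eps algebra_simps)
    then show "\<exists>v. (\<forall>b\<in>?B 0. v b \<in> polys V) \<and> p - mv (?B 0) (\<lambda>_. \<epsilon>) v () \<in> I"
      using u v by (intro exI[of _ "case_sum u v"]) auto
  next
    fix i and y :: "'b + 'c \<Rightarrow> ('v, 'k) mpoly"
    assume y: "\<And>x. x \<in> ?B i \<Longrightarrow> y x \<in> polys V" and cyc: "?cyc i y"
    have "Q.bnd' i (\<lambda>a. y (Inr a))"
      using cyc_right[OF cyc y] Q.cyc_iff_bnd[of i "\<lambda>a. y (Inr a)"] y by auto
    then obtain w where "(\<forall>b\<in>BQ (Suc i). w b \<in> polys V) \<and>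
        (\<forall>a\<in>BQ i. y (Inr a) = mv (BQ (Suc i)) (\<phi>Q i) w a)"
      by (rule bndD[THEN exE])
    note w = this[THEN conjunct1, rule_format] this[THEN conjunct2, rule_format]
    let ?t = "mv (BQ (Suc i)) (\<tau> i) w"
    let ?u = "\<lambda>a. y (Inl a) - ?t a"
    have u_polys: "?u a \<in> polys V" if "a \<in> BP i" for a
      using y that w(1) \<tau>(1) by (intro polys_diff mv_polys) auto
    have "?cyc i (\<lambda>x. y x - case_sum ?t (mv (BQ (Suc i)) (\<phi>Q i) w) x)"
      by (rule cyc_diff[OF I cyc cyc_right_lift]) (rule w(1))
    also have "?this \<longleftrightarrow> ?cyc i (case_sum ?u (\<lambda>_. 0))"
      by (rule cyc_cong) (use w(2) in auto)
    also have "\<dots> \<longleftrightarrow> P.bnd' i ?u"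
      using cyc_left[of i ?u] P.cyc_iff_bnd[of i ?u] u_polys by blast
    finally obtain w' where "(\<forall>b\<in>BP (Suc i). w' b \<in> polys V) \<and>
        (\<forall>a\<in>BP i. ?u a = mv (BP (Suc i)) (\<phi>P i) w' a)"
      by (rule bndD[THEN exE])
    note w' = this[THEN conjunct1, rule_format] this[THEN conjunct2, rule_format]
    have "y (Inl a) = mv (BP (Suc i)) (\<phi>P i) w' a + ?t a" if "a \<in> BP i" for a
      using w'(2)[OF that] by (simp add: algebra_simps)
    then show "bnd V ?B \<phi> i y"
      using w w'(1) by (intro bndI[of _ _ "case_sum w' w"]) (auto simp: mv_Inl mv_Inr)
  next
    fix i and y :: "'b + 'c \<Rightarrow> ('v, 'k) mpoly"
    assume y: "\<And>x. x \<in> ?B i \<Longrightarrow> y x \<in> polys V" and bnd: "bnd V ?B \<phi> i y"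
    then obtain w where "(\<forall>b\<in>?B (Suc i). w b \<in> polys V) \<and>
        (\<forall>a\<in>?B i. y a = mv (?B (Suc i)) (\<phi> i) w a)"
      using bndD[of V ?B \<phi> i y] by metis
    note w = this[THEN conjunct1, rule_format] this[THEN conjunct2, rule_format]
    let ?u = "mv (BP (Suc i)) (\<phi>P i) (\<lambda>a. w (Inl a))"
    have u_polys: "?u a \<in> polys V" if "a \<in> BP i" for a
      using w(1) that P.phi_polys by (intro mv_polys) auto
    have "P.bnd' i ?u"
      using w(1) by (intro bndI[of _ _ "\<lambda>a. w (Inl a)"]) auto
    then have "?cyc i (case_sum ?u (\<lambda>_. 0))"
      using cyc_left[of i ?u] P.cyc_iff_bnd[of i ?u] u_polys by blast
    moreover have "?cyc i (case_sum (mv (BQ (Suc i)) (\<tau> i) (\<lambda>a. w (Inr a)))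
        (mv (BQ (Suc i)) (\<phi>Q i) (\<lambda>a. w (Inr a))))"
      by (rule cyc_right_lift) (use w(1) in auto)
    ultimately have "?cyc i (\<lambda>x. case_sum ?u (\<lambda>_. 0) x + case_sum (mv (BQ (Suc i)) (\<tau> i) (\<lambda>a. w (Inr a)))
        (mv (BQ (Suc i)) (\<phi>Q i) (\<lambda>a. w (Inr a))) x)"
      by (rule cyc_add[OF I])
    also have "?this \<longleftrightarrow> ?cyc i y"
      by (rule cyc_cong) (use w(2) in \<open>auto simp: mv_Inl mv_Inr\<close>)
    finally show "?cyc i y" .
  next
    fix b assume b: "b \<in> ?B 0"
    then show "\<epsilon> b \<in> polys V"
      using f P.eps_polys Q.eps_polys by (auto simp: \<epsilon>_def intro!: polys_mult)
    show "homogeneous (?d 0 b) (\<epsilon> b)"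
      using b Q.eps_hom by (auto simp: \<epsilon>_def intro!: homogeneous_mult_eq[OF f(2) P.eps_hom])
  next
    fix i a b assume a: "a \<in> ?B i" and b: "b \<in> ?B (Suc i)"
    then show "\<phi> i a b \<in> polys V"
      using P.phi_polys Q.phi_polys \<tau>(1) by (auto simp: \<phi>_def)
    show "homogeneous (?d (Suc i) b - ?d i a) (\<phi> i a b)"
      using a b P.phi_hom Q.phi_hom \<tau>(2) by (auto simp: \<phi>_def algebra_simps)
  qed
  then show ?thesis by blast
qed

text \<open>For a nonzerodivisor \<open>f\<close> modulo \<open>I\<close>, the mapping cone of the multiplication by \<open>f\<close> on a
  resolution of \<open>S/I\<close> resolves \<open>S/(I + (f))\<close>.\<close>

lemma mapping_cone:
  fixes I :: "('v, 'k::field) mpoly set" and B :: "nat \<Rightarrow> 'b set"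
  assumes I: "hom_ideal V I" and f: "f \<in> polys V" "homogeneous e f"
    and reg: "colon V I f \<subseteq> I"
    and g: "gres V I B d \<epsilon> \<phi>"
  defines "BT \<equiv> \<lambda>i. B i <+> (if i = 0 then {} else B (i - 1))"
    and "dT \<equiv> \<lambda>i. case_sum (d i) (\<lambda>a. d (i - 1) a + e)"
  shows "\<exists>\<epsilon>' \<phi>'. gres V (adjoin V I f) BT dT \<epsilon>' \<phi>' \<and>
    (minimal B \<phi> \<longrightarrow> const_term f = 0 \<longrightarrow> minimal BT \<phi>')"
proof -
  interpret resolution V I B d \<epsilon> \<phi>
    using I g by unfold_locales
  define \<epsilon>T :: "'b + 'b \<Rightarrow> ('v, 'k) mpoly" where "\<epsilon>T = case_sum \<epsilon> (\<lambda>_. 0)"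
  define \<phi>T where "\<phi>T = (\<lambda>i x y. case x of
      Inl a \<Rightarrow> (case y of Inl b \<Rightarrow> \<phi> i a b | Inr c \<Rightarrow> if a = c then f else 0)
    | Inr a \<Rightarrow> (case y of Inl b \<Rightarrow> 0 | Inr c \<Rightarrow> - \<phi> (i - 1) a c))"
  have BT_0: "BT 0 = B 0 <+> {}" and BT_Suc: "BT (Suc i) = B (Suc i) <+> B i" for i
    by (simp_all add: BT_def)
  have mv_eps: "mv (BT 0) (\<lambda>_. \<epsilon>T) y () = mv (B 0) (\<lambda>_. \<epsilon>) (\<lambda>a. y (Inl a)) ()" for y
    by (simp add: BT_0 mv_Plus fin \<epsilon>T_def) (simp add: mv_def)
  have mv_Inl: "mv (BT (Suc i)) (\<phi>T i) y (Inl a) =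
      mv (B (Suc i)) (\<phi> i) (\<lambda>a. y (Inl a)) a + f * y (Inr a)" if "a \<in> B i" for i y a
  proof -
    have "mv (BT (Suc i)) (\<phi>T i) y (Inl a) = mv (B (Suc i)) (\<phi> i) (\<lambda>a. y (Inl a)) a +
        mv (B i) (\<lambda>a c. if a = c then f else 0) (\<lambda>a. y (Inr a)) a"
      by (simp add: BT_Suc mv_Plus fin \<phi>T_def) (simp add: mv_def)
    then show ?thesis
      by (simp only: mv_delta_left[OF fin that])
  qed
  have mv_Inr: "mv (BT (Suc (Suc i))) (\<phi>T (Suc i)) y (Inr a) =
      - mv (B (Suc i)) (\<phi> i) (\<lambda>a. y (Inr a)) a" for i y a
    by (simp add: BT_Suc mv_Plus fin \<phi>T_def) (simp add: mv_def sum_negf)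
  have exact_0: "cyc (adjoin V I f) BT \<epsilon>T \<phi>T 0 y \<longleftrightarrow> bnd V BT \<phi>T 0 y"
    if y: "\<And>x. x \<in> BT 0 \<Longrightarrow> y x \<in> polys V" for y
  proof
    let ?u = "\<lambda>a. y (Inl a)"
    have u: "?u a \<in> polys V" if "a \<in> B 0" for a
      using y that by (auto simp: BT_0)
    assume "cyc (adjoin V I f) BT \<epsilon>T \<phi>T 0 y"
    then obtain q where q: "q \<in> polys V" "mv (B 0) (\<lambda>_. \<epsilon>) ?u () - f * q \<in> I"
      by (auto simp: cyc_0 mv_eps adjoin_def)
    obtain v where v: "\<And>b. b \<in> B 0 \<Longrightarrow> v b \<in> polys V" "q - mv (B 0) (\<lambda>_. \<epsilon>) v () \<in> I"
      using surj[OF q(1)] by blast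
    have "(mv (B 0) (\<lambda>_. \<epsilon>) ?u () - f * q) + f * (q - mv (B 0) (\<lambda>_. \<epsilon>) v ()) \<in> I"
      by (rule ideal_add[OF I q(2)], rule ideal_mult[OF I f(1) v(2)])
    then have "mv (B 0) (\<lambda>_. \<epsilon>) (\<lambda>a. ?u a - f * v a) () \<in> I"
      unfolding mv_diff mv_scale by (simp add: algebra_simps)
    then have "bnd' 0 (\<lambda>a. ?u a - f * v a)"
      using cyc_iff_bnd[of 0 "\<lambda>a. ?u a - f * v a"] u v(1) f(1) by (auto simp: cyc_0)
    then obtain w where "(\<forall>b\<in>B (Suc 0). w b \<in> polys V) \<and>
        (\<forall>a\<in>B 0. ?u a - f * v a = mv (B (Suc 0)) (\<phi> 0) w a)"
      by (rule bndD[THEN exE])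
    note w = this[THEN conjunct1, rule_format] this[THEN conjunct2, rule_format]
    have "y (Inl a) = mv (B (Suc 0)) (\<phi> 0) w a + f * v a" if "a \<in> B 0" for a
      using w(2)[OF that] by (simp add: algebra_simps)
    moreover have "case_sum w v b \<in> polys V" if "b \<in> BT (Suc 0)" for b
      using that w(1) v(1) by (auto simp: BT_Suc)
    ultimately show "bnd V BT \<phi>T 0 y"
      by (intro bndI[of _ _ "case_sum w v"]) (auto simp: mv_Inl BT_0)
  next
    assume "bnd V BT \<phi>T 0 y"
    then obtain w where "(\<forall>b\<in>BT (Suc 0). w b \<in> polys V) \<and>
        (\<forall>a\<in>BT 0. y a = mv (BT (Suc 0)) (\<phi>T 0) w a)"
      by (rule bndD[THEN exE])
    note w = this[THEN conjunct1, rule_format] this[THEN conjunct2, rule_format]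
    let ?v = "mv (B (Suc 0)) (\<phi> 0) (\<lambda>a. w (Inl a))"
    have "bnd' 0 ?v"
      using w(1) by (intro bndI[of _ _ "\<lambda>a. w (Inl a)"]) (auto simp: BT_Suc)
    moreover have "?v a \<in> polys V" if "a \<in> B 0" for a
      using that w(1) phi_polys by (auto simp: BT_Suc intro!: mv_polys)
    ultimately have v: "mv (B 0) (\<lambda>_. \<epsilon>) ?v () \<in> I"
      using cyc_iff_bnd[of 0 ?v] by (simp add: cyc_0)
    have "y (Inl a) = ?v a + f * w (Inr a)" if "a \<in> B 0" for a
      using w(2)[of "Inl a"] that by (auto simp: BT_0 mv_Inl)
    then have "mv (B 0) (\<lambda>_. \<epsilon>) (\<lambda>a. y (Inl a)) () = mv (B 0) (\<lambda>_. \<epsilon>) (\<lambda>a. ?v a + f * w (Inr a)) ()"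
      by (intro mv_cong) auto
    then have eq: "mv (BT 0) (\<lambda>_. \<epsilon>T) y () = mv (B 0) (\<lambda>_. \<epsilon>) ?v () + f * mv (B 0) (\<lambda>_. \<epsilon>) (\<lambda>a. w (Inr a)) ()"
      unfolding mv_eps mv_add mv_scale .
    have q: "mv (B 0) (\<lambda>_. \<epsilon>) (\<lambda>a. w (Inr a)) () \<in> polys V"
      using w(1) eps_polys by (auto simp: BT_Suc intro!: mv_polys)
    show "cyc (adjoin V I f) BT \<epsilon>T \<phi>T 0 y"
      unfolding cyc_0 eq adjoin_def using q v f(1) ideal_polys[OF I v]
      by (auto intro!: bexI[OF _ q])
  qed
  have exact_Suc: "cyc (adjoin V I f) BT \<epsilon>T \<phi>T (Suc k) y \<longleftrightarrow> bnd V BT \<phi>T (Suc k) y"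
    if y: "\<And>x. x \<in> BT (Suc k) \<Longrightarrow> y x \<in> polys V" for k y
  proof
    let ?u = "\<lambda>a. y (Inl a)" and ?v = "\<lambda>a. y (Inr a)"
    have u: "?u a \<in> polys V" if "a \<in> B (Suc k)" for a
      using y that by (auto simp: BT_Suc)
    have v: "?v a \<in> polys V" if "a \<in> B k" for a
      using y that by (auto simp: BT_Suc)
    assume cyc: "cyc (adjoin V I f) BT \<epsilon>T \<phi>T (Suc k) y"
    have row: "mv (B (Suc k)) (\<phi> k) ?u a + f * ?v a = 0" if "a \<in> B k" for a
    proof -
      have "Inl a \<in> BT k"
        using that by (simp add: BT_def InlI)
      then show ?thesis
        using cyc mv_Inl[OF that, of y] by (simp add: cyc_Suc)
    qed
    have "cyc' k ?v"
    proof (cases k)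
      case 0
      have u_polys: "mv (B 1) (\<phi> 0) ?u a \<in> polys V" if "a \<in> B 0" for a
        using u 0 phi_polys that by (intro mv_polys) auto
      have "bnd' 0 (mv (B 1) (\<phi> 0) ?u)"
        by (rule bndI[of _ _ ?u]) (use u 0 in auto)
      then have "mv (B 0) (\<lambda>_. \<epsilon>) (mv (B 1) (\<phi> 0) ?u) () \<in> I"
        using cyc_iff_bnd[of 0 "mv (B 1) (\<phi> 0) ?u"] u_polys by (simp add: cyc_0)
      moreover have "mv (B 0) (\<lambda>_. \<epsilon>) (mv (B 1) (\<phi> 0) ?u) () = mv (B 0) (\<lambda>_. \<epsilon>) (\<lambda>a. - (f * ?v a)) ()"
        by (rule mv_cong) (use row 0 in \<open>auto simp: eq_neg_iff_add_eq_0\<close>)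
      ultimately have "f * mv (B 0) (\<lambda>_. \<epsilon>) ?v () \<in> I"
        using ideal_uminus_iff[OF I] by (simp add: mv_uminus mv_scale)
      moreover have "mv (B 0) (\<lambda>_. \<epsilon>) ?v () \<in> polys V"
        using v 0 eps_polys by auto
      ultimately show ?thesis
        using reg by (auto simp: 0 cyc_0 colon_def)
    next
      case (Suc j)
      have "mv (B (Suc j)) (\<phi> j) ?v a = 0" if "a \<in> B j" for a
      proof -
        have "Inr a \<in> BT k"
          using that by (simp add: Suc BT_def InrI)
        then show ?thesis
          using cyc mv_Inr[of j y a] by (simp add: cyc_Suc Suc)
      qed
      then show ?thesis
        by (simp add: Suc cyc_Suc)
    qed
    then have "bnd' k ?v"
      using cyc_iff_bnd[of k ?v] v by blast
    then obtain w where "(\<forall>b\<in>B (Suc k). w b \<in> polys V) \<and>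
        (\<forall>a\<in>B k. ?v a = mv (B (Suc k)) (\<phi> k) w a)"
      by (rule bndD[THEN exE])
    note w = this[THEN conjunct1, rule_format] this[THEN conjunct2, rule_format]
    have "cyc' (Suc k) (\<lambda>a. ?u a + f * w a)"
      using row w(2) by (simp add: cyc_Suc mv_add mv_scale)
    then have "bnd' (Suc k) (\<lambda>a. ?u a + f * w a)"
      using cyc_iff_bnd[of "Suc k" "\<lambda>a. ?u a + f * w a"] u w(1) f(1) by blast
    then obtain w' where "(\<forall>b\<in>B (Suc (Suc k)). w' b \<in> polys V) \<and>
        (\<forall>a\<in>B (Suc k). ?u a + f * w a = mv (B (Suc (Suc k))) (\<phi> (Suc k)) w' a)"
      by (rule bndD[THEN exE])
    note w' = this[THEN conjunct1, rule_format] this[THEN conjunct2, rule_format]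
    have 1: "y (Inl a) = mv (B (Suc (Suc k))) (\<phi> (Suc k)) w' a + f * (- w a)" if "a \<in> B (Suc k)" for a
      using w'(2)[OF that] by (simp add: algebra_simps)
    have 2: "y (Inr a) = - mv (B (Suc k)) (\<phi> k) (\<lambda>a. - w a) a" if "a \<in> B k" for a
      using w(2)[OF that] by (simp add: mv_uminus)
    let ?w = "case_sum w' (\<lambda>a. - w a)"
    have "?w b \<in> polys V" if "b \<in> BT (Suc (Suc k))" for b
      using that w(1) w'(1) by (auto simp: BT_Suc intro!: polys_uminus)
    moreover have "y x = mv (BT (Suc (Suc k))) (\<phi>T (Suc k)) ?w x" if "x \<in> BT (Suc k)" for x
    proof (cases x)
      case (Inl a)
      then have "a \<in> B (Suc k)" using that by (auto simp: BT_Suc)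
      then show ?thesis using 1 by (simp add: Inl mv_Inl)
    next
      case (Inr a)
      then have "a \<in> B k" using that by (auto simp: BT_Suc)
      then show ?thesis using 2 by (simp add: Inr mv_Inr)
    qed
    ultimately show "bnd V BT \<phi>T (Suc k) y"
      by (rule bndI)
  next
    assume "bnd V BT \<phi>T (Suc k) y"
    then obtain w where "(\<forall>b\<in>BT (Suc (Suc k)). w b \<in> polys V) \<and>
        (\<forall>a\<in>BT (Suc k). y a = mv (BT (Suc (Suc k))) (\<phi>T (Suc k)) w a)"
      by (rule bndD[THEN exE])
    note w = this[THEN conjunct1, rule_format] this[THEN conjunct2, rule_format]
    let ?w = "\<lambda>a. w (Inl a)" and ?w' = "\<lambda>a. w (Inr a)"
    have 1: "y (Inl a) = mv (B (Suc (Suc k))) (\<phi> (Suc k)) ?w a + f * ?w' a" if "a \<in> B (Suc k)" for a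
    proof -
      have "Inl a \<in> BT (Suc k)" using that by (simp add: BT_Suc InlI)
      then show ?thesis using w(2) that by (simp add: mv_Inl)
    qed
    have 2: "y (Inr a) = - mv (B (Suc k)) (\<phi> k) ?w' a" if "a \<in> B k" for a
    proof -
      have "Inr a \<in> BT (Suc k)" using that by (simp add: BT_Suc InrI)
      then show ?thesis using w(2) by (simp add: mv_Inr)
    qed
    have "mv (BT (Suc k)) (\<phi>T k) y (Inl a) = 0" if a: "a \<in> B k" for a
    proof -
      have "mv (B (Suc k)) (\<phi> k) (\<lambda>a. y (Inl a)) a =
          mv (B (Suc k)) (\<phi> k) (\<lambda>a. mv (B (Suc (Suc k))) (\<phi> (Suc k)) ?w a + f * ?w' a) a"
        by (rule mv_cong) (use 1 in auto)
      also have "\<dots> = f * mv (B (Suc k)) (\<phi> k) ?w' a"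
        unfolding mv_add mv_scale using phi_phi_mv[OF a] by simp
      finally show ?thesis
        unfolding mv_Inl[OF a] using 2[OF a] by simp
    qed
    moreover have "mv (BT (Suc k)) (\<phi>T k) y (Inr a) = 0" if k: "k = Suc j" and a: "a \<in> B j" for j a
    proof -
      have "mv (B (Suc j)) (\<phi> j) (\<lambda>a. y (Inr a)) a = mv (B (Suc j)) (\<phi> j) (\<lambda>a. - mv (B (Suc k)) (\<phi> k) ?w' a) a"
        by (rule mv_cong) (use 2 k in auto)
      also have "\<dots> = 0"
        unfolding mv_uminus k using phi_phi_mv[OF a] by simp
      finally show ?thesis
        unfolding k mv_Inr by simp
    qed
    ultimately show "cyc (adjoin V I f) BT \<epsilon>T \<phi>T (Suc k) y"
      unfolding cyc_Suc by (cases k) (auto simp: BT_0 BT_Suc)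
  qed
  have exact: "cyc (adjoin V I f) BT \<epsilon>T \<phi>T i y \<longleftrightarrow> bnd V BT \<phi>T i y"
    if "\<And>x. x \<in> BT i \<Longrightarrow> y x \<in> polys V" for i y
    using exact_0 exact_Suc that by (cases i) auto
  have "gres V (adjoin V I f) BT dT \<epsilon>T \<phi>T"
  proof (rule gresI)
    fix i show "finite (BT i)"
      using fin by (simp add: BT_def)
  next
    fix p :: "('v, 'k) mpoly" assume p: "p \<in> polys V"
    obtain v where v: "\<And>b. b \<in> B 0 \<Longrightarrow> v b \<in> polys V" "p - mv (B 0) (\<lambda>_. \<epsilon>) v () \<in> I"
      using surj[OF p] by blast
    have "p - mv (BT 0) (\<lambda>_. \<epsilon>T) (case_sum v (\<lambda>_. 0)) () \<in> adjoin V I f"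
      using v(2) ideal_polys[OF I v(2)] by (auto simp: mv_eps adjoin_def intro!: bexI[of _ 0])
    then show "\<exists>v. (\<forall>b\<in>BT 0. v b \<in> polys V) \<and> p - mv (BT 0) (\<lambda>_. \<epsilon>T) v () \<in> adjoin V I f"
      using v(1) by (intro exI[of _ "case_sum v (\<lambda>_. 0)"]) (auto simp: BT_0)
  next
    fix b assume b: "b \<in> BT 0"
    then show "\<epsilon>T b \<in> polys V" "homogeneous (dT 0 b) (\<epsilon>T b)"
      using eps_polys eps_hom by (auto simp: \<epsilon>T_def BT_0 dT_def)
  next
    fix i a b assume a: "a \<in> BT i" and b: "b \<in> BT (Suc i)"
    show "\<phi>T i a b \<in> polys V"
      using a b phi_polys f(1) by (cases i) (auto simp: \<phi>T_def BT_0 BT_Suc intro!: polys_uminus)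
    show "homogeneous (dT (Suc i) b - dT i a) (\<phi>T i a b)"
      using a b phi_hom f(2) by (cases i) (auto simp: \<phi>T_def dT_def BT_0 BT_Suc intro!: homogeneous_uminus)
  qed (use exact in blast)+
  moreover have "minimal BT \<phi>T" if m: "minimal B \<phi>" and c: "const_term f = 0"
    unfolding minimal_def
  proof (intro allI ballI)
    fix i a b assume "a \<in> BT i" and "b \<in> BT (Suc i)"
    then show "const_term (\<phi>T i a b) = 0"
      using m c by (cases i) (auto simp: \<phi>T_def BT_0 BT_Suc minimal_def)
  qed
  ultimately show ?thesis by blast
qed

section \<open>Squarefree monomial ideals\<close>

text \<open>The ideal generated by the squarefree monomials of the sets in \<open>H\<close>, given by its members: a
  polynomial belongs to it iff each of its monomials is divisible by a generator. Variables appear as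
  singletons in \<open>H\<close>.\<close>

definition mono_ideal :: "'v set \<Rightarrow> 'v set set \<Rightarrow> ('v, 'k::field) mpoly set" where
  "mono_ideal V H = {p \<in> polys V. \<forall>m\<in>Poly_Mapping.keys p. \<exists>e\<in>H. e \<subseteq> Poly_Mapping.keys m}"

text \<open>The squarefree monomial of a finite set of variables, as an exponent vector and as a polynomial.\<close>

definition sqfree_exp :: "'v set \<Rightarrow> 'v \<Rightarrow>\<^sub>0 nat" where
  "sqfree_exp e = (\<Sum>x\<in>e. Poly_Mapping.single x 1)"

definition sqfree_mon :: "'v set \<Rightarrow> ('v, 'k::field) mpoly" where
  "sqfree_mon e = Poly_Mapping.single (sqfree_exp e) 1"

lemma lookup_sqfree_exp: "finite e \<Longrightarrow> Poly_Mapping.lookup (sqfree_exp e) x = (if x \<in> e then 1 else 0)"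
  by (simp add: sqfree_exp_def lookup_sum lookup_single when_def)

lemma keys_sqfree_exp: "finite e \<Longrightarrow> Poly_Mapping.keys (sqfree_exp e) = e"
  by (auto simp: in_keys_iff lookup_sqfree_exp split: if_splits)

lemma mon_degree_sqfree_exp: "finite e \<Longrightarrow> mon_degree (sqfree_exp e) = card e"
  by (simp add: mon_degree_def keys_sqfree_exp lookup_sqfree_exp)

lemma polys_sqfree_mon: "finite e \<Longrightarrow> e \<subseteq> V \<Longrightarrow> sqfree_mon e \<in> polys V"
  by (simp add: sqfree_mon_def polys_def keys_sqfree_exp)

lemma homogeneous_sqfree_mon: "finite e \<Longrightarrow> homogeneous (int (card e)) (sqfree_mon e)"
  by (simp add: sqfree_mon_def homogeneous_def mon_degree_sqfree_exp)

lemma const_term_sqfree_mon: "finite e \<Longrightarrow> e \<noteq> {} \<Longrightarrow> const_term (sqfree_mon e) = 0"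
  using keys_sqfree_exp[of e] by (auto simp: sqfree_mon_def const_term_def lookup_single when_def)

lemma keys_add_sqfree_exp:
  "finite e \<Longrightarrow> Poly_Mapping.keys (sqfree_exp e + m) = e \<union> Poly_Mapping.keys m"
  by (simp add: keys_add_nat keys_sqfree_exp)

lemma sqfree_exp_dvd:
  assumes "finite e" "e \<subseteq> Poly_Mapping.keys m"
  shows "sqfree_exp e + (m - sqfree_exp e) = m"
  using assms by (intro poly_mapping_eqI)
    (auto simp: lookup_add lookup_minus lookup_sqfree_exp in_keys_iff subset_iff)

lemma poly_sum_monomials:
  "(\<Sum>m\<in>Poly_Mapping.keys p. Poly_Mapping.single m (Poly_Mapping.lookup p m)) = p"
proof (rule poly_mapping_eqI)
  fix m
  show "Poly_Mapping.lookup (\<Sum>m\<in>Poly_Mapping.keys p. Poly_Mapping.single m (Poly_Mapping.lookup p m)) m =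
      Poly_Mapping.lookup p m"
    by (simp add: lookup_sum lookup_single when_def in_keys_iff)
qed

lemma keys_single_mult:
  fixes p :: "('v, 'k::field) mpoly"
  shows "Poly_Mapping.keys (Poly_Mapping.single m0 1 * p) = (\<lambda>m. m0 + m) ` Poly_Mapping.keys p"
proof
  show "Poly_Mapping.keys (Poly_Mapping.single m0 1 * p) \<subseteq> (\<lambda>m. m0 + m) ` Poly_Mapping.keys p"
    using keys_mult[of "Poly_Mapping.single m0 1" p] by auto
  show "(\<lambda>m. m0 + m) ` Poly_Mapping.keys p \<subseteq> Poly_Mapping.keys (Poly_Mapping.single m0 1 * p)"
  proof (rule image_subsetI)
    fix m assume m: "m \<in> Poly_Mapping.keys p"
    have "pfilter (\<lambda>m'. m' = m0 + m) (Poly_Mapping.single m0 1 * p) =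
        Poly_Mapping.single m0 1 * pfilter (\<lambda>m'. m' = m) p"
      by (rule pfilter_mult) auto
    also have "pfilter (\<lambda>m'. m' = m) p = Poly_Mapping.single m (Poly_Mapping.lookup p m)"
      by (rule poly_mapping_eqI) (auto simp: lookup_pfilter lookup_single when_def)
    also have "Poly_Mapping.single m0 1 * \<dots> = Poly_Mapping.single (m0 + m) (Poly_Mapping.lookup p m)"
      by (simp add: mult_single)
    finally have "m0 + m \<in> Poly_Mapping.keys (pfilter (\<lambda>m'. m' = m0 + m) (Poly_Mapping.single m0 1 * p))"
      using m by (simp add: in_keys_iff)
    then show "m0 + m \<in> Poly_Mapping.keys (Poly_Mapping.single m0 1 * p)"
      by (simp add: keys_pfilter)
  qed
qed

lemma mono_ideal_iff:
  "p \<in> mono_ideal V H \<longleftrightarrow>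
     p \<in> polys V \<and> (\<forall>m\<in>Poly_Mapping.keys p. \<exists>e\<in>H. e \<subseteq> Poly_Mapping.keys m)"
  by (simp add: mono_ideal_def)

lemma hom_ideal_mono_ideal: "hom_ideal V (mono_ideal V H :: ('v, 'k::field) mpoly set)"
  unfolding hom_ideal_def
proof (intro conjI ballI allI)
  fix p q :: "('v, 'k) mpoly" assume "p \<in> mono_ideal V H" "q \<in> mono_ideal V H"
  then show "p + q \<in> mono_ideal V H"
    using keys_add[of p q] unfolding mono_ideal_iff by blast
next
  fix p q :: "('v, 'k) mpoly" assume p: "p \<in> polys V" and q: "q \<in> mono_ideal V H"
  have "\<exists>e\<in>H. e \<subseteq> Poly_Mapping.keys m" if m: "m \<in> Poly_Mapping.keys (p * q)" for m
  proof -
    obtain a b where "m = a + b" "b \<in> Poly_Mapping.keys q"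
      using m keys_mult[of p q] by blast
    moreover from this obtain e where "e \<in> H" "e \<subseteq> Poly_Mapping.keys b"
      using q unfolding mono_ideal_iff by blast
    ultimately show ?thesis
      by (auto simp: keys_add_nat)
  qed
  then show "p * q \<in> mono_ideal V H"
    using p q by (auto simp: mono_ideal_iff)
next
  fix e and p :: "('v, 'k) mpoly" assume "p \<in> mono_ideal V H"
  then show "hom_comp e p \<in> mono_ideal V H"
    by (simp add: mono_ideal_iff polys_def hom_comp_def keys_pfilter)
qed (simp_all add: mono_ideal_def subset_iff)

lemma mono_ideal_mono:
  assumes "\<And>e. e \<in> H \<Longrightarrow> \<exists>e'\<in>H'. e' \<subseteq> e"
  shows "mono_ideal V H \<subseteq> mono_ideal V H'"
  unfolding mono_ideal_iff subset_iff[of "mono_ideal V H"] using assms by (meson order_trans)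

lemma mono_ideal_eqI:
  "(\<And>e. e \<in> H \<Longrightarrow> \<exists>e'\<in>H'. e' \<subseteq> e) \<Longrightarrow> (\<And>e. e \<in> H' \<Longrightarrow> \<exists>e'\<in>H. e' \<subseteq> e) \<Longrightarrow>
     mono_ideal V H = mono_ideal V H'"
  by (intro equalityI mono_ideal_mono)

lemma colon_mono_ideal:
  assumes "finite e" "e \<subseteq> V"
  shows "colon V (mono_ideal V H) (sqfree_mon e :: ('v, 'k::field) mpoly) = mono_ideal V ((\<lambda>h. h - e) ` H)"
proof -
  have "sqfree_mon e * p \<in> polys V" if "p \<in> polys V" for p :: "('v, 'k) mpoly"
    using polys_sqfree_mon[OF assms] that by auto
  moreover have "h \<subseteq> e \<union> K \<longleftrightarrow> h - e \<subseteq> K" for h K by auto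
  ultimately show ?thesis
    unfolding colon_def mono_ideal_def sqfree_mon_def
    by (auto simp: keys_single_mult keys_add_sqfree_exp[OF assms(1)])
qed

lemma adjoin_mono_ideal:
  assumes e: "finite e" "e \<subseteq> V"
  shows "adjoin V (mono_ideal V H) (sqfree_mon e :: ('v, 'k::field) mpoly) = mono_ideal V (insert e H)"
proof
  show "adjoin V (mono_ideal V H) (sqfree_mon e :: ('v, 'k) mpoly) \<subseteq> mono_ideal V (insert e H)"
  proof
    fix p :: "('v, 'k) mpoly" assume "p \<in> adjoin V (mono_ideal V H) (sqfree_mon e)"
    then obtain q where q: "p \<in> polys V" "q \<in> polys V" "p - sqfree_mon e * q \<in> mono_ideal V H"
      by (auto simp: adjoin_def)
    have "sqfree_mon e * q \<in> mono_ideal V (insert e H)"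
      using q(2) polys_sqfree_mon[OF e]
      by (auto simp: mono_ideal_def sqfree_mon_def keys_single_mult keys_add_sqfree_exp[OF e(1)])
    moreover have "p - sqfree_mon e * q \<in> mono_ideal V (insert e H)"
      using q(3) mono_ideal_mono[of H "insert e H" V] by blast
    ultimately have "(p - sqfree_mon e * q) + sqfree_mon e * q \<in> mono_ideal V (insert e H)"
      by (intro ideal_add[OF hom_ideal_mono_ideal])
    then show "p \<in> mono_ideal V (insert e H)" by simp
  qed
  show "mono_ideal V (insert e H) \<subseteq> adjoin V (mono_ideal V H) (sqfree_mon e :: ('v, 'k) mpoly)"
  proof
    fix p :: "('v, 'k) mpoly" assume p: "p \<in> mono_ideal V (insert e H)"
    let ?P = "\<lambda>m. e \<subseteq> Poly_Mapping.keys m"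
    let ?p = "pfilter ?P p"
    define q where "q = (\<Sum>m\<in>Poly_Mapping.keys ?p. Poly_Mapping.single (m - sqfree_exp e) (Poly_Mapping.lookup ?p m))"
    have "sqfree_mon e * q = (\<Sum>m\<in>Poly_Mapping.keys ?p. Poly_Mapping.single m (Poly_Mapping.lookup ?p m))"
      unfolding q_def sum_distrib_left sqfree_mon_def mult_single
      by (rule sum.cong) (auto simp: keys_pfilter sqfree_exp_dvd[OF e(1)])
    then have eq: "sqfree_mon e * q = ?p"
      using poly_sum_monomials[of ?p] by simp
    have "Poly_Mapping.keys (m - sqfree_exp e) \<subseteq> Poly_Mapping.keys m" for m
      by (auto simp: in_keys_iff lookup_minus)
    then have "q \<in> polys V"
      unfolding q_def using p
      by (intro polys_sum) (force simp: polys_def mono_ideal_def keys_pfilter)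
    moreover have "p - ?p = pfilter (\<lambda>m. \<not> ?P m) p"
      by (rule poly_mapping_eqI) (simp add: lookup_pfilter lookup_minus)
    then have "p - sqfree_mon e * q \<in> mono_ideal V H"
      using p eq by (auto simp: mono_ideal_def keys_pfilter polys_def)
    moreover have "p \<in> polys V"
      using p by (simp add: mono_ideal_def)
    ultimately show "p \<in> adjoin V (mono_ideal V H) (sqfree_mon e)"
      unfolding adjoin_def by blast
  qed
qed

lemma edge_ideal_eq_mono_ideal:
  assumes E: "\<And>e. e \<in> E \<Longrightarrow> e \<subseteq> V \<and> card e = 2"
  shows "(edge_ideal V E :: ('v, 'k::field) mpoly set) = mono_ideal V E"
proof
  let ?A = "{Var u * Var v | u v. {u, v} \<in> E} :: ('v, 'k) mpoly set"
  have A: "a \<in> ?A \<longleftrightarrow> (\<exists>e\<in>E. a = sqfree_mon e)" for a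
  proof -
    have "Var u * Var v = (sqfree_mon {u, v} :: ('v, 'k) mpoly)" if "{u, v} \<in> E" for u v
    proof -
      have "u \<noteq> v" using E[OF that] by auto
      then show ?thesis
        by (simp add: Var_def sqfree_mon_def sqfree_exp_def mult_single)
    qed
    moreover have "\<exists>u v. e = {u, v}" if "e \<in> E" for e
      using E[OF that] by (auto simp: card_2_iff)
    ultimately show ?thesis by (smt (verit, best) mem_Collect_eq)
  qed
  have fin: "finite e" if "e \<in> E" for e
    using E[OF that] by (auto intro: card_ge_0_finite)
  show "edge_ideal V E \<subseteq> (mono_ideal V E :: ('v, 'k) mpoly set)"
  proof
    fix p :: "('v, 'k) mpoly" assume "p \<in> edge_ideal V E"
    then obtain A' c where p: "p = (\<Sum>a\<in>A'. c a * a)" and A': "A' \<subseteq> ?A" and c: "c ` A' \<subseteq> polys V"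
      by (auto simp: edge_ideal_def generated_ideal_def)
    show "p \<in> mono_ideal V E"
      unfolding p
    proof (rule ideal_sum[OF hom_ideal_mono_ideal])
      fix a assume a: "a \<in> A'"
      then obtain e where e: "e \<in> E" "a = sqfree_mon e" using A' A by blast
      have "a \<in> mono_ideal V E"
        using e E[OF e(1)] polys_sqfree_mon[OF fin[OF e(1)], of V] fin[OF e(1)]
        by (auto simp: mono_ideal_def sqfree_mon_def keys_sqfree_exp)
      then show "c a * a \<in> mono_ideal V E"
        using c a by (intro ideal_mult[OF hom_ideal_mono_ideal]) auto
    qed
  qed
  show "(mono_ideal V E :: ('v, 'k) mpoly set) \<subseteq> edge_ideal V E"
  proof
    fix p :: "('v, 'k) mpoly" assume p: "p \<in> mono_ideal V E"
    have "\<exists>g. \<forall>m\<in>Poly_Mapping.keys p. g m \<in> E \<and> g m \<subseteq> Poly_Mapping.keys m"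
      by (rule bchoice) (use p in \<open>auto simp: mono_ideal_def\<close>)
    then obtain g where g: "\<And>m. m \<in> Poly_Mapping.keys p \<Longrightarrow> g m \<in> E"
        "\<And>m. m \<in> Poly_Mapping.keys p \<Longrightarrow> g m \<subseteq> Poly_Mapping.keys m"
      by blast
    \<comment> \<open>Each monomial \<open>m\<close> of \<open>p\<close> is assigned to one of its divisors \<open>g m\<close>; terms with the same
      generator are then collected.\<close>
    let ?a = "\<lambda>m. sqfree_mon (g m) :: ('v, 'k) mpoly"
    let ?t = "\<lambda>m. Poly_Mapping.single (m - sqfree_exp (g m)) (Poly_Mapping.lookup p m)"
    define c where "c = (\<lambda>a. \<Sum>m | m \<in> Poly_Mapping.keys p \<and> ?a m = a. ?t m)"
    have "p = (\<Sum>m\<in>Poly_Mapping.keys p. ?t m * ?a m)"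
    proof -
      have "?t m * ?a m = Poly_Mapping.single m (Poly_Mapping.lookup p m)" if "m \<in> Poly_Mapping.keys p" for m
        using sqfree_exp_dvd[OF fin[OF g(1)[OF that]] g(2)[OF that]]
        by (simp add: sqfree_mon_def mult_single add.commute)
      then show ?thesis
        using poly_sum_monomials[of p] by simp
    qed
    also have "\<dots> = (\<Sum>a\<in>?a ` Poly_Mapping.keys p. \<Sum>m | m \<in> Poly_Mapping.keys p \<and> ?a m = a. ?t m * ?a m)"
      by (rule sum.image_gen) simp
    also have "\<dots> = (\<Sum>a\<in>?a ` Poly_Mapping.keys p. c a * a)"
      unfolding c_def sum_distrib_right by (rule sum.cong) auto
    finally have "p = (\<Sum>a\<in>?a ` Poly_Mapping.keys p. c a * a)" .
    moreover have "?a ` Poly_Mapping.keys p \<subseteq> ?A"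
      using g(1) A by blast
    moreover have "?t m \<in> polys V" if "m \<in> Poly_Mapping.keys p" for m
    proof -
      have "Poly_Mapping.keys (m - sqfree_exp (g m)) \<subseteq> Poly_Mapping.keys m"
        by (auto simp: in_keys_iff lookup_minus)
      then show ?thesis
        using p that by (force simp: polys_def mono_ideal_def)
    qed
    then have "c ` ?a ` Poly_Mapping.keys p \<subseteq> polys V"
      unfolding c_def by (auto intro!: polys_sum)
    ultimately show "p \<in> edge_ideal V E"
      unfolding edge_ideal_def generated_ideal_def
      by (intro CollectI exI[of _ "?a ` Poly_Mapping.keys p"] exI[of _ c]) auto
  qed
qed

section \<open>Resolutions with bounded shifts\<close>

text \<open>There is a finite graded free resolution of \<open>S/I\<close> in which the degrees of the generators of the
  \<open>i\<close>-th module are at most \<open>i + s\<close>; in particular, the regularity of \<open>S/I\<close> is at most \<open>s\<close>.\<close>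

definition bounded_res :: "'v set \<Rightarrow> ('v, 'k::field) mpoly set \<Rightarrow> int \<Rightarrow> bool" where
  "bounded_res V I s \<longleftrightarrow> (\<exists>(B :: nat \<Rightarrow> nat set) d \<epsilon> \<phi> N. gres V I B d \<epsilon> \<phi> \<and>
     (\<forall>i\<ge>N. B i = {}) \<and> (\<forall>i. \<forall>b\<in>B i. d i b \<le> int i + s))"

lemma gres_to_nat:
  fixes I :: "('v, 'k::field) mpoly set" and B :: "nat \<Rightarrow> 'b set"
  assumes "gres V I B d \<epsilon> \<phi>"
  shows "\<exists>h :: nat \<Rightarrow> nat \<Rightarrow> 'b. (\<forall>i. bij_betw (h i) {0..<card (B i)} (B i)) \<and>
     gres V I (\<lambda>i. {0..<card (B i)}) (\<lambda>i b. d i (h i b)) (\<lambda>b. \<epsilon> (h 0 b))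
       (\<lambda>i a b. \<phi> i (h i a) (h (Suc i) b))"
proof -
  have "finite (B i)" for i
    using assms by (simp add: gres_def)
  then have "\<exists>h. bij_betw h {0..<card (B i)} (B i)" for i
    by (rule ex_bij_betw_nat_finite)
  then obtain h where "\<And>i. bij_betw (h i) {0..<card (B i)} (B i)"
    by metis
  note h = this
  show ?thesis
    by (rule exI[of _ h], rule conjI, rule allI, rule h, rule gres_reindex[OF assms h])
qed

lemma bounded_resI:
  fixes I :: "('v, 'k::field) mpoly set" and B :: "nat \<Rightarrow> 'b set"
  assumes g: "gres V I B d \<epsilon> \<phi>" and N: "\<And>i. i \<ge> N \<Longrightarrow> B i = {}"
    and s: "\<And>i b. b \<in> B i \<Longrightarrow> d i b \<le> int i + s"
  shows "bounded_res V I s"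
proof -
  obtain h where "(\<forall>i. bij_betw (h i) {0..<card (B i)} (B i)) \<and>
    gres V I (\<lambda>i. {0..<card (B i)}) (\<lambda>i b. d i (h i b)) (\<lambda>b. \<epsilon> (h 0 b))
       (\<lambda>i a b. \<phi> i (h i a) (h (Suc i) b))"
    by (rule exE[OF gres_to_nat[OF g]])
  note h = this[THEN conjunct1, rule_format] this[THEN conjunct2]
  have 1: "{0..<card (B i)} = {}" if "i \<ge> N" for i
    using N[OF that] by simp
  have 2: "d i (h i b) \<le> int i + s" if "b \<in> {0..<card (B i)}" for i b
    using s[of "h i b" i] bij_betwE[OF h(1)[of i]] that by blast
  show ?thesis
    unfolding bounded_res_def
    by (rule exI, rule exI, rule exI, rule exI, rule exI[of _ N], rule conjI[OF h(2)])
      (use 1 2 in blast)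
qed

lemma bounded_res_mono:
  fixes I :: "('v, 'k::field) mpoly set"
  assumes "bounded_res V I s" "s \<le> s'"
  shows "bounded_res V I s'"
proof -
  obtain B :: "nat \<Rightarrow> nat set" and d \<epsilon> \<phi> N where P: "gres V I B d \<epsilon> \<phi>"
    "\<And>i. i \<ge> N \<Longrightarrow> B i = {}" "\<And>i b. b \<in> B i \<Longrightarrow> d i b \<le> int i + s"
    using assms(1) unfolding bounded_res_def by blast
  show ?thesis
    by (rule bounded_resI[OF P(1), of N]) (use P(2,3) assms(2) in force)+
qed

lemma bounded_res_horseshoe:
  fixes I :: "('v, 'k::field) mpoly set"
  assumes I: "hom_ideal V I" and f: "f \<in> polys V" "homogeneous e f"
    and P: "bounded_res V (colon V I f) (s - e)" and Q: "bounded_res V (adjoin V I f) s"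
  shows "bounded_res V I s"
proof -
  obtain BP :: "nat \<Rightarrow> nat set" and dP \<epsilon>P \<phi>P NP where P: "gres V (colon V I f) BP dP \<epsilon>P \<phi>P"
    "\<And>i. i \<ge> NP \<Longrightarrow> BP i = {}" "\<And>i b. b \<in> BP i \<Longrightarrow> dP i b \<le> int i + (s - e)"
    using P unfolding bounded_res_def by blast
  obtain BQ :: "nat \<Rightarrow> nat set" and dQ \<epsilon>Q \<phi>Q NQ where Q: "gres V (adjoin V I f) BQ dQ \<epsilon>Q \<phi>Q"
    "\<And>i. i \<ge> NQ \<Longrightarrow> BQ i = {}" "\<And>i b. b \<in> BQ i \<Longrightarrow> dQ i b \<le> int i + s"
    using Q unfolding bounded_res_def by blast
  obtain \<epsilon> \<phi> where "gres V I (\<lambda>i. BP i <+> BQ i) (\<lambda>i. case_sum (\<lambda>a. dP i a + e) (dQ i)) \<epsilon> \<phi>"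
    using horseshoe[OF I f P(1) Q(1)] by blast
  then show ?thesis
  proof (rule bounded_resI)
    fix i assume "i \<ge> max NP NQ"
    then show "BP i <+> BQ i = {}"
      using P(2) Q(2) by simp
  next
    fix i b assume "b \<in> BP i <+> BQ i"
    then show "case_sum (\<lambda>a. dP i a + e) (dQ i) b \<le> int i + s"
      by (rule PlusE) (use P(3)[of _ i] Q(3)[of _ i] in fastforce)+
  qed
qed

lemma bounded_res_adjoin:
  fixes I :: "('v, 'k::field) mpoly set"
  assumes I: "hom_ideal V I" and f: "f \<in> polys V" "homogeneous 1 f" and "colon V I f \<subseteq> I"
    and "bounded_res V I s"
  shows "bounded_res V (adjoin V I f) s"
proof -
  obtain B :: "nat \<Rightarrow> nat set" and d \<epsilon> \<phi> N where P: "gres V I B d \<epsilon> \<phi>"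
    "\<And>i. i \<ge> N \<Longrightarrow> B i = {}" "\<And>i b. b \<in> B i \<Longrightarrow> d i b \<le> int i + s"
    using assms(5) unfolding bounded_res_def by blast
  obtain \<epsilon>' \<phi>' where "gres V (adjoin V I f) (\<lambda>i. B i <+> (if i = 0 then {} else B (i - 1)))
      (\<lambda>i. case_sum (d i) (\<lambda>a. d (i - 1) a + 1)) \<epsilon>' \<phi>'"
    using mapping_cone[OF I f assms(4) P(1)] by blast
  then show ?thesis
  proof (rule bounded_resI)
    fix i assume "i \<ge> Suc N"
    then show "B i <+> (if i = 0 then {} else B (i - 1)) = {}"
      using P(2)[of i] P(2)[of "i - 1"] by simp
  next
    fix i b assume "b \<in> B i <+> (if i = 0 then {} else B (i - 1))"
    then show "case_sum (d i) (\<lambda>a. d (i - 1) a + 1) b \<le> int i + s"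
      by (rule PlusE) (use P(3)[of _ i] P(3)[of _ "i - 1"] in \<open>fastforce split: if_splits\<close>)+
  qed
qed

text \<open>The module \<open>S\<close> is its own resolution.\<close>

lemma gres_zero_ideal:
  "gres V ({0} :: ('v, 'k::field) mpoly set) (\<lambda>i. if i = 0 then {0::nat} else {}) (\<lambda>_ _. 0) (\<lambda>_. 1) (\<lambda>_ _ _. 0)"
proof (rule gresI)
  fix p :: "('v, 'k) mpoly" assume "p \<in> polys V"
  then show "\<exists>v. (\<forall>b\<in>if 0 = (0::nat) then {0::nat} else {}. v b \<in> polys V) \<and>
      p - mv (if 0 = (0::nat) then {0::nat} else {}) (\<lambda>_ _. 1) v () \<in> {0}"
    by (intro exI[of _ "\<lambda>_. p"]) (simp add: mv_def)
qed (auto simp: cyc_def bnd_def mv_def split: nat.splits if_splits)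

lemma mono_ideal_empty: "mono_ideal V {} = {0 :: ('v, 'k::field) mpoly}"
  by (auto simp: mono_ideal_def)

text \<open>The Koszul complex on the variables in \<open>X\<close>.\<close>

lemma bounded_res_variables:
  assumes "finite X" "X \<subseteq> V"
  shows "bounded_res V (mono_ideal V ((\<lambda>x. {x}) ` X) :: ('v, 'k::field) mpoly set) 0"
  using assms
proof (induction X)
  case empty
  show ?case
    unfolding image_empty mono_ideal_empty
    by (rule bounded_resI[OF gres_zero_ideal, of 1]) (auto split: if_splits)
next
  case (insert x X)
  let ?f = "sqfree_mon {x} :: ('v, 'k) mpoly" and ?I = "mono_ideal V ((\<lambda>x. {x}) ` X)"
  have "bounded_res V (adjoin V ?I ?f) 0"
  proof (rule bounded_res_adjoin[OF hom_ideal_mono_ideal])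
    show "?f \<in> polys V"
      using insert.prems by (intro polys_sqfree_mon) auto
    show "homogeneous 1 ?f"
      using homogeneous_sqfree_mon[of "{x}"] by simp
    have "(\<lambda>h. h - {x}) ` (\<lambda>x. {x}) ` X = (\<lambda>x. {x}) ` X"
      using insert.hyps(2) by (force simp: image_image)
    then show "colon V ?I ?f \<subseteq> ?I"
      using insert.prems by (subst colon_mono_ideal) auto
  qed (use insert in auto)
  then show ?case
    using insert.prems by (subst (asm) adjoin_mono_ideal) auto
qed

section \<open>Graphs with dominated whiskers\<close>

text \<open>The property of multi-clique-whiskered graphs that matters: every edge meets the vertex set
  \<open>A\<close>, and every vertex \<open>x\<close> of \<open>A\<close> is adjacent to some \<open>w\<close> outside of \<open>A\<close> whose closed neighbourhood
  is contained in that of \<open>x\<close>. This is inherited by the deletion of \<open>x \<in> A\<close> and by the deletion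
  of its closed neighbourhood.\<close>

definition dominated_whiskers :: "'v set \<Rightarrow> 'v set set \<Rightarrow> bool" where
  "dominated_whiskers A \<Gamma> \<longleftrightarrow> (\<forall>e\<in>\<Gamma>. card e = 2 \<and> e \<inter> A \<noteq> {}) \<and>
     (\<forall>x\<in>A. \<exists>w. w \<notin> A \<and> {x, w} \<in> \<Gamma> \<and> (\<forall>y. {w, y} \<in> \<Gamma> \<longrightarrow> y = x \<or> {x, y} \<in> \<Gamma>))"

lemma dominated_whiskers_edge: "dominated_whiskers A \<Gamma> \<Longrightarrow> e \<in> \<Gamma> \<Longrightarrow> card e = 2 \<and> e \<inter> A \<noteq> {}"
  by (simp add: dominated_whiskers_def)

lemma dominated_whiskers_delete:
  assumes W: "dominated_whiskers A \<Gamma>" and x: "x \<in> A"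
  shows "dominated_whiskers (A - {x}) {e \<in> \<Gamma>. x \<notin> e}"
  unfolding dominated_whiskers_def
proof (intro conjI ballI)
  fix z assume z: "z \<in> A - {x}"
  then obtain w where w: "w \<notin> A" "{z, w} \<in> \<Gamma>" "\<And>y. {w, y} \<in> \<Gamma> \<Longrightarrow> y = z \<or> {z, y} \<in> \<Gamma>"
    using W unfolding dominated_whiskers_def by blast
  then show "\<exists>w. w \<notin> A - {x} \<and> {z, w} \<in> {e \<in> \<Gamma>. x \<notin> e} \<and>
      (\<forall>y. {w, y} \<in> {e \<in> \<Gamma>. x \<notin> e} \<longrightarrow> y = z \<or> {z, y} \<in> {e \<in> \<Gamma>. x \<notin> e})"
    using x z by (intro exI[of _ w]) auto
qed (use dominated_whiskers_edge[OF W] in auto)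

lemma dominated_whiskers_delete_nbhd:
  assumes W: "dominated_whiskers A \<Gamma>" and x: "x \<in> A"
  defines "N \<equiv> {y. {x, y} \<in> \<Gamma>}"
  shows "dominated_whiskers (A - insert x N) {e \<in> \<Gamma>. e \<inter> insert x N = {}}"
  unfolding dominated_whiskers_def
proof (intro conjI ballI)
  fix z assume z: "z \<in> A - insert x N"
  then obtain w where w: "w \<notin> A" "{z, w} \<in> \<Gamma>" "\<And>y. {w, y} \<in> \<Gamma> \<Longrightarrow> y = z \<or> {z, y} \<in> \<Gamma>"
    using W unfolding dominated_whiskers_def by blast
  have "w \<notin> N"
  proof
    assume "w \<in> N"
    then have "{w, x} \<in> \<Gamma>" by (simp add: N_def insert_commute)
    then have "x = z \<or> {x, z} \<in> \<Gamma>"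
      using w(3) by (simp add: insert_commute)
    then show False
      using z by (auto simp: N_def)
  qed
  moreover have "w \<noteq> x"
    using w(1) x by blast
  ultimately show "\<exists>w. w \<notin> A - insert x N \<and> {z, w} \<in> {e \<in> \<Gamma>. e \<inter> insert x N = {}} \<and>
      (\<forall>y. {w, y} \<in> {e \<in> \<Gamma>. e \<inter> insert x N = {}} \<longrightarrow>
        y = z \<or> {z, y} \<in> {e \<in> \<Gamma>. e \<inter> insert x N = {}})"
    using w z by (intro exI[of _ w]) auto
qed (use dominated_whiskers_edge[OF W] in blast)+

lemma induced_matching_delete:
  assumes "induced_matching {e \<in> \<Gamma>. x \<notin> e} M"
  shows "induced_matching \<Gamma> M"
proof -
  have M: "M \<subseteq> {e \<in> \<Gamma>. x \<notin> e}" "disjoint M" "\<And>e. e \<in> \<Gamma> \<Longrightarrow> x \<notin> e \<Longrightarrow> e \<notin> M \<Longrightarrow> \<not> e \<subseteq> \<Union>M"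
    using assms by (auto simp: induced_matching_def matching_def)
  then have "x \<notin> \<Union>M" by blast
  then show ?thesis
    using M unfolding induced_matching_def matching_def by blast
qed

text \<open>The additional edge joins \<open>x\<close> to its whisker.\<close>

lemma induced_matching_insert:
  assumes W: "dominated_whiskers A \<Gamma>" and x: "x \<in> A"
  defines "N \<equiv> {y. {x, y} \<in> \<Gamma>}"
  assumes M: "induced_matching {e \<in> \<Gamma>. e \<inter> insert x N = {}} M"
  shows "\<exists>e. e \<notin> M \<and> induced_matching \<Gamma> (insert e M)"
proof -
  obtain w where w: "w \<notin> A" "{x, w} \<in> \<Gamma>" "\<And>y. {w, y} \<in> \<Gamma> \<Longrightarrow> y = x \<or> {x, y} \<in> \<Gamma>"
    using W x unfolding dominated_whiskers_def by blast
  have M': "M \<subseteq> \<Gamma>" "disjoint M" "\<Union>M \<inter> insert x N = {}"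
    "\<And>e. e \<in> \<Gamma> \<Longrightarrow> e \<inter> insert x N = {} \<Longrightarrow> e \<notin> M \<Longrightarrow> \<not> e \<subseteq> \<Union>M"
    using M unfolding induced_matching_def matching_def by blast+
  have xw: "{x, w} \<subseteq> insert x N"
    using w(2) by (simp add: N_def)
  have "{x, w} \<notin> M"
    using M'(3) by blast
  moreover have "disjoint (insert {x, w} M)"
    using M'(2,3) xw by (auto simp: pairwise_insert disjnt_def)
  moreover have "\<not> e \<subseteq> \<Union>(insert {x, w} M)" if e: "e \<in> \<Gamma>" "e \<notin> M" "e \<noteq> {x, w}" for e
  proof
    assume sub: "e \<subseteq> \<Union>(insert {x, w} M)"
    have "e \<inter> insert x N \<noteq> {}"
      using M'(4)[OF e(1) _ e(2)] sub xw by auto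
    then obtain z where z: "z \<in> e" "z = x \<or> z = w"
      using sub M'(3) by blast
    obtain y where y: "e = {z, y}" "y \<noteq> z"
      using dominated_whiskers_edge[OF W e(1)] z(1) by (auto simp: card_2_iff)
    have "y \<in> insert x N"
      using z(2) y(1) e(1) w(3) by (auto simp: N_def)
    then have "y \<in> {x, w}"
      using y(1) sub M'(3) by blast
    then have "e = {x, w}"
      using y z(2) by auto
    then show False
      using e(3) by simp
  qed
  ultimately show ?thesis
    using M'(1) w(2) unfolding induced_matching_def matching_def by blast
qed

text \<open>The set \<open>X\<close> of variables in the ideal collects the deleted vertices \<open>x\<close> and the neighbours of \<open>x\<close>
  that arise in the two outer terms of the horseshoe lemma.\<close>

lemma bounded_res_dominated_whiskers:
  assumes "finite V" "A \<subseteq> V" "X \<subseteq> V" "X \<inter> A = {}" "\<Union>\<Gamma> \<subseteq> V" "dominated_whiskers A \<Gamma>"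
    and "\<And>M. induced_matching \<Gamma> M \<Longrightarrow> card M \<le> s"
  shows "bounded_res V (mono_ideal V (\<Gamma> \<union> (\<lambda>x. {x}) ` X) :: ('v, 'k::field) mpoly set) (int s)"
  using assms(2-)
proof (induction "card A" arbitrary: A X \<Gamma> s rule: less_induct)
  case less
  show ?case
  proof (cases "A = {}")
    case True
    then have "\<Gamma> = {}"
      using less.prems(5) dominated_whiskers_edge by fastforce
    moreover have "finite X"
      using less.prems(2) assms(1) by (rule finite_subset)
    ultimately have "bounded_res V (mono_ideal V (\<Gamma> \<union> (\<lambda>x. {x}) ` X) :: ('v, 'k) mpoly set) 0"
      using bounded_res_variables[OF _ less.prems(2)] by simp
    then show ?thesis
      by (rule bounded_res_mono) simp
  next
    case False
    then obtain x where x: "x \<in> A" by blast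
    have fin_A: "finite A"
      using less.prems(1) assms(1) by (rule finite_subset)
    have x_V: "finite {x}" "{x} \<subseteq> V"
      using x less.prems(1) by auto
    define N where "N = {y. {x, y} \<in> \<Gamma>}"
    have N: "N \<subseteq> V" "x \<notin> N"
      using less.prems(4) dominated_whiskers_edge[OF less.prems(5), of "{x, x}"] by (auto simp: N_def)
    \<comment> \<open>The sum with \<open>(x)\<close> is the ideal for the deletion of \<open>x\<close> and \<open>X \<union> {x}\<close>, and the colon by \<open>x\<close> is that
      for the deletion of the closed neighbourhood of \<open>x\<close> and \<open>X \<union> N\<close>; generators that become
      redundant are dropped.\<close>
    let ?I = "mono_ideal V (\<Gamma> \<union> (\<lambda>x. {x}) ` X) :: ('v, 'k) mpoly set"
    let ?\<Gamma> = "{e \<in> \<Gamma>. e \<inter> insert x N = {}}"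
    have edge: "\<exists>y. e = {x, y} \<and> y \<in> N" if e: "e \<in> \<Gamma>" "x \<in> e" for e
    proof -
      obtain y where "e = {x, y}"
        using dominated_whiskers_edge[OF less.prems(5) e(1)] e(2) by (auto simp: card_2_iff)
      then show ?thesis
        using e(1) by (auto simp: N_def)
    qed
    show ?thesis
    proof (rule bounded_res_horseshoe[OF hom_ideal_mono_ideal, of "sqfree_mon {x}" _ 1])
      show "sqfree_mon {x} \<in> polys V"
        using x_V by (rule polys_sqfree_mon)
      show "homogeneous 1 (sqfree_mon {x} :: ('v, 'k) mpoly)"
        using homogeneous_sqfree_mon[of "{x}"] by simp
      have "mono_ideal V (insert {x} (\<Gamma> \<union> (\<lambda>x. {x}) ` X)) =
          (mono_ideal V ({e \<in> \<Gamma>. x \<notin> e} \<union> (\<lambda>x. {x}) ` insert x X) :: ('v, 'k) mpoly set)"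
        by (rule mono_ideal_eqI) auto
      moreover have "bounded_res V (mono_ideal V ({e \<in> \<Gamma>. x \<notin> e} \<union> (\<lambda>x. {x}) ` insert x X) ::
          ('v, 'k) mpoly set) (int s)"
      proof (rule less.hyps)
        show "card (A - {x}) < card A"
          using fin_A x by (rule card_Diff1_less)
        show "card M \<le> s" if "induced_matching {e \<in> \<Gamma>. x \<notin> e} M" for M
          using less.prems(6) induced_matching_delete[OF that] .
        show "dominated_whiskers (A - {x}) {e \<in> \<Gamma>. x \<notin> e}"
          by (rule dominated_whiskers_delete[OF less.prems(5) x])
      qed (use less.prems(1-4) x in blast)+
      ultimately show "bounded_res V (adjoin V ?I (sqfree_mon {x})) (int s)"
        by (simp only: adjoin_mono_ideal[OF x_V])
      have "mono_ideal V ((\<lambda>h. h - {x}) ` (\<Gamma> \<union> (\<lambda>x. {x}) ` X)) =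
          (mono_ideal V (?\<Gamma> \<union> (\<lambda>x. {x}) ` (X \<union> N)) :: ('v, 'k) mpoly set)"
      proof (rule mono_ideal_eqI)
        fix e assume "e \<in> (\<lambda>h. h - {x}) ` (\<Gamma> \<union> (\<lambda>x. {x}) ` X)"
        then consider h where "h \<in> \<Gamma>" "e = h - {x}" | z where "z \<in> X" "e = {z} - {x}"
          by (auto simp: image_iff)
        then show "\<exists>e'\<in>?\<Gamma> \<union> (\<lambda>x. {x}) ` (X \<union> N). e' \<subseteq> e"
        proof cases
          case 1
          show ?thesis
          proof (cases "h \<inter> insert x N = {}")
            case True
            then show ?thesis using 1 by (intro bexI[of _ h]) auto
          next
            case False
            then obtain y where "y \<in> h" "y \<in> N"
              using edge[OF 1(1)] by blast
            then show ?thesis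
              using 1 N(2) by (intro bexI[of _ "{y}"]) auto
          qed
        next
          case 2
          then show ?thesis
            using x less.prems(3) by (intro bexI[of _ "{z}"]) auto
        qed
      next
        fix e assume "e \<in> ?\<Gamma> \<union> (\<lambda>x. {x}) ` (X \<union> N)"
        then consider "e \<in> ?\<Gamma>" | z where "z \<in> X" "e = {z}" | y where "y \<in> N" "e = {y}"
          by blast
        then show "\<exists>e'\<in>(\<lambda>h. h - {x}) ` (\<Gamma> \<union> (\<lambda>x. {x}) ` X). e' \<subseteq> e"
        proof cases
          case 1
          then show ?thesis
            by (intro bexI[of _ "e - {x}"]) auto
        next
          case 2
          then show ?thesis
            by (intro bexI[of _ "{z} - {x}"]) auto
        next
          case 3
          then have "{x, y} - {x} \<in> (\<lambda>h. h - {x}) ` (\<Gamma> \<union> (\<lambda>x. {x}) ` X)"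
            by (intro imageI) (simp add: N_def)
          then show ?thesis
            using 3 by (intro bexI[of _ "{x, y} - {x}"]) auto
        qed
      qed
      moreover have "bounded_res V (mono_ideal V (?\<Gamma> \<union> (\<lambda>x. {x}) ` (X \<union> N)) ::
          ('v, 'k) mpoly set) (int (s - 1))"
      proof (rule less.hyps)
        show "card (A - insert x N) < card A"
          using fin_A x by (intro psubset_card_mono) auto
        show "dominated_whiskers (A - insert x N) ?\<Gamma>"
          unfolding N_def by (rule dominated_whiskers_delete_nbhd[OF less.prems(5) x])
        show "card M \<le> s - 1" if M: "induced_matching ?\<Gamma> M" for M
        proof -
          obtain e where e: "e \<notin> M" "induced_matching \<Gamma> (insert e M)"
            using induced_matching_insert[OF less.prems(5) x M[unfolded N_def]] by blast
          have "M \<subseteq> \<Gamma>"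
            using M by (auto simp: induced_matching_def matching_def)
          moreover have "finite \<Gamma>"
            using less.prems(4) assms(1) by (meson finite_UnionD finite_subset)
          ultimately have "finite M"
            by (rule finite_subset)
          then show ?thesis
            using less.prems(6)[OF e(2)] e(1) by simp
        qed
      qed (use less.prems(1-4) N(1) in blast)+
      moreover have "s \<ge> 1"
      proof -
        have "induced_matching ?\<Gamma> {}"
          using dominated_whiskers_edge[OF less.prems(5)] by (fastforce simp: induced_matching_def matching_def)
        then obtain e where "induced_matching \<Gamma> {e}"
          using induced_matching_insert[OF less.prems(5) x, of "{}"] unfolding N_def by metis
        then show ?thesis
          using less.prems(6)[of "{e}"] by simp
      qed
      ultimately show "bounded_res V (colon V ?I (sqfree_mon {x})) (int s - 1)"
        by (simp add: colon_mono_ideal[OF x_V] of_nat_diff)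
    qed
  qed
qed

text \<open>Disjoint edges form a regular sequence, so that the iterated mapping cone is a minimal
  resolution (the Koszul complex), whose last module is generated in degree twice its length.\<close>

lemma disjoint_edges_resolution:
  assumes "finite M" "disjoint M" "\<And>e. e \<in> M \<Longrightarrow> card e = 2" "\<Union>M \<subseteq> V"
  shows "\<exists>(B :: nat \<Rightarrow> nat set) d \<epsilon> \<phi>. gres V (mono_ideal V M :: ('v, 'k::field) mpoly set) B d \<epsilon> \<phi> \<and>
    minimal B \<phi> \<and> (\<exists>b\<in>B (card M). d (card M) b = 2 * int (card M))"
  using assms
proof (induction M)
  case empty
  let ?B = "\<lambda>i. if i = 0 then {0::nat} else {}" and ?\<phi> = "\<lambda>_ _ _. 0 :: ('v, 'k) mpoly"
  have "minimal ?B ?\<phi>"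
    by (simp add: minimal_def)
  then show ?case
    unfolding mono_ideal_empty using gres_zero_ideal[of V] by fastforce
next
  case (insert e M)
  let ?I = "mono_ideal V M :: ('v, 'k) mpoly set" and ?f = "sqfree_mon e :: ('v, 'k) mpoly"
  have e: "finite e" "e \<subseteq> V" "card e = 2" "e \<noteq> {}"
    using insert.prems(2)[of e] insert.prems(3) by (auto intro: card_ge_0_finite)
  have "disjoint M"
    using insert.prems(1) by (auto simp: pairwise_insert)
  then obtain B :: "nat \<Rightarrow> nat set" and d \<epsilon> \<phi> b where B: "gres V ?I B d \<epsilon> \<phi>" "minimal B \<phi>"
      "b \<in> B (card M)" "d (card M) b = 2 * int (card M)"
    using insert.IH insert.prems by blast
  have "h - e = h" if "h \<in> M" for h
    using insert.prems(1) insert.hyps(2) that by (auto simp: pairwise_insert disjnt_def)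
  then have colon: "colon V ?I ?f = ?I"
    using colon_mono_ideal[OF e(1,2), of M] by simp
  define BT where "BT = (\<lambda>i. B i <+> (if i = 0 then {} else B (i - 1)))"
  define dT where "dT = (\<lambda>i. case_sum (d i) (\<lambda>a. d (i - 1) a + 2))"
  have const: "const_term ?f = 0"
    using e(1,4) by (rule const_term_sqfree_mon)
  have "homogeneous 2 ?f"
    using homogeneous_sqfree_mon[OF e(1)] e(3) by (metis of_nat_numeral)
  then obtain \<epsilon>' \<phi>' where T: "gres V (adjoin V ?I ?f) BT dT \<epsilon>' \<phi>'" "minimal BT \<phi>'"
    using mapping_cone[OF hom_ideal_mono_ideal polys_sqfree_mon[OF e(1,2)] _ _ B(1), of 2] colon B(2)
      const unfolding BT_def dT_def by blast
  obtain h where "(\<forall>i. bij_betw (h i) {0..<card (BT i)} (BT i)) \<and>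
    gres V (adjoin V ?I ?f) (\<lambda>i. {0..<card (BT i)}) (\<lambda>i b. dT i (h i b)) (\<lambda>b. \<epsilon>' (h 0 b))
       (\<lambda>i a b. \<phi>' i (h i a) (h (Suc i) b))"
    by (rule exE[OF gres_to_nat[OF T(1)]])
  note h = this[THEN conjunct1, rule_format] this[THEN conjunct2]
  have hB: "h i a \<in> BT i" if "a \<in> {0..<card (BT i)}" for i a
    using bij_betwE[OF h(1)] that by blast
  have min: "minimal (\<lambda>i. {0..<card (BT i)}) (\<lambda>i a b. \<phi>' i (h i a) (h (Suc i) b))"
    unfolding minimal_def using T(2) hB unfolding minimal_def by blast
  have "Inr b \<in> BT (Suc (card M))"
    using B(3) by (simp add: BT_def InrI)
  then obtain b' where b': "b' \<in> {0..<card (BT (Suc (card M)))}" "h (Suc (card M)) b' = Inr b"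
    using h(1)[of "Suc (card M)"] unfolding bij_betw_def by (metis imageE)
  have card: "card (insert e M) = Suc (card M)"
    using insert.hyps by simp
  have "dT (card (insert e M)) (h (card (insert e M)) b') = 2 * int (card (insert e M))"
    unfolding card b'(2) using B(4) by (simp add: dT_def)
  moreover have "adjoin V ?I ?f = mono_ideal V (insert e M)"
    by (rule adjoin_mono_ideal[OF e(1,2)])
  ultimately show ?case
    using h(2) min b'(1) unfolding card
    by (intro exI[of _ "\<lambda>i. {0..<card (BT i)}"] exI[of _ "\<lambda>i b. dT i (h i b)"] exI
        conjI bexI[of _ b']) (simp_all add: card)
qed

section \<open>Minimal resolutions by matrices and the regularity\<close>

text \<open>For bases \<open>{0..<\<rho> i}\<close>, the two notions of graded free resolution agree.\<close>

lemma graded_free_resolution_iff_gres: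
  fixes I :: "('v, 'k::field) mpoly set"
  assumes \<epsilon>: "\<epsilon> \<in> carrier_vec (\<rho> 0)" "\<And>b. b < \<rho> 0 \<Longrightarrow> \<epsilon> $ b = \<epsilon>f b"
    and \<phi>: "\<And>i. \<phi> i \<in> carrier_mat (\<rho> i) (\<rho> (Suc i))"
      "\<And>i a b. a < \<rho> i \<Longrightarrow> b < \<rho> (Suc i) \<Longrightarrow> \<phi> i $$ (a, b) = \<phi>f i a b"
  shows "graded_free_resolution V I \<rho> d \<epsilon> \<phi> \<longleftrightarrow> gres V I (\<lambda>i. {0..<\<rho> i}) d \<epsilon>f \<phi>f"
proof -
  let ?B = "\<lambda>i. {0..<\<rho> i}"
  have dot: "\<epsilon> \<bullet> v = mv (?B 0) (\<lambda>_. \<epsilon>f) (\<lambda>b. v $ b) ()" if "v \<in> carrier_vec (\<rho> 0)" for v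
    using that \<epsilon>(2) by (auto simp: scalar_prod_def mv_def intro!: sum.cong)
  have mult: "(\<phi> i *\<^sub>v w) $ a = mv (?B (Suc i)) (\<phi>f i) (\<lambda>b. w $ b) a"
    if "w \<in> carrier_vec (\<rho> (Suc i))" "a < \<rho> i" for i w a
    using that \<phi>(1)[of i] \<phi>(2)[of a i] by (auto simp: scalar_prod_def mv_def intro!: sum.cong)
  have Z0: "{v \<in> free_module V (\<rho> 0). \<epsilon> \<bullet> v \<in> I} =
      {v \<in> free_module V (\<rho> 0). cyc I ?B \<epsilon>f \<phi>f 0 (\<lambda>b. v $ b)}"
    using dot by (auto simp: free_module_def cyc_0)
  have ZS: "{v \<in> free_module V (\<rho> (Suc i)). \<phi> i *\<^sub>v v = 0\<^sub>v (\<rho> i)} =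
      {v \<in> free_module V (\<rho> (Suc i)). cyc I ?B \<epsilon>f \<phi>f (Suc i) (\<lambda>b. v $ b)}" for i
  proof -
    have "\<phi> i *\<^sub>v v = 0\<^sub>v (\<rho> i) \<longleftrightarrow> (\<forall>a<\<rho> i. mv (?B (Suc i)) (\<phi>f i) (\<lambda>b. v $ b) a = 0)"
      if v: "v \<in> carrier_vec (\<rho> (Suc i))" for v
    proof
      assume eq: "\<phi> i *\<^sub>v v = 0\<^sub>v (\<rho> i)"
      show "\<forall>a<\<rho> i. mv (?B (Suc i)) (\<phi>f i) (\<lambda>b. v $ b) a = 0"
        using mult[OF v] unfolding eq by simp
    next
      assume "\<forall>a<\<rho> i. mv (?B (Suc i)) (\<phi>f i) (\<lambda>b. v $ b) a = 0"
      then show "\<phi> i *\<^sub>v v = 0\<^sub>v (\<rho> i)"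
        using \<phi>(1)[of i] mult[OF v] by (intro eq_vecI) auto
    qed
    then show ?thesis
      by (auto simp: free_module_def cyc_Suc)
  qed
  have Bnd: "(\<lambda>w. \<phi> i *\<^sub>v w) ` free_module V (\<rho> (Suc i)) =
      {v \<in> free_module V (\<rho> i). bnd V ?B \<phi>f i (\<lambda>b. v $ b)}"
    if entries: "\<And>a b. a < \<rho> i \<Longrightarrow> b < \<rho> (Suc i) \<Longrightarrow> \<phi>f i a b \<in> polys V" for i
  proof (intro equalityI subsetI)
    fix v assume "v \<in> (\<lambda>w. \<phi> i *\<^sub>v w) ` free_module V (\<rho> (Suc i))"
    then obtain w where w: "w \<in> carrier_vec (\<rho> (Suc i))" "\<And>b. b < \<rho> (Suc i) \<Longrightarrow> w $ b \<in> polys V"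
        "v = \<phi> i *\<^sub>v w"
      by (auto simp: free_module_def)
    have v: "v $ a = mv (?B (Suc i)) (\<phi>f i) (\<lambda>b. w $ b) a" if "a < \<rho> i" for a
      unfolding w(3) using mult[OF w(1) that] .
    moreover have "mv (?B (Suc i)) (\<phi>f i) (\<lambda>b. w $ b) a \<in> polys V" if "a < \<rho> i" for a
      using entries[OF that] w(2) by auto
    moreover have "v \<in> carrier_vec (\<rho> i)"
      unfolding w(3) using \<phi>(1) w(1) by (rule mult_mat_vec_carrier)
    ultimately show "v \<in> {v \<in> free_module V (\<rho> i). bnd V ?B \<phi>f i (\<lambda>b. v $ b)}"
      using w(2) by (auto simp: free_module_def intro: bndI[of _ _ "\<lambda>b. w $ b"])
  next
    fix v assume "v \<in> {v \<in> free_module V (\<rho> i). bnd V ?B \<phi>f i (\<lambda>b. v $ b)}"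
    then have v: "v \<in> carrier_vec (\<rho> i)" and "bnd V ?B \<phi>f i (\<lambda>b. v $ b)"
      by (auto simp: free_module_def)
    from this(2) obtain w where "(\<forall>b\<in>?B (Suc i). w b \<in> polys V) \<and>
        (\<forall>a\<in>?B i. v $ a = mv (?B (Suc i)) (\<phi>f i) w a)"
      by (rule bndD[THEN exE])
    note w = this[THEN conjunct1, rule_format] this[THEN conjunct2, rule_format]
    let ?w = "vec (\<rho> (Suc i)) w"
    have "v = \<phi> i *\<^sub>v ?w"
    proof (rule eq_vecI)
      fix a assume "a < dim_vec (\<phi> i *\<^sub>v ?w)"
      then have a: "a < \<rho> i" using \<phi>(1)[of i] by simp
      have "mv (?B (Suc i)) (\<phi>f i) (\<lambda>b. ?w $ b) a = mv (?B (Suc i)) (\<phi>f i) w a"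
        by (rule mv_cong) auto
      then show "v $ a = (\<phi> i *\<^sub>v ?w) $ a"
        using mult[of ?w i a] a w(2)[of a] by simp
    qed (use v \<phi>(1)[of i] in simp)
    moreover have "?w \<in> free_module V (\<rho> (Suc i))"
      using w(1) by (simp add: free_module_def)
    ultimately show "v \<in> (\<lambda>w. \<phi> i *\<^sub>v w) ` free_module V (\<rho> (Suc i))"
      by blast
  qed
  have exact: "{v \<in> free_module V (\<rho> i). cyc I ?B \<epsilon>f \<phi>f i (\<lambda>b. v $ b)} =
        {v \<in> free_module V (\<rho> i). bnd V ?B \<phi>f i (\<lambda>b. v $ b)} \<longleftrightarrow>
      (\<forall>y\<in>?B i \<rightarrow> polys V. cyc I ?B \<epsilon>f \<phi>f i y \<longleftrightarrow> bnd V ?B \<phi>f i y)" (is "?l \<longleftrightarrow> ?r") for i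
  proof
    assume l: ?l
    show ?r
    proof
      fix y :: "nat \<Rightarrow> ('v, 'k) mpoly" assume y: "y \<in> ?B i \<rightarrow> polys V"
      let ?v = "vec (\<rho> i) y"
      have v: "?v \<in> free_module V (\<rho> i)"
        using y by (auto simp: free_module_def)
      have "cyc I ?B \<epsilon>f \<phi>f i y \<longleftrightarrow> cyc I ?B \<epsilon>f \<phi>f i (\<lambda>b. ?v $ b)"
        by (rule cyc_cong) simp
      also have "\<dots> \<longleftrightarrow> bnd V ?B \<phi>f i (\<lambda>b. ?v $ b)"
        using l v by blast
      also have "\<dots> \<longleftrightarrow> bnd V ?B \<phi>f i y"
        by (rule bnd_cong) simp
      finally show "cyc I ?B \<epsilon>f \<phi>f i y \<longleftrightarrow> bnd V ?B \<phi>f i y" .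
    qed
  next
    assume r: ?r
    have "(\<lambda>b. v $ b) \<in> ?B i \<rightarrow> polys V" if "v \<in> free_module V (\<rho> i)" for v
      using that by (auto simp: free_module_def)
    then show ?l
      using r by blast
  qed
  have surj: "(\<exists>v\<in>free_module V (\<rho> 0). p - \<epsilon> \<bullet> v \<in> I) \<longleftrightarrow>
      (\<exists>v\<in>?B 0 \<rightarrow> polys V. p - mv (?B 0) (\<lambda>_. \<epsilon>f) v () \<in> I)" for p
  proof
    assume "\<exists>v\<in>free_module V (\<rho> 0). p - \<epsilon> \<bullet> v \<in> I"
    then obtain v where v: "v \<in> free_module V (\<rho> 0)" "p - \<epsilon> \<bullet> v \<in> I" by blast
    then have "p - mv (?B 0) (\<lambda>_. \<epsilon>f) (\<lambda>b. v $ b) () \<in> I"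
      using dot[of v] by (simp add: free_module_def)
    moreover have "(\<lambda>b. v $ b) \<in> ?B 0 \<rightarrow> polys V"
      using v(1) by (auto simp: free_module_def)
    ultimately show "\<exists>v\<in>?B 0 \<rightarrow> polys V. p - mv (?B 0) (\<lambda>_. \<epsilon>f) v () \<in> I"
      by (rule bexI)
  next
    assume "\<exists>v\<in>?B 0 \<rightarrow> polys V. p - mv (?B 0) (\<lambda>_. \<epsilon>f) v () \<in> I"
    then obtain v where v: "v \<in> ?B 0 \<rightarrow> polys V" "p - mv (?B 0) (\<lambda>_. \<epsilon>f) v () \<in> I" by blast
    have "mv (?B 0) (\<lambda>_. \<epsilon>f) (\<lambda>b. vec (\<rho> 0) v $ b) () = mv (?B 0) (\<lambda>_. \<epsilon>f) v ()"
      by (rule mv_cong) auto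
    then have "p - \<epsilon> \<bullet> vec (\<rho> 0) v \<in> I"
      using dot[of "vec (\<rho> 0) v"] v(2) by simp
    moreover have "vec (\<rho> 0) v \<in> free_module V (\<rho> 0)"
      using v(1) by (auto simp: free_module_def)
    ultimately show "\<exists>v\<in>free_module V (\<rho> 0). p - \<epsilon> \<bullet> v \<in> I"
      by (rule bexI)
  qed
  define E where "E \<longleftrightarrow> (\<forall>i. \<forall>a\<in>?B i. \<forall>b\<in>?B (Suc i). \<phi>f i a b \<in> polys V \<and>
      homogeneous (d (Suc i) b - d i a) (\<phi>f i a b))"
  have 1: "\<epsilon> \<in> free_module V (\<rho> 0) \<and> (\<forall>b<\<rho> 0. homogeneous (d 0 b) (\<epsilon> $ b)) \<longleftrightarrow>
      (\<forall>b\<in>?B 0. \<epsilon>f b \<in> polys V \<and> homogeneous (d 0 b) (\<epsilon>f b))" (is "?L1 \<longleftrightarrow> ?R1")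
    using \<epsilon> by (auto simp: free_module_def)
  have 2: "(\<forall>i. \<phi> i \<in> carrier_mat (\<rho> i) (\<rho> (Suc i)) \<and> (\<forall>a<\<rho> i. \<forall>b<\<rho> (Suc i).
      \<phi> i $$ (a, b) \<in> polys V \<and> homogeneous (d (Suc i) b - d i a) (\<phi> i $$ (a, b)))) \<longleftrightarrow> E" (is "?L2 \<longleftrightarrow> E")
    using \<phi> by (simp add: E_def Ball_def)
  have 3: "{v \<in> free_module V (\<rho> 0). \<epsilon> \<bullet> v \<in> I} = (\<lambda>w. \<phi> 0 *\<^sub>v w) ` free_module V (\<rho> 1) \<and>
     (\<forall>i. {v \<in> free_module V (\<rho> (Suc i)). \<phi> i *\<^sub>v v = 0\<^sub>v (\<rho> i)} =
          (\<lambda>w. \<phi> (Suc i) *\<^sub>v w) ` free_module V (\<rho> (Suc (Suc i)))) \<longleftrightarrow>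
     (\<forall>i. \<forall>y\<in>?B i \<rightarrow> polys V. cyc I ?B \<epsilon>f \<phi>f i y \<longleftrightarrow> bnd V ?B \<phi>f i y)"
    (is "?L3 \<longleftrightarrow> ?R3") if E
  proof -
    have entries: "\<phi>f i a b \<in> polys V" if "a < \<rho> i" "b < \<rho> (Suc i)" for i a b
      using \<open>E\<close> that by (auto simp: E_def)
    have Bnd': "(\<lambda>w. \<phi> i *\<^sub>v w) ` free_module V (\<rho> (Suc i)) =
        {v \<in> free_module V (\<rho> i). bnd V ?B \<phi>f i (\<lambda>b. v $ b)}" for i
      by (rule Bnd) (rule entries)
    have "(\<forall>i. P i) \<longleftrightarrow> P 0 \<and> (\<forall>i. P (Suc i))" for P :: "nat \<Rightarrow> bool"
      by (metis not0_implies_Suc)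
    from this[of "\<lambda>i. \<forall>y\<in>?B i \<rightarrow> polys V. cyc I ?B \<epsilon>f \<phi>f i y \<longleftrightarrow> bnd V ?B \<phi>f i y"] show ?thesis
      unfolding Z0 ZS One_nat_def Bnd' exact by simp
  qed
  have 4: "(\<forall>p\<in>polys V. \<exists>v\<in>free_module V (\<rho> 0). p - \<epsilon> \<bullet> v \<in> I) \<longleftrightarrow>
      (\<forall>p\<in>polys V. \<exists>v\<in>?B 0 \<rightarrow> polys V. p - mv (?B 0) (\<lambda>_. \<epsilon>f) v () \<in> I)" (is "?L4 \<longleftrightarrow> ?R4")
    by (simp only: surj)
  have "graded_free_resolution V I \<rho> d \<epsilon> \<phi> \<longleftrightarrow> ?L1 \<and> ?L2 \<and> ?L4 \<and> ?L3"
    unfolding graded_free_resolution_def by (simp only: conj_assoc)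
  moreover have "gres V I ?B d \<epsilon>f \<phi>f \<longleftrightarrow> ?R1 \<and> E \<and> ?R4 \<and> ?R3"
    unfolding gres_def E_def by (simp only: finite_atLeastLessThan simp_thms)
  moreover have "E \<longrightarrow> (?L3 \<longleftrightarrow> ?R3)"
    using 3 by (rule impI)
  ultimately show ?thesis
    using 1 2 4 by argo
qed

lemma minimal_graded_free_resolution_gres:
  fixes I :: "('v, 'k::field) mpoly set"
  assumes "minimal_graded_free_resolution V I \<rho> d \<epsilon> \<phi>"
  shows "gres V I (\<lambda>i. {0..<\<rho> i}) d (\<lambda>b. \<epsilon> $ b) (\<lambda>i a b. \<phi> i $$ (a, b))"
    and "minimal (\<lambda>i. {0..<\<rho> i}) (\<lambda>i a b. \<phi> i $$ (a, b))"
proof -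
  have g: "graded_free_resolution V I \<rho> d \<epsilon> \<phi>"
    using assms by (simp add: minimal_graded_free_resolution_def)
  then have "\<epsilon> \<in> carrier_vec (\<rho> 0)" "\<And>i. \<phi> i \<in> carrier_mat (\<rho> i) (\<rho> (Suc i))"
    by (auto simp: graded_free_resolution_def free_module_def)
  then show "gres V I (\<lambda>i. {0..<\<rho> i}) d (\<lambda>b. \<epsilon> $ b) (\<lambda>i a b. \<phi> i $$ (a, b))"
    using g graded_free_resolution_iff_gres[of \<epsilon> \<rho> "\<lambda>b. \<epsilon> $ b" \<phi> "\<lambda>i a b. \<phi> i $$ (a, b)" V I d] by simp
  show "minimal (\<lambda>i. {0..<\<rho> i}) (\<lambda>i a b. \<phi> i $$ (a, b))"
    using assms by (simp add: minimal_graded_free_resolution_def minimal_def const_term_def)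
qed

text \<open>Betti numbers may be read off from any minimal resolution.\<close>

lemma graded_betti_eq:
  assumes I: "hom_ideal V I" and m: "minimal_graded_free_resolution V I \<rho> d \<epsilon> \<phi>"
  shows "graded_betti V I i j = card {b. b < \<rho> i \<and> d i b = j}"
proof -
  have le: "card {b. b < \<rho> i \<and> d i b = j} \<le> card {b. b < \<rho>' i \<and> d' i b = j}"
    if "minimal_graded_free_resolution V I \<rho> d \<epsilon> \<phi>" "minimal_graded_free_resolution V I \<rho>' d' \<epsilon>' \<phi>'"
    for \<rho> d \<epsilon> \<phi> \<rho>' d' \<epsilon>' \<phi>'
  proof -
    have "restr V ` I \<subseteq> I"
      using ideal_polys[OF I] by (auto simp: restr_id)
    from betti_retract_le[OF I I minimal_graded_free_resolution_gres[OF that(1)]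
        minimal_graded_free_resolution_gres(1)[OF that(2)] order_refl order_refl this, of i j]
    show ?thesis by simp
  qed
  show ?thesis
    unfolding graded_betti_def
  proof (rule the_equality)
    show "\<exists>\<rho>' d' \<epsilon> \<phi>. minimal_graded_free_resolution V I \<rho>' d' \<epsilon> \<phi> \<and>
        card {b. b < \<rho> i \<and> d i b = j} = card {b. b < \<rho>' i \<and> d' i b = j}"
      using m by blast
  next
    fix \<beta> assume "\<exists>\<rho> d \<epsilon> \<phi>. minimal_graded_free_resolution V I \<rho> d \<epsilon> \<phi> \<and>
        \<beta> = card {b. b < \<rho> i \<and> d i b = j}"
    then obtain \<rho>' d' \<epsilon>' \<phi>' where m': "minimal_graded_free_resolution V I \<rho>' d' \<epsilon>' \<phi>'"
        and \<beta>: "\<beta> = card {b. b < \<rho>' i \<and> d' i b = j}"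
      by blast
    show "\<beta> = card {b. b < \<rho> i \<and> d i b = j}"
      unfolding \<beta> using le[OF m m'] le[OF m' m] by (rule antisym[rotated])
  qed
qed

lemma bounded_res_minimal_resolution:
  fixes I :: "('v, 'k::field) mpoly set"
  assumes I: "hom_ideal V I" and "bounded_res V I s"
  shows "\<exists>\<rho> d \<epsilon> \<phi>. minimal_graded_free_resolution V I \<rho> d \<epsilon> \<phi> \<and> (\<forall>i. \<forall>b<\<rho> i. d i b \<le> int i + s)"
proof -
  obtain B :: "nat \<Rightarrow> nat set" and d \<epsilon> \<phi> N where B: "gres V I B d \<epsilon> \<phi>"
    "\<And>i. i \<ge> N \<Longrightarrow> B i = {}" "\<And>i b. b \<in> B i \<Longrightarrow> d i b \<le> int i + s"
    using assms(2) unfolding bounded_res_def by blast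
  obtain B' \<phi>' where B': "gres V I B' d \<epsilon> \<phi>'" "minimal B' \<phi>'" "\<And>i. B' i \<subseteq> B i"
    using exists_minimal_gres[OF I B(1,2)] by blast
  obtain h where "(\<forall>i. bij_betw (h i) {0..<card (B' i)} (B' i)) \<and>
    gres V I (\<lambda>i. {0..<card (B' i)}) (\<lambda>i b. d i (h i b)) (\<lambda>b. \<epsilon> (h 0 b))
       (\<lambda>i a b. \<phi>' i (h i a) (h (Suc i) b))"
    by (rule exE[OF gres_to_nat[OF B'(1)]])
  note h = this[THEN conjunct1, rule_format] this[THEN conjunct2]
  have hB: "h i a \<in> B' i" if "a < card (B' i)" for i a
    using bij_betwE[OF h(1)[of i]] that by simp
  let ?\<rho> = "\<lambda>i. card (B' i)"
  let ?\<epsilon> = "vec (?\<rho> 0) (\<lambda>b. \<epsilon> (h 0 b))"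
  let ?\<phi> = "\<lambda>i. mat (?\<rho> i) (?\<rho> (Suc i)) (\<lambda>(a, b). \<phi>' i (h i a) (h (Suc i) b))"
  have "graded_free_resolution V I ?\<rho> (\<lambda>i b. d i (h i b)) ?\<epsilon> ?\<phi>"
    by (subst graded_free_resolution_iff_gres[where \<epsilon>f = "\<lambda>b. \<epsilon> (h 0 b)"
        and \<phi>f = "\<lambda>i a b. \<phi>' i (h i a) (h (Suc i) b)"]) (simp_all add: h(2))
  moreover have "Poly_Mapping.lookup (?\<phi> i $$ (a, b)) 0 = 0" if "a < ?\<rho> i" "b < ?\<rho> (Suc i)" for i a b
    using B'(2) hB[OF that(1)] hB[OF that(2)] that by (simp add: minimal_def const_term_def)
  ultimately have "minimal_graded_free_resolution V I ?\<rho> (\<lambda>i b. d i (h i b)) ?\<epsilon> ?\<phi>"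
    unfolding minimal_graded_free_resolution_def by blast
  moreover have "\<forall>i. \<forall>b<?\<rho> i. d i (h i b) \<le> int i + s"
    using B(3) B'(3) hB by blast
  ultimately show ?thesis
    by (intro exI conjI)
qed

text \<open>An induced matching with \<open>m\<close> edges causes a nonzero Betti number in homological degree \<open>m\<close> and
  degree \<open>2m\<close>. As the matching is induced, killing the other variables maps the edge ideal of the
  graph onto that of the matching.\<close>

lemma induced_matching_betti:
  fixes \<Gamma> :: "'v set set"
  assumes V: "finite V" "\<Union>\<Gamma> \<subseteq> V" and \<Gamma>: "\<And>e. e \<in> \<Gamma> \<Longrightarrow> card e = 2"
    and M: "induced_matching \<Gamma> M"
    and m: "minimal_graded_free_resolution V (mono_ideal V \<Gamma> :: ('v, 'k::field) mpoly set) \<rho> d \<epsilon> \<phi>"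
  shows "\<exists>b<\<rho> (card M). d (card M) b = 2 * int (card M)"
proof -
  let ?U = "\<Union>M"
  have M': "M \<subseteq> \<Gamma>" "disjoint M" "\<And>e. e \<in> \<Gamma> \<Longrightarrow> e \<subseteq> ?U \<Longrightarrow> e \<in> M"
    using M by (auto simp: induced_matching_def matching_def)
  have "finite \<Gamma>"
    using V by (meson finite_UnionD finite_subset)
  then have "finite M"
    using M'(1) finite_subset by blast
  moreover have "card e = 2" if "e \<in> M" for e
    using that M'(1) \<Gamma> by blast
  ultimately have "\<exists>(B :: nat \<Rightarrow> nat set) d \<epsilon> \<phi>. gres ?U (mono_ideal ?U M :: ('v, 'k) mpoly set) B d \<epsilon> \<phi> \<and>
      minimal B \<phi> \<and> (\<exists>b\<in>B (card M). d (card M) b = 2 * int (card M))"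
    by (rule disjoint_edges_resolution[OF _ M'(2) _ order_refl])
  then obtain B :: "nat \<Rightarrow> nat set" and dM \<epsilon>M \<phi>M b where
    B: "gres ?U (mono_ideal ?U M :: ('v, 'k) mpoly set) B dM \<epsilon>M \<phi>M" "minimal B \<phi>M"
      "b \<in> B (card M)" "dM (card M) b = 2 * int (card M)"
    by (elim exE conjE bexE)
  have U: "?U \<subseteq> V"
    using M'(1) V(2) by blast
  have "mono_ideal ?U M \<subseteq> (mono_ideal V \<Gamma> :: ('v, 'k) mpoly set)"
  proof
    fix p :: "('v, 'k) mpoly" assume "p \<in> mono_ideal ?U M"
    then show "p \<in> mono_ideal V \<Gamma>"
      using polys_mono[OF U, of p] M'(1) unfolding mono_ideal_iff by (meson subsetD)
  qed
  moreover have "restr ?U ` mono_ideal V \<Gamma> \<subseteq> (mono_ideal ?U M :: ('v, 'k) mpoly set)"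
  proof (rule image_subsetI)
    fix p :: "('v, 'k) mpoly" assume p: "p \<in> mono_ideal V \<Gamma>"
    have "\<exists>e\<in>M. e \<subseteq> Poly_Mapping.keys m" if m: "m \<in> Poly_Mapping.keys (restr ?U p)" for m
    proof -
      have mp: "m \<in> Poly_Mapping.keys p" and mU: "Poly_Mapping.keys m \<subseteq> ?U"
        using m by (simp_all add: restr_def keys_pfilter)
      obtain e where e: "e \<in> \<Gamma>" "e \<subseteq> Poly_Mapping.keys m"
        using p mp by (auto simp: mono_ideal_iff)
      then have "e \<in> M"
        using M'(3)[OF e(1) order_trans[OF e(2) mU]] by simp
      then show ?thesis
        using e(2) by (rule bexI[rotated])
    qed
    then show "restr ?U p \<in> mono_ideal ?U M"
      using polys_restr[of ?U p] by (simp add: mono_ideal_iff)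
  qed
  ultimately have le: "card {b \<in> B (card M). dM (card M) b = 2 * int (card M)} \<le>
      card {b \<in> {0..<\<rho> (card M)}. d (card M) b = 2 * int (card M)}"
    by (rule betti_retract_le[OF hom_ideal_mono_ideal hom_ideal_mono_ideal B(1,2)
        minimal_graded_free_resolution_gres(1)[OF m] U])
  have "finite (B (card M))"
    using B(1) by (simp add: gres_def)
  then have "0 < card {b \<in> B (card M). dM (card M) b = 2 * int (card M)}"
    using B(3,4) by (auto simp: card_gt_0_iff)
  from this le have "0 < card {b \<in> {0..<\<rho> (card M)}. d (card M) b = 2 * int (card M)}"
    by (rule order.strict_trans2)
  then show ?thesis
    by (auto simp: card_gt_0_iff)
qed

theorem reg_quotient_dominated_whiskers:
  fixes \<Gamma> :: "'v set set"
  assumes V: "finite V" "\<Union>\<Gamma> \<subseteq> V" "A \<subseteq> V" and W: "dominated_whiskers A \<Gamma>"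
  shows "reg_quotient V (edge_ideal V \<Gamma> :: ('v, 'k::field) mpoly set) =
    ereal (real (induced_matching_number \<Gamma>))"
proof -
  let ?I = "mono_ideal V \<Gamma> :: ('v, 'k) mpoly set" and ?s = "induced_matching_number \<Gamma>"
  have \<Gamma>: "card e = 2" "e \<subseteq> V" if "e \<in> \<Gamma>" for e
    using dominated_whiskers_edge[OF W that] V(2) that by auto
  have I: "edge_ideal V \<Gamma> = ?I"
    by (rule edge_ideal_eq_mono_ideal) (use \<Gamma> in blast)
  have "finite \<Gamma>"
    using V(1,2) by (meson finite_UnionD finite_subset)
  moreover have "{M. induced_matching \<Gamma> M} \<subseteq> Pow \<Gamma>"
    by (auto simp: induced_matching_def matching_def)
  ultimately have "finite {M. induced_matching \<Gamma> M}"
    using finite_subset by auto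
  then have fin: "finite {card M | M. induced_matching \<Gamma> M}"
    by (simp add: setcompr_eq_image)
  have "{} \<notin> \<Gamma>"
    using \<Gamma>(1)[of "{}"] by auto
  then have empty: "induced_matching \<Gamma> {}"
    by (auto simp: induced_matching_def matching_def)
  then have "?s \<in> {card M | M. induced_matching \<Gamma> M}"
    unfolding induced_matching_number_def using fin by (intro Max_in) auto
  then obtain M where M: "induced_matching \<Gamma> M" "card M = ?s" by auto
  have max: "card M \<le> ?s" if "induced_matching \<Gamma> M" for M
    unfolding induced_matching_number_def using fin that by (intro Max_ge) auto
  have "bounded_res V ?I (int ?s)"
    using bounded_res_dominated_whiskers[OF V(1,3) empty_subsetI _ V(2) W max] by simp
  then obtain \<rho> d \<epsilon> \<phi> where m: "minimal_graded_free_resolution V ?I \<rho> d \<epsilon> \<phi>"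
      and bound: "\<And>i b. b < \<rho> i \<Longrightarrow> d i b \<le> int i + int ?s"
    using bounded_res_minimal_resolution[OF hom_ideal_mono_ideal] by blast
  note betti = graded_betti_eq[OF hom_ideal_mono_ideal m]
  show ?thesis
    unfolding I reg_quotient_def
  proof (rule antisym)
    show "Sup {ereal (real_of_int (j - int i)) | i j. graded_betti V ?I i j \<noteq> 0} \<le> ereal (real ?s)"
    proof (rule Sup_least)
      fix r assume "r \<in> {ereal (real_of_int (j - int i)) | i j. graded_betti V ?I i j \<noteq> 0}"
      then obtain i j where r: "r = ereal (real_of_int (j - int i))" "graded_betti V ?I i j \<noteq> 0"
        by blast
      then have "{b. b < \<rho> i \<and> d i b = j} \<noteq> {}"
        by (metis betti card.empty)
      then have "j - int i \<le> int ?s"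
        using bound[of _ i] by force
      then show "r \<le> ereal (real ?s)"
        unfolding r(1) by (simp only: ereal_less_eq)
    qed
    obtain b where "b < \<rho> ?s" "d ?s b = 2 * int ?s"
      using induced_matching_betti[OF V(1,2) \<Gamma>(1) M(1) m] M(2) by auto
    then have "graded_betti V ?I ?s (2 * int ?s) \<noteq> 0"
      unfolding betti by (auto simp: card_eq_0_iff)
    then have "ereal (real_of_int (2 * int ?s - int ?s)) \<in>
        {ereal (real_of_int (j - int i)) | i j. graded_betti V ?I i j \<noteq> 0}"
      by blast
    from Sup_upper[OF this]
    show "ereal (real ?s) \<le> Sup {ereal (real_of_int (j - int i)) | i j. graded_betti V ?I i j \<noteq> 0}"
      by simp
  qed
qed

text \<open>The whisker \<open>Whisk i 1\<close> of a vertex in \<open>W i\<close> exists because \<open>n i \<ge> 1\<close>; its neighbours form the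
  clique \<open>W i\<close>.\<close>

lemma whiskered_dominated_whiskers:
  assumes G: "simple_graph V E" and P: "clique_partition V E r W" and n: "\<forall>i\<in>{1..r}. n i \<ge> 1"
  shows "dominated_whiskers (Orig ` V) (whiskered_edges E r W n)"
  unfolding dominated_whiskers_def
proof (intro conjI ballI)
  fix e assume "e \<in> whiskered_edges E r W n"
  then consider e' where "e' \<in> E" "e = Orig ` e'"
    | x i k where "i \<in> {1..r}" "x \<in> W i" "e = {Orig x, Whisk i k}"
    unfolding whiskered_edges_def by blast
  then have "card e = 2 \<and> e \<inter> Orig ` V \<noteq> {}"
  proof cases
    case 1
    have "card e' = 2" "e' \<subseteq> V"
      using G 1(1) by (auto simp: simple_graph_def)
    moreover from this have "e' \<noteq> {}" by auto
    ultimately show ?thesis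
      using 1(2) by (auto simp: card_image inj_on_def)
  next
    case 2
    have "x \<in> (\<Union>i\<in>{1..r}. W i)"
      using 2(1,2) by (rule UN_I)
    then have "x \<in> V"
      using P unfolding clique_partition_def by blast
    then show ?thesis
      using 2(3) by auto
  qed
  then show "card e = 2" "e \<inter> Orig ` V \<noteq> {}"
    by simp_all
next
  fix v assume "v \<in> Orig ` V"
  then obtain x i where x: "v = Orig x" "i \<in> {1..r}" "x \<in> W i"
    using P by (auto simp: clique_partition_def)
  have "y = v \<or> {v, y} \<in> whiskered_edges E r W n" if y: "{Whisk i 1, y} \<in> whiskered_edges E r W n" for y
  proof -
    obtain z where z: "z \<in> W i" "y = Orig z"
    proof -
      have "{Whisk i 1, y} \<noteq> Orig ` e" for e
        by (metis imageE insertI1 whisker_vertex.distinct(1))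
      then have "{Whisk i 1, y} \<notin> (\<lambda>e. Orig ` e) ` E"
        by (metis imageE)
      then obtain z i' k where "{Whisk i 1, y} = {Orig z, Whisk i' k}" "z \<in> W i'"
        using y unfolding whiskered_edges_def by blast
      then show ?thesis
        using that[of z] by (auto simp: doubleton_eq_iff)
    qed
    have "clique (W i) E"
      using P x(2) by (simp add: clique_partition_def)
    then have "z = x \<or> {x, z} \<in> E"
      using x(3) z(1) by (cases "z = x") (simp_all add: clique_def)
    then show ?thesis
    proof
      assume "{x, z} \<in> E"
      then have "Orig ` {x, z} \<in> whiskered_edges E r W n"
        unfolding whiskered_edges_def by (intro UnI1 imageI)
      then show ?thesis
        by (simp add: x(1) z(2))
    qed (simp add: x(1) z(2))
  qed
  moreover have "{v, Whisk i 1} \<in> whiskered_edges E r W n"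
  proof -
    have "1 \<in> {1..n i}"
      using n x(2) by simp
    then show ?thesis
      unfolding x(1) whiskered_edges_def using x(2,3) by blast
  qed
  ultimately show "\<exists>w. w \<notin> Orig ` V \<and> {v, w} \<in> whiskered_edges E r W n \<and>
      (\<forall>y. {w, y} \<in> whiskered_edges E r W n \<longrightarrow> y = v \<or> {v, y} \<in> whiskered_edges E r W n)"
    by (intro exI[of _ "Whisk i 1"]) auto
qed

lemma finite_whiskered_verts:
  assumes "finite V"
  shows "finite (whiskered_verts V r n)"
proof -
  have "{Whisk i k | i k. i \<in> {1..r} \<and> k \<in> {1..n i}} =
      (\<lambda>(i, k). Whisk i k :: 'a whisker_vertex) ` (SIGMA i:{1..r}. {1..n i})"
    by auto
  then show ?thesis
    using assms by (simp add: whiskered_verts_def)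
qed

theorem corollary5p7:
  fixes V :: "'a set" and E :: "'a set set"
    and r :: nat and W :: "nat \<Rightarrow> 'a set" and n :: "nat \<Rightarrow> nat"
  assumes "simple_graph V E"
    and "clique_partition V E r W"
    and "\<forall>i\<in>{1..r}. n i \<ge> 1"
  shows "reg_quotient (whiskered_verts V r n)
           (edge_ideal (whiskered_verts V r n) (whiskered_edges E r W n)
              :: ('a whisker_vertex, 'k::field) mpoly set)
         = ereal (real (induced_matching_number (whiskered_edges E r W n)))"
proof (rule reg_quotient_dominated_whiskers)
  show "finite (whiskered_verts V r n)"
    using assms(1) by (intro finite_whiskered_verts) (simp add: simple_graph_def)
  show "\<Union>(whiskered_edges E r W n) \<subseteq> whiskered_verts V r n"
    using assms(1,2)
    by (fastforce simp: whiskered_edges_def whiskered_verts_def simple_graph_def clique_partition_def)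
  show "Orig ` V \<subseteq> whiskered_verts V r n"
    by (auto simp: whiskered_verts_def)
  show "dominated_whiskers (Orig ` V) (whiskered_edges E r W n)"
    using assms by (rule whiskered_dominated_whiskers)
qed

end
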